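(* Let $f\in L^2(\Omega)$ and let $u\in H^2_0(\Omega)$ be the solution of $a(u,v)=(f,v)_{L^2(\Omega)}$ for all $v\in H^2_0(\Omega)$. Suppose that $u\in H^4(\Omega)$. Then for any $w_h\in V_h$ (the three-dimensional cubic Morley element space), $$a_h(u,w_h)-(f,w_h)_{L^2(\Omega)}\le Ch^2\big(\|f\|_{L^2(\Omega)}+|u|_{H^4(\Omega)}\big)|w_h|_h,$$ where $C>0$ is a constant independent of the meshsize $h$, of $f$, $u$ and $w_h$.
   Context: $\Omega\subset\mathbb{R}^3$ is a bounded Lipschitz domain and $\mathcal{T}_h$ is a uniform partition of $\Omega$ into axis-parallel cubes $K$; each $K$ with center $(x_{1,c},x_{2,c},x_{3,c})$ is mapped to $[-1,1]^3$ by $\xi_i=(x_i-x_{i,c})/h$, $i=1,2,3$ (so $K$ has side length $2h$). Continuous form: $a(u,v)=(\nabla^2u,\nabla^2v)_{L^2(\Omega)}$, with $\nabla^2$ the Hessian matrix (weak form of $\Delta^2u=f$ in $\Omega$, $u=\partial u/\partial n=0$ on $\partial\Omega$). Cubic Morley space: $P(K)=P_2(K)+\mathrm{span}\{x_1^3,x_2^3,x_3^3,x_1x_2x_3\}$, where $P_l(K)$ denotes polynomials of total degree $\le l$ on $K$. $V_h$ is the set of $v\in L^2(\Omega)$ with $v|_K\in P(K)$ for all $K\in\mathcal{T}_h$, such that $v$ is continuous at all internal vertices and vanishes at all boundary vertices of $\mathcal{T}_h$, and $\int_F\frac{\partial v}{\partial n_F}\,ds$ is continuous across each internal face $F$ and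 vanishes on each boundary face $F$. Discrete form: $a_h(v,w)=\sum_{K\in\mathcal{T}_h}\int_K\nabla^2v:\nabla^2w\,dx$ (Hessian element by element) and $|v|_h^2=a_h(v,v)$ for piecewise $H^2$ functions. *)

theory Defs
  imports "HOL-Analysis.Analysis"
begin

section \<open>Classical derivatives and test functions\<close>

definition partial_deriv :: "'n \<Rightarrow> (real^'n \<Rightarrow> real) \<Rightarrow> real^'n \<Rightarrow> real" where
  "partial_deriv i f x = frechet_derivative f (at x) (axis i 1)"

text \<open>A list of coordinate directions plays the role of a multi-index:
  \<open>partial_derivs [i, j] f\<close> is \<open>\<partial>\<^sub>i \<partial>\<^sub>j f\<close>.\<close>

definition partial_derivs :: "'n list \<Rightarrow> (real^'n \<Rightarrow> real) \<Rightarrow> real^'n \<Rightarrow> real" where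
  "partial_derivs is f = foldr partial_deriv is f"

definition test_functions :: "(real^'n) set \<Rightarrow> (real^'n \<Rightarrow> real) set" where
  "test_functions \<Omega> = {\<phi>. (\<forall>is. partial_derivs is \<phi> differentiable_on UNIV) \<and>
     compact (closure {x. \<phi> x \<noteq> 0}) \<and> closure {x. \<phi> x \<noteq> 0} \<subseteq> \<Omega>}"

section \<open>Lebesgue and Sobolev spaces\<close>

text \<open>Elements of these spaces are represented by total functions, of which only the values
  almost everywhere on \<open>\<Omega>\<close> matter.\<close>

definition L2 :: "(real^'n) set \<Rightarrow> (real^'n \<Rightarrow> real) set" where
  "L2 \<Omega> = {f \<in> borel_measurable (lebesgue_on \<Omega>). integrable (lebesgue_on \<Omega>) (\<lambda>x. (f x)\<^sup>2)}"

definition L2_inner :: "(real^'n) set \<Rightarrow> (real^'n \<Rightarrow> real) \<Rightarrow> (real^'n \<Rightarrow> real) \<Rightarrow> real" where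
  "L2_inner \<Omega> f g = (\<integral>x. f x * g x \<partial>lebesgue_on \<Omega>)"

definition L2_norm :: "(real^'n) set \<Rightarrow> (real^'n \<Rightarrow> real) \<Rightarrow> real" where
  "L2_norm \<Omega> f = sqrt (L2_inner \<Omega> f f)"

definition locally_integrable :: "(real^'n) set \<Rightarrow> (real^'n \<Rightarrow> real) \<Rightarrow> bool" where
  "locally_integrable \<Omega> f \<longleftrightarrow> (\<forall>C. compact C \<and> C \<subseteq> \<Omega> \<longrightarrow> integrable (lebesgue_on C) f)"

definition has_weak_deriv ::
    "(real^'n) set \<Rightarrow> 'n list \<Rightarrow> (real^'n \<Rightarrow> real) \<Rightarrow> (real^'n \<Rightarrow> real) \<Rightarrow> bool" where
  "has_weak_deriv \<Omega> is u v \<longleftrightarrow> locally_integrable \<Omega> u \<and> locally_integrable \<Omega> v \<and>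
     (\<forall>\<phi>\<in>test_functions \<Omega>.
        L2_inner \<Omega> u (partial_derivs is \<phi>) = (- 1) ^ length is * L2_inner \<Omega> v \<phi>)"

text \<open>Weak derivatives are unique up to null sets, so the choice below is immaterial wherever
  it occurs under an integral.\<close>

definition weak_deriv :: "(real^'n) set \<Rightarrow> 'n list \<Rightarrow> (real^'n \<Rightarrow> real) \<Rightarrow> real^'n \<Rightarrow> real" where
  "weak_deriv \<Omega> is u = (SOME v. has_weak_deriv \<Omega> is u v)"

definition sobolev :: "nat \<Rightarrow> (real^'n) set \<Rightarrow> (real^'n \<Rightarrow> real) set" where
  "sobolev k \<Omega> = {u \<in> L2 \<Omega>. \<forall>is. length is \<le> k \<longrightarrow> (\<exists>v\<in>L2 \<Omega>. has_weak_deriv \<Omega> is u v)}"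

text \<open>The sum runs over ordered tuples of directions, so that the seminorm of order \<open>k\<close> is the
  \<open>L\<^sup>2\<close>-norm of the Euclidean (Frobenius) length of the tensor of all \<open>k\<close>-th derivatives.\<close>

definition sobolev_seminorm :: "nat \<Rightarrow> (real^'n) set \<Rightarrow> (real^'n \<Rightarrow> real) \<Rightarrow> real" where
  "sobolev_seminorm k \<Omega> u = sqrt (\<Sum>is | length is = k. (L2_norm \<Omega> (weak_deriv \<Omega> is u))\<^sup>2)"

definition sobolev_norm :: "nat \<Rightarrow> (real^'n) set \<Rightarrow> (real^'n \<Rightarrow> real) \<Rightarrow> real" where
  "sobolev_norm k \<Omega> u = sqrt (\<Sum>j\<le>k. (sobolev_seminorm j \<Omega> u)\<^sup>2)"

definition sobolev0 :: "nat \<Rightarrow> (real^'n) set \<Rightarrow> (real^'n \<Rightarrow> real) set" where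
  "sobolev0 k \<Omega> = {u \<in> sobolev k \<Omega>. \<exists>\<phi>. (\<forall>n. \<phi> n \<in> test_functions \<Omega>) \<and>
     (\<lambda>n. sobolev_norm k \<Omega> (\<lambda>x. u x - \<phi> n x)) \<longlonglongrightarrow> 0}"

definition weak_hessian :: "(real^'n) set \<Rightarrow> (real^'n \<Rightarrow> real) \<Rightarrow> real^'n \<Rightarrow> real^'n^'n" where
  "weak_hessian \<Omega> u x = (\<chi> i j. weak_deriv \<Omega> [i, j] u x)"

text \<open>The inner product of \<^typ>\<open>real^'n^'n\<close> is the Frobenius product of matrices.\<close>

definition hessian_form :: "(real^'n) set \<Rightarrow> (real^'n \<Rightarrow> real) \<Rightarrow> (real^'n \<Rightarrow> real) \<Rightarrow> real" where
  "hessian_form \<Omega> u v = (\<integral>x. weak_hessian \<Omega> u x \<bullet> weak_hessian \<Omega> v x \<partial>lebesgue_on \<Omega>)"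

section \<open>Domains and meshes\<close>

definition lipschitz_domain :: "(real^3) set \<Rightarrow> bool" where
  "lipschitz_domain \<Omega> \<longleftrightarrow> open \<Omega> \<and> connected \<Omega> \<and> \<Omega> \<noteq> {} \<and>
     (\<forall>x\<in>frontier \<Omega>. \<exists>r>0. \<exists>(R :: real^3 \<Rightarrow> real^3) L (g :: real \<times> real \<Rightarrow> real).
        orthogonal_transformation R \<and> L-lipschitz_on UNIV g \<and>
        \<Omega> \<inter> ball x r = {y \<in> ball x r. g (R y $ 1, R y $ 2) < R y $ 3})"

definition cube :: "real \<Rightarrow> real^'n \<Rightarrow> (real^'n) set" where
  "cube h c = cbox (\<chi> i. c $ i - h) (\<chi> i. c $ i + h)"

text \<open>As usual for finite elements, partitions are conforming: distinct cells meet in a common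
  face of any dimension, or not at all (the empty set is a face). Since all the cells have the same
  size, this includes that distinct cells have disjoint interiors.\<close>

definition uniform_cube_partition :: "(real^'n) set \<Rightarrow> real \<Rightarrow> (real^'n) set set \<Rightarrow> bool" where
  "uniform_cube_partition \<Omega> h \<T> \<longleftrightarrow> finite \<T> \<and> (\<forall>K\<in>\<T>. \<exists>c. K = cube h c) \<and>
     \<Union>\<T> = closure \<Omega> \<and>
     (\<forall>K\<in>\<T>. \<forall>K'\<in>\<T>. (K \<inter> K') face_of K \<and> (K \<inter> K') face_of K')"

text \<open>Surface measure of the hyperplane \<open>{x. x $ i = a}\<close>: Lebesgue measure in the coordinates
  other than \<open>i\<close>.\<close>

definition hyperplane_measure :: "'n \<Rightarrow> real \<Rightarrow> (real^'n) measure" where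
  "hyperplane_measure i a =
     distr (\<Pi>\<^sub>M j\<in>UNIV - {i}. lborel) borel (\<lambda>y. \<chi> j. if j = i then a else y j)"

section \<open>The cubic Morley element\<close>

definition poly_functions :: "nat \<Rightarrow> (real^'n \<Rightarrow> real) set" where
  "poly_functions l = {p. \<exists>c. \<forall>x. p x =
     (\<Sum>\<alpha> :: 'n \<Rightarrow> nat | (\<Sum>i\<in>UNIV. \<alpha> i) \<le> l. c \<alpha> * (\<Prod>i\<in>UNIV. (x $ i) ^ \<alpha> i))}"

definition morley_shape :: "(real^3 \<Rightarrow> real) set" where
  "morley_shape = {p. \<exists>q\<in>poly_functions 2. \<exists>a\<^sub>1 a\<^sub>2 a\<^sub>3 b. \<forall>x. p x =
     q x + a\<^sub>1 * (x $ 1) ^ 3 + a\<^sub>2 * (x $ 2) ^ 3 + a\<^sub>3 * (x $ 3) ^ 3 + b * (x $ 1 * x $ 2 * x $ 3)}"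

text \<open>The polynomial \<open>p K\<close> is the restriction of \<open>v\<close> to the cell \<open>K\<close>; it carries the vertex values
  and normal derivatives of \<open>v\<close> as seen from \<open>K\<close>. Every face of a cube lies in exactly one
  hyperplane \<open>{x. x $ i = a}\<close>, and its unit normal is (up to the immaterial sign) \<open>axis i 1\<close>.\<close>

definition morley_space :: "(real^3) set \<Rightarrow> (real^3) set set \<Rightarrow> (real^3 \<Rightarrow> real) set" where
  "morley_space \<Omega> \<T> = {v \<in> L2 \<Omega>. \<exists>p.
     (\<forall>K\<in>\<T>. p K \<in> morley_shape \<and> (AE x in lebesgue_on K. v x = p K x)) \<and>
     (\<forall>K\<in>\<T>. \<forall>K'\<in>\<T>. \<forall>z\<in>\<Omega>. z extreme_point_of K \<and> z extreme_point_of K' \<longrightarrow> p K z = p K' z) \<and>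
     (\<forall>K\<in>\<T>. \<forall>z\<in>frontier \<Omega>. z extreme_point_of K \<longrightarrow> p K z = 0) \<and>
     (\<forall>K\<in>\<T>. \<forall>K'\<in>\<T>. \<forall>F i a.
        F facet_of K \<and> F facet_of K' \<and> F \<subseteq> {x. x $ i = a} \<and> \<not> F \<subseteq> frontier \<Omega> \<longrightarrow>
        (LINT x:F|hyperplane_measure i a. partial_deriv i (p K) x) =
        (LINT x:F|hyperplane_measure i a. partial_deriv i (p K') x)) \<and>
     (\<forall>K\<in>\<T>. \<forall>F i a. F facet_of K \<and> F \<subseteq> {x. x $ i = a} \<and> F \<subseteq> frontier \<Omega> \<longrightarrow>
        (LINT x:F|hyperplane_measure i a. partial_deriv i (p K) x) = 0)}"

definition broken_form ::
    "(real^'n) set set \<Rightarrow> (real^'n \<Rightarrow> real) \<Rightarrow> (real^'n \<Rightarrow> real) \<Rightarrow> real" where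
  "broken_form \<T> v w = (\<Sum>K\<in>\<T>. hessian_form (interior K) v w)"

definition broken_seminorm :: "(real^'n) set set \<Rightarrow> (real^'n \<Rightarrow> real) \<Rightarrow> real" where
  "broken_seminorm \<T> v = sqrt (broken_form \<T> v v)"

end

theory Submission
  imports Defs
begin

text \<open>
  On a cell with local coordinates \<open>\<xi>\<close> a shape function splits as \<open>w = q + b\<close>, where \<open>q\<close> is its trilinear
  vertex interpolant and \<open>b = \<Sum>\<^sub>k \<alpha>\<^sub>k (\<xi>\<^sub>k\<^sup>2 - 1) + \<beta>\<^sub>k (\<xi>\<^sub>k\<^sup>3 - \<xi>\<^sub>k)\<close>. The means of \<open>\<partial>\<^sub>i w\<close> over the two faces with
  normal direction \<open>i\<close> are interpolated by a function \<open>m\<^sub>i\<close> of \<open>\<xi>\<^sub>i\<close> alone that satisfies \<open>\<partial>\<^sub>i m\<^sub>i = \<partial>\<^sub>i\<partial>\<^sub>i w\<close>;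
  moreover \<open>\<partial>\<^sub>i\<partial>\<^sub>j w = \<partial>\<^sub>i\<partial>\<^sub>j q\<close> for \<open>i \<noteq> j\<close>. Across faces with normal direction \<open>i\<close>, the functions \<open>m\<^sub>i\<close>, \<open>q\<close> and
  \<open>\<partial>\<^sub>j q\<close> with \<open>j \<noteq> i\<close> are continuous, and they vanish on those in the boundary. Integrating by parts
  in one direction at a time, and using that \<open>f\<close> is the bilaplacian of \<open>u\<close>, one finds that the
  consistency error is the sum of the integrals of \<open>\<partial>\<^sub>i\<^sup>3 u (\<partial>\<^sub>i q - m\<^sub>i)\<close> minus that of \<open>f b\<close>. On each cell
  \<open>\<partial>\<^sub>i q - m\<^sub>i\<close> is a divergence \<open>\<Sum>\<^sub>k \<partial>\<^sub>k \<Phi>\<^sub>k\<close> where \<open>\<Phi>\<^sub>k\<close> vanishes on the two faces with normal direction \<open>k\<close>, so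
  that only fourth derivatives of \<open>u\<close> remain; \<open>\<Phi>\<^sub>k\<close> and \<open>b\<close> are bounded by \<open>h\<^sup>2\<close> times the Hessian of \<open>w\<close>.

  No traces are needed: a weak derivative in direction \<open>i\<close> may be tested with a polynomial on a box
  that vanishes on the two faces with normal direction \<open>i\<close> only. Continuity across a common face is
  exploited by such a polynomial on the union of the two cells.\<close>

section \<open>Partial derivatives and smooth functions\<close>

text \<open>Only vertex values and face means of normal derivatives are continuous, so a diagonal
  Hessian entry cannot be moved onto the i-th derivative of the shape function itself. The function
  \<open>mean c i\<close> is that derivative with all terms in the other coordinates dropped, which
  leaves its i-th derivative unchanged. The price is a difference \<open>grad c i - mean c i\<close>
  that is small of first order only. The lost order is recovered because the constants cancel in
  this difference and every remaining term has mean zero in one of the local coordinates: its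
  antiderivative in that coordinate can be made to vanish on both opposite faces. The factor
  \<open>h^2\<close> is read off directly, since the Hessian entries are the coefficients of the
  non-affine part of the shape function divided by \<open>h^2\<close>. This makes the constant
  explicit: nine pairs of directions, times the factor 3 of \<open>sum_coef_size_le\<close>.\<close>

lemma partial_deriv_eq:
  assumes "(f has_derivative f') (at x)"
  shows "partial_deriv i f x = f' (axis i 1)"
  using frechet_derivative_at[OF assms] by (simp add: partial_deriv_def)

lemma partial_deriv_add:
  assumes "f differentiable at x" "g differentiable at x"
  shows "partial_deriv i (\<lambda>x. f x + g x) x = partial_deriv i f x + partial_deriv i g x"
  using partial_deriv_eq[OF has_derivative_add[OF assms[unfolded frechet_derivative_works]]]
  by (simp add: partial_deriv_def)

lemma partial_deriv_mult:
  assumes "f differentiable at x" "g differentiable at x"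
  shows "partial_deriv i (\<lambda>x. f x * g x) x = f x * partial_deriv i g x + g x * partial_deriv i f x"
  using partial_deriv_eq[OF has_derivative_mult[OF assms[unfolded frechet_derivative_works]]]
  by (simp add: partial_deriv_def mult.commute)

lemma partial_deriv_outside_support:
  assumes "x \<notin> closure {x. f x \<noteq> 0}"
  shows "partial_deriv i f x = 0"
proof -
  have "(f has_derivative (\<lambda>_. 0)) (at x)"
  proof (rule has_derivative_transform_within_open)
    show "((\<lambda>_. 0) has_derivative (\<lambda>_. 0)) (at x)" by simp
    show "open (- closure {x. f x \<noteq> 0})" "x \<in> - closure {x. f x \<noteq> 0}" using assms by auto
    show "\<And>y. y \<in> - closure {x. f x \<noteq> 0} \<Longrightarrow> 0 = f y"
      using closure_subset[of "{x. f x \<noteq> 0}"] by auto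
  qed
  from partial_deriv_eq[OF this] show ?thesis by simp
qed

lemma partial_derivs_Nil [simp]: "partial_derivs [] f = f"
  by (simp add: partial_derivs_def)

lemma partial_derivs_Cons [simp]: "partial_derivs (i # is) f = partial_deriv i (partial_derivs is f)"
  by (simp add: partial_derivs_def)

lemma partial_derivs_append: "partial_derivs (is @ js) f = partial_derivs is (partial_derivs js f)"
  by (simp add: partial_derivs_def)

definition smooth :: "(real^'n \<Rightarrow> real) \<Rightarrow> bool" where
  "smooth f \<longleftrightarrow> (\<forall>is. partial_derivs is f differentiable_on UNIV)"

lemma smooth_differentiable: "smooth f \<Longrightarrow> f differentiable at x"
  unfolding smooth_def by (metis partial_derivs_Nil differentiable_on_def UNIV_I)

lemma smooth_continuous_on: "smooth f \<Longrightarrow> continuous_on S f"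
  by (meson smooth_differentiable differentiable_imp_continuous_within continuous_on_eq_continuous_within
      continuous_at_imp_continuous_at_within)

lemma smooth_partial_derivs: "smooth f \<Longrightarrow> smooth (partial_derivs is f)"
  by (metis smooth_def partial_derivs_append)

lemma smooth_partial_deriv: "smooth f \<Longrightarrow> smooth (partial_deriv i f)"
  using smooth_partial_derivs[of f "[i]"] by simp

text \<open>Smoothness quantifies over all iterated derivatives; a class of differentiable functions
  that every partial derivative maps into itself absorbs the iteration. The instance is
  \<open>elementary\<close>.\<close>

lemma smooth_coinduct:
  assumes "P f" and diff: "\<And>g x. P g \<Longrightarrow> g differentiable at x"
    and pd: "\<And>g i. P g \<Longrightarrow> P (partial_deriv i g)"
  shows "smooth f"
proof -
  have "P (partial_derivs is f)" for "is"
    by (induction "is") (use assms in auto)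
  then show ?thesis
    by (auto simp: smooth_def differentiable_on_def intro: diff)
qed

text \<open>For \<open>P = 1\<close> this is the classical smooth function that is flat at 0. The
  polynomial factor makes the family closed under differentiation.\<close>

definition flat :: "real poly \<Rightarrow> real \<Rightarrow> real" where
  "flat P t = (if t \<le> 0 then 0 else poly P (1 / t) * exp (- (1 / t)))"

lemma poly_times_exp_neg_tendsto_0:
  "((\<lambda>y::real. poly P y * exp (- y)) \<longlongrightarrow> 0) at_top"
proof (induction P rule: pCons_induct)
  case 0
  then show ?case by simp
next
  case (pCons a P)
  show ?case
  proof -
    have "((\<lambda>y::real. y ^ k * exp (- y)) \<longlongrightarrow> 0) at_top" for k
      using tendsto_power_div_exp_0[of k] by (simp add: exp_minus divide_inverse)
    then have "((\<lambda>y::real. \<Sum>k\<le>degree (pCons a P). coeff (pCons a P) k * (y ^ k * exp (- y)))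
        \<longlongrightarrow> (\<Sum>k\<le>degree (pCons a P). coeff (pCons a P) k * 0)) at_top"
      by (intro tendsto_intros)
    moreover have "(\<Sum>k\<le>degree (pCons a P). coeff (pCons a P) k * (y ^ k * exp (- y)))
        = poly (pCons a P) y * exp (- y)" for y
      unfolding poly_altdef sum_distrib_right by (simp add: mult.assoc)
    ultimately show ?thesis by simp
  qed
qed

text \<open>With \<open>s = 1 / t\<close>, differentiation in \<open>t\<close> is
  \<open>- s^2\<close> times differentiation in \<open>s\<close>, which turns
  \<open>P exp(-s)\<close> into \<open>s^2 (P - P') exp(-s)\<close>.\<close>

lemma flat_has_real_derivative:
  "(flat P has_real_derivative flat (monom 1 2 * (P - pderiv P)) t) (at t)"
proof -
  let ?Q = "monom 1 2 * (P - pderiv P)"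
  consider "t < 0" | "t > 0" | "t = 0" by linarith
  then show ?thesis
  proof cases
    case 1
    show ?thesis
    proof (rule has_field_derivative_transform_within)
      show "((\<lambda>_. 0) has_real_derivative flat ?Q t) (at t)"
        using 1 by (auto simp: flat_def)
      show "0 < -t" "t \<in> UNIV" using 1 by simp_all
      show "\<And>y. dist y t < - t \<Longrightarrow> 0 = flat P y" by (auto simp: flat_def dist_real_def)
    qed
  next
    case 2
    show ?thesis
    proof (rule has_field_derivative_transform_within)
      show "((\<lambda>t. poly P (1 / t) * exp (- (1 / t))) has_real_derivative flat ?Q t) (at t)"
        using 2 by (auto intro!: derivative_eq_intros poly_DERIV[THEN DERIV_chain2]
            simp: flat_def poly_monom field_simps power2_eq_square)
      show "0 < t" "t \<in> UNIV" using 2 by simp_all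
      show "\<And>y. dist y t < t \<Longrightarrow> poly P (1 / y) * exp (- (1 / y)) = flat P y"
        by (auto simp: flat_def dist_real_def)
    qed
  next
    case 3
    \<comment> \<open>At 0 the right difference quotient is \<open>s * poly P s * exp (- s)\<close>
      with \<open>s = 1 / t\<close>, so it tends to 0 as \<open>s\<close> grows.\<close>
    have "((\<lambda>y. y * poly P y * exp (- y)) \<longlongrightarrow> 0) (at_top::real filter)"
      using poly_times_exp_neg_tendsto_0[of "pCons 0 P"] by simp
    then have "((\<lambda>t. (1/t) * poly P (1/t) * exp (- (1/t))) \<longlongrightarrow> 0) (at_right (0::real))"
      by (rule filterlim_compose) (simp add: filterlim_inverse_at_top_right flip: inverse_eq_divide)
    then have R: "((\<lambda>t. flat P t / t) \<longlongrightarrow> 0) (at_right 0)"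
      by (rule Lim_transform_eventually)
         (auto simp: eventually_at_right_less flat_def intro!: eventually_mono[OF eventually_at_right_less])
    have L: "((\<lambda>t. flat P t / t) \<longlongrightarrow> 0) (at_left 0)"
      by (rule Lim_transform_eventually[OF tendsto_const])
         (auto simp: flat_def eventually_at_filter)
    from L R have "((\<lambda>t. flat P t / t) \<longlongrightarrow> 0) (at 0)"
      by (simp add: filterlim_at_split)
    then show ?thesis
      using 3 by (simp add: has_field_derivative_iff flat_def)
  qed
qed

text \<open>A syntactic class containing both the polynomials and the cutoffs and stable under
  partial derivatives. Membership follows by introduction rules and yields smoothness, hence
  continuity and integrability on bounded sets, for every weight in the proof.\<close>

inductive elementary :: "(real^'n \<Rightarrow> real) \<Rightarrow> bool" where
  elementary_const: "elementary (\<lambda>_. r)"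
| elementary_coord: "elementary (\<lambda>x. x $ k)"
| elementary_flat: "elementary (\<lambda>x. flat P (s * x $ k + t))"
| elementary_add: "elementary f \<Longrightarrow> elementary g \<Longrightarrow> elementary (\<lambda>x. f x + g x)"
| elementary_mult: "elementary f \<Longrightarrow> elementary g \<Longrightarrow> elementary (\<lambda>x. f x * g x)"

lemma coord_has_derivative: "((\<lambda>x. x $ k) has_derivative (\<lambda>h. h $ k)) (at x)"
  by (rule bounded_linear_imp_has_derivative[OF bounded_linear_vec_nth])

lemma flat_coord_has_derivative:
  "((\<lambda>x::real^'n. flat P (s * x $ k + t)) has_derivative
     (\<lambda>h. flat (monom 1 2 * (P - pderiv P)) (s * x $ k + t) * (s * h $ k))) (at x)"
proof -
  have "((\<lambda>x::real^'n. s * x $ k + t) has_derivative (\<lambda>h. s * h $ k)) (at x)"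
    by (auto intro!: derivative_eq_intros coord_has_derivative)
  from has_derivative_compose[OF this flat_has_real_derivative[of P, unfolded has_field_derivative_def]]
  show ?thesis by simp
qed

lemma elementary_differentiable: "elementary f \<Longrightarrow> f differentiable at x"
proof (induction arbitrary: x rule: elementary.induct)
  case (elementary_coord k)
  show ?case using coord_has_derivative by (auto simp: differentiable_def)
next
  case (elementary_flat P s k t)
  show ?case unfolding differentiable_def using flat_coord_has_derivative by blast
qed auto

lemma elementary_partial_deriv: "elementary f \<Longrightarrow> elementary (partial_deriv i f)"
proof (induction rule: elementary.induct)
  case (elementary_const r)
  have "partial_deriv i (\<lambda>_. r) = (\<lambda>_. 0)"
    by (auto intro!: ext partial_deriv_eq[THEN trans] derivative_eq_intros)
  then show ?case by (simp add: elementary.intros)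
next
  case (elementary_coord k)
  have "partial_deriv i (\<lambda>x. x $ k) = (\<lambda>_. axis i 1 $ k)"
  proof
    fix x :: "real^'a"
    show "partial_deriv i (\<lambda>x. x $ k) x = axis i 1 $ k"
      by (rule partial_deriv_eq[OF coord_has_derivative])
  qed
  then show ?case by (simp add: elementary.intros)
next
  case (elementary_flat P s k t)
  have "partial_deriv i (\<lambda>x. flat P (s * x $ k + t)) =
     (\<lambda>x. flat (monom 1 2 * (P - pderiv P)) (s * x $ k + t) * (s * axis i 1 $ k))"
    by (rule ext) (rule partial_deriv_eq[OF flat_coord_has_derivative])
  then show ?case by (simp add: elementary.intros)
next
  case (elementary_add f g)
  have "partial_deriv i (\<lambda>x. f x + g x) = (\<lambda>x. partial_deriv i f x + partial_deriv i g x)"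
    using elementary_add.hyps by (simp add: fun_eq_iff partial_deriv_add elementary_differentiable)
  then show ?case using elementary_add.IH by (simp add: elementary.intros)
next
  case (elementary_mult f g)
  have "partial_deriv i (\<lambda>x. f x * g x) = (\<lambda>x. f x * partial_deriv i g x + g x * partial_deriv i f x)"
    using elementary_mult.hyps by (simp add: fun_eq_iff partial_deriv_mult elementary_differentiable)
  then show ?case using elementary_mult by (simp add: elementary.intros)
qed

lemma elementary_smooth: "elementary f \<Longrightarrow> smooth f"
  by (rule smooth_coinduct[where P = elementary]) (auto intro: elementary_differentiable elementary_partial_deriv)

lemma elementary_prod:
  "finite I \<Longrightarrow> (\<And>k. k \<in> I \<Longrightarrow> elementary (f k)) \<Longrightarrow> elementary (\<lambda>x. \<Prod>k\<in>I. f k x)"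
  by (induction I rule: finite_induct) (auto intro: elementary.intros)

lemma elementary_sum:
  "finite I \<Longrightarrow> (\<And>k. k \<in> I \<Longrightarrow> elementary (f k)) \<Longrightarrow> elementary (\<lambda>x. \<Sum>k\<in>I. f k x)"
  by (induction I rule: finite_induct) (auto intro: elementary.intros)

lemma elementary_diff: "elementary f \<Longrightarrow> elementary g \<Longrightarrow> elementary (\<lambda>x. f x - g x)"
  using elementary_add[OF _ elementary_mult[OF elementary_const[of "-1"]], of f g] by simp

lemma elementary_divide: "elementary f \<Longrightarrow> elementary (\<lambda>x. f x / r)"
  using elementary_mult[OF _ elementary_const[of "1 / r"], of f] by simp

lemma elementary_power: "elementary f \<Longrightarrow> elementary (\<lambda>x. f x ^ n)"
  by (induction n) (auto intro: elementary.intros)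

lemmas elementary_intros =
  elementary_const elementary_coord elementary_add elementary_mult elementary_diff
  elementary_divide elementary_power elementary_sum elementary_prod

section \<open>Cutoff functions and the fundamental lemma\<close>

lemma flat_tendsto_at_top: "(flat P \<longlongrightarrow> poly P 0) at_top"
proof (rule Lim_transform_eventually)
  have "((\<lambda>t::real. 1 / t) \<longlongrightarrow> 0) at_top"
    using tendsto_inverse_0_at_top[OF filterlim_ident] by (simp add: inverse_eq_divide)
  then show "((\<lambda>t. poly P (1 / t) * exp (- (1 / t))) \<longlongrightarrow> poly P 0) at_top"
    using tendsto_mult[OF tendsto_poly[of _ 0] tendsto_exp[OF tendsto_minus[of _ 0]]] by fastforce
  show "\<forall>\<^sub>F t in at_top. poly P (1 / t) * exp (- (1 / t)) = flat P t"
    using eventually_gt_at_top[of 0] by eventually_elim (auto simp: flat_def)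
qed

lemma flat_1_bounds: "0 \<le> flat 1 t" "flat 1 t \<le> 1"
  by (auto simp: flat_def)

text \<open>With \<open>z = y - 1\<close> and \<open>s = 1 / z\<close> one has
  \<open>y * s^2 = s + s^2\<close>, so the distance factor \<open>y\<close> turns the derivative of
  \<open>flat 1\<close> into another member of the family, bounded by 2.\<close>

lemma times_flat_deriv:
  "y * flat (monom 1 2) (y - 1) = flat [:0, 1, 1:] (y - 1)"
  by (cases "y \<le> 1") (simp_all add: flat_def poly_monom power2_eq_square divide_simps)

lemma abs_flat_le_2: "\<bar>flat [:0, 1, 1:] z\<bar> \<le> 2"
proof (cases "z \<le> 0")
  case False
  define s where "s = 1 / z"
  have "0 \<le> s" using False by (simp add: s_def)
  have "1 + s + s\<^sup>2 / 2 \<le> exp s" using exp_lower_Taylor_quadratic[OF \<open>0 \<le> s\<close>] .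
  then have "s + s * s \<le> 2 * exp s" using \<open>0 \<le> s\<close> by (simp add: power2_eq_square)
  then have "(s + s * s) * exp (- s) \<le> 2" by (simp add: exp_minus field_simps)
  then show ?thesis using False \<open>0 \<le> s\<close>
    by (simp add: flat_def s_def[symmetric] algebra_simps)
qed (simp add: flat_def)

text \<open>The shift by 1 makes the function vanish within distance \<open>1 / n\<close> of both
  endpoints, so that products over coordinates have compact support in the open box. The cutoff
  tends to 1 pointwise inside the interval without being equal to 1 anywhere.\<close>

definition cutoff1 :: "real \<Rightarrow> real \<Rightarrow> nat \<Rightarrow> real \<Rightarrow> real" where
  "cutoff1 a b n t = flat 1 (real n * (t - a) - 1) * flat 1 (real n * (b - t) - 1)"

definition cutoff1_deriv :: "real \<Rightarrow> real \<Rightarrow> nat \<Rightarrow> real \<Rightarrow> real" where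
  "cutoff1_deriv a b n t =
     real n * flat (monom 1 2) (real n * (t - a) - 1) * flat 1 (real n * (b - t) - 1)
     - real n * flat (monom 1 2) (real n * (b - t) - 1) * flat 1 (real n * (t - a) - 1)"

definition cutoff :: "real^'n \<Rightarrow> real^'n \<Rightarrow> nat \<Rightarrow> real^'n \<Rightarrow> real" where
  "cutoff a b n x = (\<Prod>k\<in>UNIV. cutoff1 (a $ k) (b $ k) n (x $ k))"

lemma cutoff1_bounds: "0 \<le> cutoff1 a b n t" "cutoff1 a b n t \<le> 1"
  unfolding cutoff1_def by (auto intro!: mult_le_one mult_nonneg_nonneg flat_1_bounds)

lemma filterlim_cutoff_arg: "0 < r \<Longrightarrow> filterlim (\<lambda>n. real n * r - 1) at_top sequentially"
proof -
  assume "0 < r"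
  then have "filterlim (\<lambda>n. -1 + real n * r) at_top sequentially"
    by (intro filterlim_tendsto_add_at_top[OF tendsto_const]
        filterlim_at_top_mult_tendsto_pos[OF tendsto_const _ filterlim_real_sequentially])
  then show ?thesis by simp
qed

lemma flat_cutoff_arg_tendsto:
  "0 < r \<Longrightarrow> (\<lambda>n. flat P (real n * r - 1)) \<longlonglongrightarrow> poly P 0"
  by (rule filterlim_compose[OF flat_tendsto_at_top filterlim_cutoff_arg])

lemma cutoff1_tendsto: "a < t \<Longrightarrow> t < b \<Longrightarrow> (\<lambda>n. cutoff1 a b n t) \<longlonglongrightarrow> 1"
  unfolding cutoff1_def
  using tendsto_mult[OF flat_cutoff_arg_tendsto[of "t - a" 1] flat_cutoff_arg_tendsto[of "b - t" 1]] by simp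

lemma cutoff1_has_real_derivative:
  "(cutoff1 a b n has_real_derivative cutoff1_deriv a b n t) (at t)"
proof -
  have F: "(flat 1 has_real_derivative flat (monom 1 2) z) (at z)" for z
    using flat_has_real_derivative[of 1 z] by simp
  show ?thesis
    unfolding cutoff1_def[abs_def] cutoff1_deriv_def
    by (auto intro!: derivative_eq_intros F[THEN DERIV_chain2])
qed

text \<open>The derivative of the cutoff grows like \<open>n\<close> near an endpoint, and the
  weight contributes the distance to that endpoint. By \<open>times_flat_deriv\<close> the product
  depends on \<open>n\<close> only through the arguments of bounded functions.\<close>

lemma weighted_cutoff1_deriv:
  "(t - a) * (b - t) * cutoff1_deriv a b n t =
     (b - t) * flat [:0, 1, 1:] (real n * (t - a) - 1) * flat 1 (real n * (b - t) - 1)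
     - (t - a) * flat [:0, 1, 1:] (real n * (b - t) - 1) * flat 1 (real n * (t - a) - 1)"
  unfolding cutoff1_deriv_def times_flat_deriv[symmetric] by (simp add: algebra_simps)

text \<open>The polynomial \<open>[:0, 1, 1:]\<close> vanishes at 0, and its value there is the
  limit of the corresponding \<open>flat\<close> function at infinity.\<close>

lemma weighted_cutoff1_deriv_tendsto:
  assumes "a < t" "t < b"
  shows "(\<lambda>n. (t - a) * (b - t) * cutoff1_deriv a b n t) \<longlonglongrightarrow> 0"
  unfolding weighted_cutoff1_deriv using assms
  by (auto intro!: tendsto_eq_intros flat_cutoff_arg_tendsto)

lemma weighted_cutoff1_deriv_bound:
  assumes "a < t" "t < b"
  shows "\<bar>(t - a) * (b - t) * cutoff1_deriv a b n t\<bar> \<le> 4 * (b - a)"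
proof -
  have *: "\<bar>r * flat [:0, 1, 1:] y * flat 1 z\<bar> \<le> 2 * (b - a)" if "0 < r" "r < b - a" for r y z
  proof -
    have "\<bar>r * flat [:0, 1, 1:] y * flat 1 z\<bar> \<le> (b - a) * 2 * 1"
      unfolding abs_mult using that flat_1_bounds[of z]
      by (intro mult_mono) (auto simp: abs_flat_le_2)
    then show ?thesis by simp
  qed
  show ?thesis
    unfolding weighted_cutoff1_deriv
    using *[of "b - t" "real n * (t - a) - 1" "real n * (b - t) - 1"]
      *[of "t - a" "real n * (b - t) - 1" "real n * (t - a) - 1"] assms by linarith
qed

lemma cutoff1_elementary: "elementary (\<lambda>x. cutoff1 a b n (x $ k))"
proof -
  have "elementary (\<lambda>x. flat 1 (real n * x $ k + (- real n * a - 1)) * flat 1 ((- real n) * x $ k + (real n * b - 1)))"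
    by (intro elementary_mult elementary_flat)
  then show ?thesis by (simp add: cutoff1_def algebra_simps)
qed

lemma cutoff_elementary: "elementary (cutoff a b n)"
  unfolding cutoff_def[abs_def] by (intro elementary_prod cutoff1_elementary) simp

lemma cutoff_bounds: "0 \<le> cutoff a b n x" "cutoff a b n x \<le> 1"
  unfolding cutoff_def by (auto intro!: prod_nonneg prod_le_1 simp: cutoff1_bounds)

lemma cutoff_tendsto:
  assumes "x \<in> box a b"
  shows "(\<lambda>n. cutoff a b n x) \<longlonglongrightarrow> 1"
  unfolding cutoff_def using assms
  by (auto intro!: tendsto_eq_intros cutoff1_tendsto simp: mem_box_cart)

lemma partial_deriv_cutoff:
  "partial_deriv i (cutoff a b n) x =
     cutoff1_deriv (a $ i) (b $ i) n (x $ i) * (\<Prod>k\<in>UNIV - {i}. cutoff1 (a $ k) (b $ k) n (x $ k))"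
proof -
  have D: "((\<lambda>x. cutoff1 (a $ k) (b $ k) n (x $ k)) has_derivative
      (\<lambda>h. cutoff1_deriv (a $ k) (b $ k) n (x $ k) * h $ k)) (at x)" for k
    using has_derivative_compose[OF coord_has_derivative cutoff1_has_real_derivative[unfolded has_field_derivative_def]] .
  have "(cutoff a b n has_derivative (\<lambda>h. \<Sum>j\<in>UNIV. cutoff1_deriv (a $ j) (b $ j) n (x $ j) * h $ j *
        (\<Prod>k\<in>UNIV - {j}. cutoff1 (a $ k) (b $ k) n (x $ k)))) (at x)"
    unfolding cutoff_def[abs_def] by (rule has_derivative_prod) (rule D)
  from partial_deriv_eq[OF this, of i] show ?thesis
    by (simp add: axis_def if_distrib[of "\<lambda>z. _ * z * _"] cong: if_cong)
qed

lemma cutoff_support: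
  assumes "n > 0"
  shows "{x. cutoff a b n x \<noteq> 0} \<subseteq> cbox (\<chi> k. a $ k + 1 / n) (\<chi> k. b $ k - 1 / n)"
proof safe
  fix x assume "cutoff a b n x \<noteq> 0"
  then have "cutoff1 (a $ k) (b $ k) n (x $ k) \<noteq> 0" for k
    by (auto simp: cutoff_def)
  then have "real n * (x $ k - a $ k) > 1 \<and> real n * (b $ k - x $ k) > 1" for k
    by (simp add: cutoff1_def flat_def split: if_splits) (metis linorder_not_le)
  then show "x \<in> cbox (\<chi> k. a $ k + 1 / n) (\<chi> k. b $ k - 1 / n)"
    using assms by (auto simp: mem_box_cart field_simps intro!: less_imp_le)
qed

lemma shrunk_cbox_subset_box:
  "n > 0 \<Longrightarrow> cbox (\<chi> k. a $ k + 1 / real n) (\<chi> k. b $ k - 1 / real n) \<subseteq> box a b"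
  by (auto simp: mem_box_cart) (smt (verit, best) divide_pos_pos of_nat_0_less_iff)+

lemma elementary_cutoff_test_function:
  assumes "elementary \<phi>" "box a b \<subseteq> \<Omega>" "n > 0"
  shows "(\<lambda>x. \<phi> x * cutoff a b n x) \<in> test_functions \<Omega>"
proof -
  let ?f = "\<lambda>x. \<phi> x * cutoff a b n x"
  have "smooth ?f" by (intro elementary_smooth elementary_mult assms cutoff_elementary)
  moreover have cl: "closure {x. ?f x \<noteq> 0} \<subseteq> cbox (\<chi> k. a $ k + 1 / n) (\<chi> k. b $ k - 1 / n)"
    using cutoff_support[OF assms(3), of a b] by (intro closure_minimal) auto
  moreover have "compact (closure {x. ?f x \<noteq> 0})"
    using cl bounded_subset[OF bounded_cbox] closed_closure compact_eq_bounded_closed by blast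
  ultimately show ?thesis
    using shrunk_cbox_subset_box[OF assms(3), of a b] assms(2)
    unfolding test_functions_def smooth_def by blast
qed

section \<open>Integration by parts on boxes\<close>

lemma integral_lebesgue_on_support:
  fixes f :: "real^'n \<Rightarrow> real"
  assumes "S \<subseteq> T" "S \<in> sets lebesgue" "T \<in> sets lebesgue" "\<And>x. x \<in> T - S \<Longrightarrow> f x = 0"
  shows "integral\<^sup>L (lebesgue_on T) f = integral\<^sup>L (lebesgue_on S) f"
proof -
  have "integral\<^sup>L (lebesgue_on T) f = integral\<^sup>L (lebesgue_on T) (\<lambda>x. if x \<in> S then f x else 0)"
    by (rule Bochner_Integration.integral_cong) (use assms in auto)
  then show ?thesis by (simp add: integral_restrict assms)
qed

lemma integrable_lebesgue_on_subset:
  fixes f :: "real^'n \<Rightarrow> real"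
  assumes "S \<subseteq> T" "S \<in> sets lebesgue" "T \<in> sets lebesgue" "integrable (lebesgue_on T) f"
  shows "integrable (lebesgue_on S) f"
proof -
  have "integrable lebesgue (\<lambda>x. indicator S x *\<^sub>R (if x \<in> T then f x else 0))"
    using assms Lebesgue_Measure.integrable_restrict_UNIV[of T f] by (intro integrable_mult_indicator) auto
  moreover have "(\<lambda>x. indicator S x *\<^sub>R (if x \<in> T then f x else 0)) = (\<lambda>x. if x \<in> S then f x else 0)"
    using assms(1) by (auto simp: indicator_def fun_eq_iff)
  ultimately show ?thesis using assms(2) by (simp add: Lebesgue_Measure.integrable_restrict_UNIV)
qed

lemma continuous_bounded_on_box:
  fixes f :: "real^'n \<Rightarrow> real"
  assumes "continuous_on UNIV f"
  obtains B where "\<And>x. x \<in> box a b \<Longrightarrow> \<bar>f x\<bar> \<le> B" "B \<ge> 0"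
proof -
  have "compact (f ` cbox a b)"
    by (intro compact_continuous_image compact_cbox continuous_on_subset[OF assms]) auto
  then obtain B where "\<forall>y \<in> f ` cbox a b. norm y \<le> B" using compact_imp_bounded bounded_iff by metis
  then show thesis using box_subset_cbox[of a b] by (intro that[of "max B 0"]) (auto simp: le_max_iff_disj)
qed

lemma integrable_mult_continuous_box:
  fixes f :: "real^'n \<Rightarrow> real"
  assumes "integrable (lebesgue_on (box a b)) f" "continuous_on UNIV g"
  shows "integrable (lebesgue_on (box a b)) (\<lambda>x. f x * g x)"
proof -
  obtain B where B: "\<And>x. x \<in> box a b \<Longrightarrow> \<bar>g x\<bar> \<le> B" "B \<ge> 0"
    by (rule continuous_bounded_on_box[OF assms(2), of a b]) blast
  show ?thesis
  proof (rule Bochner_Integration.integrable_bound[where f = "\<lambda>x. B * f x"])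
    show "(\<lambda>x. f x * g x) \<in> borel_measurable (lebesgue_on (box a b))"
      using assms
      by (intro borel_measurable_times borel_measurable_integrable continuous_imp_measurable_on_sets_lebesgue)
         (auto intro: continuous_on_subset)
    show "AE x in lebesgue_on (box a b). norm (f x * g x) \<le> norm (B * f x)"
      using B by (intro AE_I2) (auto simp: abs_mult mult.commute[of B] intro: mult_left_mono)
  qed (use assms in auto)
qed

text \<open>The weak derivative is tested with the weight times a cutoff. In direction
  \<open>i\<close> only the cutoff factor of coordinate \<open>i\<close> is differentiated;
  multiplied by the weight it stays bounded and tends to 0. The factors of the other coordinates are
  merely bounded and tend to 1, so the weight may be nonzero on the faces normal to them. Dominated
  convergence removes the cutoff.\<close>

theorem integration_by_parts_box:
  fixes v v' :: "real^'n \<Rightarrow> real"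
  assumes weak: "has_weak_deriv \<Omega> [i] v v'" and "box a b \<subseteq> \<Omega>" "\<Omega> \<in> sets lebesgue"
    and v: "integrable (lebesgue_on (box a b)) v" and v': "integrable (lebesgue_on (box a b)) v'"
    and "elementary A"
  defines "\<phi> \<equiv> \<lambda>x. (x $ i - a $ i) * (b $ i - x $ i) * A x"
  shows "(\<integral>x. v x * partial_deriv i \<phi> x + v' x * \<phi> x \<partial>lebesgue_on (box a b)) = 0"
proof -
  let ?M = "lebesgue_on (box a b)"
  have el: "elementary \<phi>"
    unfolding \<phi>_def by (intro elementary_intros assms)
  have cA: "continuous_on UNIV A" and cphi: "continuous_on UNIV \<phi>"
    and cdphi: "continuous_on UNIV (partial_deriv i \<phi>)"
    by (intro smooth_continuous_on smooth_partial_deriv elementary_smooth assms el)+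
  obtain BA where BA: "\<And>x. x \<in> box a b \<Longrightarrow> \<bar>A x\<bar> \<le> BA" "BA \<ge> 0" by (rule continuous_bounded_on_box[OF cA, of a b]) blast
  obtain B0 where B0: "\<And>x. x \<in> box a b \<Longrightarrow> \<bar>\<phi> x\<bar> \<le> B0" "B0 \<ge> 0" by (rule continuous_bounded_on_box[OF cphi, of a b]) blast
  obtain B1 where B1: "\<And>x. x \<in> box a b \<Longrightarrow> \<bar>partial_deriv i \<phi> x\<bar> \<le> B1" "B1 \<ge> 0"
    by (rule continuous_bounded_on_box[OF cdphi, of a b]) blast
  \<comment> \<open>The index is shifted because the support of the cutoff is described through
    \<open>1 / n\<close>.\<close>
  define \<Phi> where "\<Phi> n x = \<phi> x * cutoff a b (Suc n) x" for n x
  have Phi_el: "elementary (\<Phi> n)" for n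
    unfolding \<Phi>_def by (intro elementary_mult el cutoff_elementary)
  have test: "\<Phi> n \<in> test_functions \<Omega>" for n
    unfolding \<Phi>_def by (rule elementary_cutoff_test_function) (use el assms in auto)
  have supp: "closure {x. \<Phi> n x \<noteq> 0} \<subseteq> box a b" for n
  proof -
    have "\<Phi> n \<in> test_functions (box a b)"
      unfolding \<Phi>_def by (rule elementary_cutoff_test_function) (use el assms in auto)
    then show ?thesis by (simp add: test_functions_def)
  qed
  have Phi0: "\<Phi> n x = 0" "partial_deriv i (\<Phi> n) x = 0" if "x \<notin> box a b" for n x
    using that supp[of n] closure_subset[of "{x. \<Phi> n x \<noteq> 0}"]
    by (auto intro!: partial_deriv_outside_support)
  have dPhi: "partial_deriv i (\<Phi> n) x = \<phi> x * partial_deriv i (cutoff a b (Suc n)) x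
      + cutoff a b (Suc n) x * partial_deriv i \<phi> x" for n x
    unfolding \<Phi>_def using el cutoff_elementary by (intro partial_deriv_mult elementary_differentiable)
  have mPhi: "continuous_on UNIV (\<Phi> n)" "continuous_on UNIV (partial_deriv i (\<Phi> n))" for n
    by (intro smooth_continuous_on smooth_partial_deriv elementary_smooth Phi_el)+
  have eq0: "(\<integral>x. v x * partial_deriv i (\<Phi> n) x + v' x * \<Phi> n x \<partial>?M) = 0" for n
  proof -
    have "L2_inner \<Omega> v (partial_derivs [i] (\<Phi> n)) = - L2_inner \<Omega> v' (\<Phi> n)"
      using weak test unfolding has_weak_deriv_def by auto
    moreover have "L2_inner \<Omega> v (partial_derivs [i] (\<Phi> n)) = (\<integral>x. v x * partial_deriv i (\<Phi> n) x \<partial>?M)"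
      unfolding L2_inner_def using assms(2,3)
      by (subst integral_lebesgue_on_support[of "box a b" \<Omega>]) (auto simp: Phi0)
    moreover have "L2_inner \<Omega> v' (\<Phi> n) = (\<integral>x. v' x * \<Phi> n x \<partial>?M)"
      unfolding L2_inner_def using assms(2,3)
      by (subst integral_lebesgue_on_support[of "box a b" \<Omega>]) (auto simp: Phi0)
    ultimately show ?thesis
      using v v' mPhi by (simp add: integrable_mult_continuous_box)
  qed
  \<comment> \<open>The bound of \<open>weighted_cutoff1_deriv_bound\<close> times the bound of
    \<open>A\<close>; the remaining cutoff factors are at most 1.\<close>
  define D where "D = 4 * \<bar>b $ i - a $ i\<bar> * BA"
  have weighted: "\<bar>\<phi> x * partial_deriv i (cutoff a b m) x\<bar> \<le> D"
    and weighted_lim: "(\<lambda>m. \<phi> x * partial_deriv i (cutoff a b m) x) \<longlonglongrightarrow> 0" if x: "x \<in> box a b" for m x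
  proof -
    have xi: "a $ i < x $ i" "x $ i < b $ i" using x by (auto simp: mem_box_cart)
    define P where "P m = (\<Prod>k\<in>UNIV - {i}. cutoff1 (a $ k) (b $ k) m (x $ k))" for m
    define w where "w m = (x $ i - a $ i) * (b $ i - x $ i) * cutoff1_deriv (a $ i) (b $ i) m (x $ i)" for m
    have P: "0 \<le> P m" "P m \<le> 1" for m
      unfolding P_def by (auto intro!: prod_nonneg prod_le_1 simp: cutoff1_bounds)
    have Plim: "P \<longlonglongrightarrow> 1" unfolding P_def using x
      by (auto intro!: tendsto_eq_intros cutoff1_tendsto simp: mem_box_cart)
    have eq: "\<phi> x * partial_deriv i (cutoff a b m) x = w m * A x * P m" for m
      unfolding partial_deriv_cutoff P_def w_def \<phi>_def by (simp add: algebra_simps)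
    have "\<bar>w m\<bar> \<le> 4 * \<bar>b $ i - a $ i\<bar>"
      unfolding w_def using weighted_cutoff1_deriv_bound[OF xi, of m] xi by simp
    then have "\<bar>w m\<bar> * \<bar>A x\<bar> * \<bar>P m\<bar> \<le> (4 * \<bar>b $ i - a $ i\<bar>) * BA * 1"
      using BA x P[of m] by (intro mult_mono) auto
    then show "\<bar>\<phi> x * partial_deriv i (cutoff a b m) x\<bar> \<le> D" by (simp add: eq abs_mult D_def)
    have "w \<longlonglongrightarrow> 0" unfolding w_def by (rule weighted_cutoff1_deriv_tendsto[OF xi])
    then show "(\<lambda>m. \<phi> x * partial_deriv i (cutoff a b m) x) \<longlonglongrightarrow> 0"
      unfolding eq using Plim by (auto intro!: tendsto_eq_intros)
  qed
  have "D \<ge> 0" using BA by (simp add: D_def)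
  have "(\<lambda>n. \<integral>x. v x * partial_deriv i (\<Phi> n) x + v' x * \<Phi> n x \<partial>?M)
    \<longlonglongrightarrow> (\<integral>x. v x * partial_deriv i \<phi> x + v' x * \<phi> x \<partial>?M)"
  proof (rule integral_dominated_convergence)
    show "integrable ?M (\<lambda>x. \<bar>v x\<bar> * (D + B1) + \<bar>v' x\<bar> * B0)"
      using v v' by auto
    show "(\<lambda>x. v x * partial_deriv i \<phi> x + v' x * \<phi> x) \<in> borel_measurable ?M"
      "(\<lambda>x. v x * partial_deriv i (\<Phi> n) x + v' x * \<Phi> n x) \<in> borel_measurable ?M" for n
      using v v' cphi cdphi mPhi
      by (auto intro!: borel_measurable_integrable integrable_mult_continuous_box Bochner_Integration.integrable_add)
    show "AE x in ?M. (\<lambda>n. v x * partial_deriv i (\<Phi> n) x + v' x * \<Phi> n x)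
      \<longlonglongrightarrow> v x * partial_deriv i \<phi> x + v' x * \<phi> x"
    proof (rule AE_I2)
      fix x assume "x \<in> space ?M"
      then have x: "x \<in> box a b" by simp
      have c: "(\<lambda>n. cutoff a b (Suc n) x) \<longlonglongrightarrow> 1"
        and w: "(\<lambda>n. \<phi> x * partial_deriv i (cutoff a b (Suc n)) x) \<longlonglongrightarrow> 0"
        using LIMSEQ_Suc[OF cutoff_tendsto[OF x]] LIMSEQ_Suc[OF weighted_lim[OF x]] by auto
      show "(\<lambda>n. v x * partial_deriv i (\<Phi> n) x + v' x * \<Phi> n x)
      \<longlonglongrightarrow> v x * partial_deriv i \<phi> x + v' x * \<phi> x"
        unfolding dPhi unfolding \<Phi>_def
        using tendsto_add[OF tendsto_mult[OF tendsto_const tendsto_add[OF w tendsto_mult[OF c tendsto_const]]]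
            tendsto_mult[OF tendsto_const tendsto_mult[OF tendsto_const c]],
            of "v x" "partial_deriv i \<phi> x" "v' x" "\<phi> x"] by simp
    qed
    show "AE x in ?M. norm (v x * partial_deriv i (\<Phi> n) x + v' x * \<Phi> n x)
        \<le> \<bar>v x\<bar> * (D + B1) + \<bar>v' x\<bar> * B0" for n
    proof (rule AE_I2)
      fix x assume "x \<in> space ?M"
      then have x: "x \<in> box a b" by simp
      have c: "\<bar>cutoff a b (Suc n) x\<bar> \<le> 1" using cutoff_bounds[of a b "Suc n" x] by simp
      have "\<bar>cutoff a b (Suc n) x\<bar> * \<bar>partial_deriv i \<phi> x\<bar> \<le> 1 * B1"
        using B1 x c by (intro mult_mono) auto
      then have 1: "\<bar>partial_deriv i (\<Phi> n) x\<bar> \<le> D + B1"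
        unfolding dPhi using weighted[OF x, of "Suc n"]
        by (intro order_trans[OF abs_triangle_ineq add_mono]) (auto simp: abs_mult)
      have "\<bar>\<phi> x\<bar> * \<bar>cutoff a b (Suc n) x\<bar> \<le> B0 * 1"
        using B0 x c by (intro mult_mono) auto
      then have 2: "\<bar>\<Phi> n x\<bar> \<le> B0" by (simp add: \<Phi>_def abs_mult)
      have "\<bar>v x * partial_deriv i (\<Phi> n) x + v' x * \<Phi> n x\<bar>
        \<le> \<bar>v x\<bar> * \<bar>partial_deriv i (\<Phi> n) x\<bar> + \<bar>v' x\<bar> * \<bar>\<Phi> n x\<bar>"
        by (metis abs_triangle_ineq abs_mult)
      also have "\<dots> \<le> \<bar>v x\<bar> * (D + B1) + \<bar>v' x\<bar> * B0"
        using 1 2 by (intro add_mono mult_left_mono) auto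
      finally show "norm (v x * partial_deriv i (\<Phi> n) x + v' x * \<Phi> n x)
        \<le> \<bar>v x\<bar> * (D + B1) + \<bar>v' x\<bar> * B0" by simp
    qed
  qed
  then show ?thesis unfolding eq0 using LIMSEQ_unique tendsto_const by blast
qed

lemma locally_integrable_subset:
  "locally_integrable \<Omega> v \<Longrightarrow> S \<subseteq> \<Omega> \<Longrightarrow> locally_integrable S v"
  unfolding locally_integrable_def by blast

lemma locally_integrable_diff:
  "locally_integrable \<Omega> v \<Longrightarrow> locally_integrable \<Omega> w \<Longrightarrow> locally_integrable \<Omega> (\<lambda>x. v x - w x)"
  unfolding locally_integrable_def by auto

lemma locally_integrable_sum:
  "(\<And>i. i \<in> I \<Longrightarrow> locally_integrable \<Omega> (v i)) \<Longrightarrow> locally_integrable \<Omega> (\<lambda>x. \<Sum>i\<in>I. v i x)"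
  unfolding locally_integrable_def by (auto intro!: Bochner_Integration.integrable_sum)

lemma compact_sets_lebesgue: "compact C \<Longrightarrow> C \<in> sets lebesgue"
  by (simp add: compact_imp_closed lmeasurable_compact fmeasurableD)

text \<open>Boxes form an intersection-stable generator of the Borel sets, and the sets over which
  the integral vanishes form a Dynkin system. The function is first replaced by a Borel
  representative, since the induction produces Borel sets; vanishing on all of them determines the
  density.\<close>

lemma integral_boxes_zero_imp_AE_zero:
  fixes F :: "real^'n \<Rightarrow> real"
  assumes F: "integrable lebesgue F" and box0: "\<And>a b. (\<integral>x. indicator (box a b) x * F x \<partial>lebesgue) = 0"
  shows "AE x in lebesgue. F x = 0"
proof -
  obtain g where g[measurable]: "g \<in> borel_measurable lborel" and gF: "AE x in lborel. F x = g x"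
    using completion_ex_borel_measurable_real[OF borel_measurable_integrable[OF F]] by blast
  have g': "g \<in> borel_measurable lebesgue"
    using measurable_completion[OF g] .
  have gF': "AE x in lebesgue. F x = g x" using AE_completion[OF gF] .
  have gi: "integrable lborel g"
    using integrable_cong_AE[OF borel_measurable_integrable[OF F] g' gF'] F g integrable_completion[of g lborel] by simp
  have box0': "(\<integral>x. indicator (box a b) x * g x \<partial>lborel) = 0" for a b
  proof -
    have "(\<integral>x. indicator (box a b) x * g x \<partial>lborel) = (\<integral>x. indicator (box a b) x * g x \<partial>lebesgue)"
      by (rule integral_completion[symmetric]) measurable
    also have "\<dots> = (\<integral>x. indicator (box a b) x * F x \<partial>lebesgue)"
      using gF' g' borel_measurable_integrable[OF F]
      by (intro integral_cong_AE borel_measurable_times borel_measurable_indicator) auto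
    finally show ?thesis using box0 by simp
  qed
  have ind: "(LINT x:A|lborel. g x) = 0" if "A \<in> sets borel" for A
  proof -
    have "Int_stable (range (\<lambda>(a, b). box a b :: (real^'n) set))"
      by (auto simp: Int_stable_def box_Int_box)
    moreover have "range (\<lambda>(a, b). box a b :: (real^'n) set) \<subseteq> Pow UNIV" by auto
    moreover have "A \<in> sigma_sets UNIV (range (\<lambda>(a, b). box a b))"
      using that unfolding borel_eq_box by simp
    ultimately show ?thesis
    proof (induction rule: sigma_sets_induct_disjoint)
      case (basic A)
      then show ?case using box0' by (auto simp: set_lebesgue_integral_def)
    next
      case empty
      then show ?case by (simp add: set_lebesgue_integral_def)
    next
      case (compl A)
      then have A: "A \<in> sets lborel" by (simp add: borel_eq_box)
      \<comment> \<open>For complements the integral over the whole space is needed; it is the limit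
        of the integrals over growing boxes.\<close>
      have tot: "(\<integral>x. g x \<partial>lborel) = 0"
      proof -
        have "(\<lambda>n::nat. \<integral>x. indicator (box (\<chi> i. - real n) (\<chi> i. real n)) x * g x \<partial>lborel)
            \<longlonglongrightarrow> (\<integral>x. g x \<partial>lborel)"
        proof (rule integral_dominated_convergence[where w = "\<lambda>x. \<bar>g x\<bar>"])
          show "AE x in lborel. (\<lambda>n. indicator (box (\<chi> i. - real n) (\<chi> i. real n)) x * g x) \<longlonglongrightarrow> g x"
          proof (rule AE_I2)
            fix x :: "real^'n"
            obtain N :: nat where N: "norm x < N" using reals_Archimedean2 by blast
            have "\<forall>\<^sub>F n in sequentially. indicator (box (\<chi> i. - real n) (\<chi> i. real n)) x * g x = g x"
              using eventually_ge_at_top[of N]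
            proof eventually_elim
              case (elim n)
              have "\<bar>x $ i\<bar> < n" for i using component_le_norm_cart[of x i] N elim by linarith
              then show ?case by (auto simp: indicator_def mem_box_cart abs_less_iff minus_less_iff)
            qed
            then show "(\<lambda>n. indicator (box (\<chi> i. - real n) (\<chi> i. real n)) x * g x) \<longlonglongrightarrow> g x"
              by (rule tendsto_eventually)
          qed
        qed (use gi in \<open>auto simp: indicator_def\<close>)
        then show ?thesis unfolding box0' using LIMSEQ_unique tendsto_const by blast
      qed
      have "(LINT x:UNIV - A|lborel. g x) = (\<integral>x. g x - indicator A x *\<^sub>R g x \<partial>lborel)"
        unfolding set_lebesgue_integral_def by (rule Bochner_Integration.integral_cong) (auto simp: indicator_def)
      also have "\<dots> = (\<integral>x. g x \<partial>lborel) - (LINT x:A|lborel. g x)"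
        unfolding set_lebesgue_integral_def
        by (rule Bochner_Integration.integral_diff[OF gi integrable_mult_indicator[OF A gi]])
      also have "\<dots> = 0" unfolding tot compl.IH by (rule diff_self)
      finally show ?case by simp
    next
      case (union A)
      then have A: "\<And>i. A i \<in> sets lborel" by (auto simp: borel_eq_box)
      have "set_integrable lborel (\<Union>i. A i) g"
        unfolding set_integrable_def by (intro integrable_mult_indicator gi sets.countable_UN) (use A in auto)
      moreover have "A i \<inter> A j = {}" if "i \<noteq> j" for i j
        using disjoint_family_onD[OF union.hyps(1) _ _ that] by simp
      ultimately have "(LINT x:(\<Union>i. A i)|lborel. g x) = (\<Sum>i. (LINT x:A i|lborel. g x))"
        using A by (intro lebesgue_integral_countable_add)
      also have "\<dots> = 0" unfolding union.IH by (rule suminf_zero)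
      finally show ?case .
    qed
  qed
  have "AE x in lborel. g x = 0"
  proof (rule density_unique_real[OF gi])
    show "(LINT x:A|lborel. g x) = (LINT x:A|lborel. 0)" if "A \<in> sets lborel" for A
      using ind[of A] that by (simp add: set_lebesgue_integral_def)
  qed simp
  then have "AE x in lebesgue. g x = 0" by (rule AE_completion)
  with gF' show ?thesis by eventually_elim simp
qed

lemma lebesgue_on_AE_iff:
  "S \<in> sets lebesgue \<Longrightarrow> (AE x in lebesgue_on S. P x) \<longleftrightarrow> (AE x in lebesgue. x \<in> S \<longrightarrow> P x)"
  by (subst AE_restrict_space_iff) auto

lemma open_sets_lebesgue: "open \<Omega> \<Longrightarrow> \<Omega> \<in> sets lebesgue"
  using borel_open[of \<Omega>] sets_completionI_sets[of \<Omega> lborel] by simp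

text \<open>Countability, from the Lindelof property, allows the exceptional null sets of the single
  boxes to be united.\<close>

lemma box_cover:
  fixes \<Omega> :: "(real^'n) set"
  assumes "open \<Omega>"
  obtains \<B> where "countable \<B>" "\<Union>\<B> = \<Omega>" "\<And>B. B \<in> \<B> \<Longrightarrow> \<exists>a b. B = box a b \<and> cbox a b \<subseteq> \<Omega>"
proof -
  define \<F> where "\<F> = {box a b | a b. cbox a b \<subseteq> \<Omega>}"
  have "open S" if "S \<in> \<F>" for S using that by (auto simp: \<F>_def)
  from Lindelof[of \<F>, OF this] obtain \<B>
    where \<B>: "\<B> \<subseteq> \<F>" "countable \<B>" "\<Union>\<B> = \<Union>\<F>" by blast
  have "\<Union>\<F> = \<Omega>"
  proof
    show "\<Omega> \<subseteq> \<Union>\<F>"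
    proof
      fix x assume "x \<in> \<Omega>"
      then obtain a b where "cbox a b \<subseteq> \<Omega>" "x \<in> box a b"
        using open_contains_cbox[OF assms] by metis
      then show "x \<in> \<Union>\<F>" unfolding \<F>_def by blast
    qed
    show "\<Union>\<F> \<subseteq> \<Omega>"
      unfolding \<F>_def using box_subset_cbox by blast
  qed
  moreover have "\<exists>a b. B = box a b \<and> cbox a b \<subseteq> \<Omega>" if "B \<in> \<B>" for B
    using that \<B>(1) unfolding \<F>_def by blast
  ultimately show thesis using \<B> by (intro that[of \<B>]) simp_all
qed

lemma locally_integrable_box:
  "locally_integrable \<Omega> v \<Longrightarrow> cbox a b \<subseteq> \<Omega> \<Longrightarrow> integrable (lebesgue_on (box a b)) v"
  using integrable_lebesgue_on_subset[of "box a b" "cbox a b" v]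
  by (simp add: locally_integrable_def box_subset_cbox compact_sets_lebesgue open_sets_lebesgue)

text \<open>The cutoffs of a box are test functions tending to its indicator, so the integral
  vanishes over every box whose closure lies in the domain. Each member of a countable cover by such
  boxes is then handled by extending the restriction of \<open>v\<close> by zero.\<close>

theorem fundamental_lemma:
  fixes v :: "real^'n \<Rightarrow> real"
  assumes "open \<Omega>" and li: "locally_integrable \<Omega> v"
    and test0: "\<And>\<phi>. \<phi> \<in> test_functions \<Omega> \<Longrightarrow> L2_inner \<Omega> v \<phi> = 0"
  shows "AE x in lebesgue_on \<Omega>. v x = 0"
proof -
  have Om: "\<Omega> \<in> sets lebesgue" by (rule open_sets_lebesgue) fact
  have box0: "(\<integral>x. v x \<partial>lebesgue_on (box a b)) = 0" if "cbox a b \<subseteq> \<Omega>" for a b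
  proof -
    have iv: "integrable (lebesgue_on (box a b)) v" by (rule locally_integrable_box) fact+
    have c: "continuous_on UNIV (cutoff a b n)" for n
      by (intro smooth_continuous_on elementary_smooth cutoff_elementary)
    have sub: "box a b \<subseteq> \<Omega>" using that box_subset_cbox by blast
    have "(\<lambda>n. \<integral>x. v x * cutoff a b (Suc n) x \<partial>lebesgue_on (box a b)) \<longlonglongrightarrow> (\<integral>x. v x \<partial>lebesgue_on (box a b))"
    proof (rule integral_dominated_convergence[where w = "\<lambda>x. \<bar>v x\<bar>"])
      show "AE x in lebesgue_on (box a b). (\<lambda>n. v x * cutoff a b (Suc n) x) \<longlonglongrightarrow> v x"
      proof (rule AE_I2)
        fix x assume "x \<in> space (lebesgue_on (box a b))"
        then have "x \<in> box a b" by simp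
        from tendsto_mult[OF tendsto_const LIMSEQ_Suc[OF cutoff_tendsto[OF this]], of "v x"]
        show "(\<lambda>n. v x * cutoff a b (Suc n) x) \<longlonglongrightarrow> v x" by simp
      qed
      show "AE x in lebesgue_on (box a b). norm (v x * cutoff a b (Suc n) x) \<le> \<bar>v x\<bar>" for n
        using cutoff_bounds[of a b "Suc n"] by (intro AE_I2) (simp add: abs_mult mult_left_le)
      show "v \<in> borel_measurable (lebesgue_on (box a b))" "integrable (lebesgue_on (box a b)) (\<lambda>x. \<bar>v x\<bar>)"
        using iv by auto
      show "(\<lambda>x. v x * cutoff a b (Suc n) x) \<in> borel_measurable (lebesgue_on (box a b))" for n
        by (intro borel_measurable_integrable integrable_mult_continuous_box iv c)
    qed
    moreover have "(\<integral>x. v x * cutoff a b (Suc n) x \<partial>lebesgue_on (box a b)) = 0" for n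
    proof -
      have "cutoff a b (Suc n) x = 0" if "x \<notin> box a b" for x
        using that cutoff_support[of "Suc n" a b] shrunk_cbox_subset_box[of "Suc n" a b] by blast
      then have "(\<integral>x. v x * cutoff a b (Suc n) x \<partial>lebesgue_on (box a b)) = L2_inner \<Omega> v (cutoff a b (Suc n))"
        unfolding L2_inner_def
        by (intro integral_lebesgue_on_support[OF sub, symmetric]) (simp_all add: Om open_sets_lebesgue)
      also have "\<dots> = 0"
        using elementary_cutoff_test_function[OF elementary_const[of 1] sub, of "Suc n"] by (intro test0) simp
      finally show ?thesis .
    qed
    ultimately have "(\<lambda>n. 0) \<longlonglongrightarrow> (\<integral>x. v x \<partial>lebesgue_on (box a b))" by simp
    then show ?thesis using LIMSEQ_unique tendsto_const by blast
  qed
  obtain \<B> where \<B>: "countable \<B>" "\<Union>\<B> = \<Omega>" "\<And>B. B \<in> \<B> \<Longrightarrow> \<exists>a b. B = box a b \<and> cbox a b \<subseteq> \<Omega>"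
    using box_cover[OF assms(1)] by blast
  have "AE x in lebesgue. x \<in> B \<longrightarrow> v x = 0" if "B \<in> \<B>" for B
  proof -
    from \<B>(3)[OF that] obtain a b where B: "B = box a b" and ab: "cbox a b \<subseteq> \<Omega>" by blast
    let ?F = "\<lambda>x. if x \<in> box a b then v x else 0"
    have "AE x in lebesgue. ?F x = 0"
    proof (rule integral_boxes_zero_imp_AE_zero)
      show "integrable lebesgue ?F"
        using locally_integrable_box[OF li ab]
        by (simp add: Lebesgue_Measure.integrable_restrict_UNIV open_sets_lebesgue)
      show "(\<integral>x. indicator (box c d) x * ?F x \<partial>lebesgue) = 0" for c d
      proof -
        \<comment> \<open>The extension by zero must have vanishing integral over an arbitrary box;
          its intersection with the fixed box is again a box, now with closure inside the domain or
          empty.\<close>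
        obtain p q where pq: "box a b \<inter> box c d = box p q" using box_Int_box by blast
        have "box p q \<subseteq> box a b" using pq by blast
        then have "box p q = {} \<or> cbox p q \<subseteq> cbox a b"
          using closure_mono[of "box p q" "box a b"] closure_box[of p q] closure_box[of a b] by fastforce
        then have "(\<integral>x. v x \<partial>lebesgue_on (box p q)) = 0"
        proof
          assume "box p q = {}"
          then show ?thesis by (simp only: integral_lebesgue_on_empty)
        next
          assume "cbox p q \<subseteq> cbox a b"
          then show ?thesis using ab by (intro box0) (rule subset_trans)
        qed
        moreover have "(\<integral>x. indicator (box c d) x * ?F x \<partial>lebesgue) = (\<integral>x. (if x \<in> box p q then v x else 0) \<partial>lebesgue)"
          unfolding pq[symmetric] by (intro Bochner_Integration.integral_cong) (auto simp: indicator_def)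
        ultimately show ?thesis
          by (simp add: Lebesgue_Measure.integral_restrict_UNIV open_sets_lebesgue)
      qed
    qed
    then show ?thesis unfolding B by eventually_elim auto
  qed
  then have "AE x in lebesgue. (\<forall>B\<in>\<B>. x \<in> B \<longrightarrow> v x = 0)"
    by (rule AE_ball_countable'[OF _ \<B>(1)])
  then have "AE x in lebesgue. x \<in> \<Omega> \<longrightarrow> v x = 0"
    by eventually_elim (use \<B>(2) in blast)
  then show ?thesis by (simp add: lebesgue_on_AE_iff Om)
qed

section \<open>Calculus of test functions and weak derivatives\<close>

lemma smooth_test: "\<phi> \<in> test_functions \<Omega> \<Longrightarrow> smooth \<phi>"
  by (simp add: test_functions_def smooth_def)

lemma locally_integrable_mult_test:
  assumes "open \<Omega>" "locally_integrable \<Omega> v" "\<phi> \<in> test_functions \<Omega>"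
  shows "integrable (lebesgue_on \<Omega>) (\<lambda>x. v x * \<phi> x)"
proof -
  let ?C = "closure {x. \<phi> x \<noteq> 0}"
  have C: "compact ?C" "?C \<subseteq> \<Omega>" using assms(3) by (simp_all add: test_functions_def)
  have cont: "continuous_on UNIV \<phi>" by (rule smooth_continuous_on[OF smooth_test[OF assms(3)]])
  have out: "\<phi> x = 0" if "x \<notin> ?C" for x using that closure_subset[of "{x. \<phi> x \<noteq> 0}"] by blast
  have "compact (\<phi> ` ?C)"
    by (intro compact_continuous_image C continuous_on_subset[OF cont]) auto
  then obtain B where B: "\<forall>y \<in> \<phi> ` ?C. norm y \<le> B" using compact_imp_bounded bounded_iff by metis
  have iv: "integrable (lebesgue_on ?C) v" using assms(2) C by (simp add: locally_integrable_def)
  have "integrable (lebesgue_on ?C) (\<lambda>x. v x * \<phi> x)"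
  proof (rule Bochner_Integration.integrable_bound[where f = "\<lambda>x. B * v x"])
    show "(\<lambda>x. v x * \<phi> x) \<in> borel_measurable (lebesgue_on ?C)"
      by (intro borel_measurable_times borel_measurable_integrable[OF iv] continuous_imp_measurable_on_sets_lebesgue
          continuous_on_subset[OF cont] compact_sets_lebesgue[OF C(1)] subset_UNIV)
    show "AE x in lebesgue_on ?C. norm (v x * \<phi> x) \<le> norm (B * v x)"
    proof (rule AE_I2)
      fix x assume "x \<in> space (lebesgue_on ?C)"
      then have "x \<in> ?C" by simp
      then have "norm (\<phi> x) \<le> B" using B by blast
      then have "\<bar>\<phi> x\<bar> \<le> \<bar>B\<bar>" by simp
      then show "norm (v x * \<phi> x) \<le> norm (B * v x)"
        by (simp add: abs_mult mult.commute[of "\<bar>B\<bar>"] mult_left_mono)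
    qed
  qed (simp add: iv)
  then have "integrable lebesgue (\<lambda>x. if x \<in> ?C then v x * \<phi> x else 0)"
    by (simp add: Lebesgue_Measure.integrable_restrict_UNIV compact_sets_lebesgue[OF C(1)])
  also have "(\<lambda>x. if x \<in> ?C then v x * \<phi> x else 0) = (\<lambda>x. if x \<in> \<Omega> then v x * \<phi> x else 0)"
  proof
    fix x
    show "(if x \<in> ?C then v x * \<phi> x else 0) = (if x \<in> \<Omega> then v x * \<phi> x else 0)"
      using C(2) out[of x] by (cases "x \<in> ?C") auto
  qed
  finally show ?thesis
    by (simp add: Lebesgue_Measure.integrable_restrict_UNIV open_sets_lebesgue[OF assms(1)])
qed

lemma partial_derivs_outside_support:
  "x \<notin> closure {x. f x \<noteq> 0} \<Longrightarrow> partial_derivs is f x = 0"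
proof (induction "is" arbitrary: x)
  case Nil
  then show ?case using closure_subset[of "{x. f x \<noteq> 0}"] by auto
next
  case (Cons i "is")
  then have "{x. partial_derivs is f x \<noteq> 0} \<subseteq> closure {x. f x \<noteq> 0}" by auto
  then have "closure {x. partial_derivs is f x \<noteq> 0} \<subseteq> closure {x. f x \<noteq> 0}"
    by (simp add: closure_minimal)
  then show ?case using Cons.prems by (auto intro!: partial_deriv_outside_support)
qed

lemma test_functions_partial_derivs:
  assumes "\<phi> \<in> test_functions \<Omega>"
  shows "partial_derivs is \<phi> \<in> test_functions \<Omega>"
proof -
  let ?D = "partial_derivs is \<phi>"
  have s: "smooth ?D" using assms by (intro smooth_partial_derivs) (simp add: test_functions_def smooth_def)
  have sub: "closure {x. ?D x \<noteq> 0} \<subseteq> closure {x. \<phi> x \<noteq> 0}"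
    using partial_derivs_outside_support[of _ \<phi> "is"] by (intro closure_minimal) auto
  have c: "compact (closure {x. \<phi> x \<noteq> 0})" "closure {x. \<phi> x \<noteq> 0} \<subseteq> \<Omega>"
    using assms by (auto simp: test_functions_def)
  have "compact (closure {x. ?D x \<noteq> 0})"
    using compact_Int_closed[OF c(1) closed_closure[of "{x. ?D x \<noteq> 0}"]] sub by (simp add: Int_absorb1)
  then show ?thesis using s sub c unfolding test_functions_def smooth_def by blast
qed

lemma test_functions_mono: "S \<subseteq> \<Omega> \<Longrightarrow> test_functions S \<subseteq> test_functions \<Omega>"
  unfolding test_functions_def by blast

lemma weak_deriv_unique:
  assumes "open \<Omega>" "has_weak_deriv \<Omega> is u v" "has_weak_deriv \<Omega> is u v'"
  shows "AE x in lebesgue_on \<Omega>. v x = v' x"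
proof -
  have li: "locally_integrable \<Omega> v" "locally_integrable \<Omega> v'" using assms by (auto simp: has_weak_deriv_def)
  have "AE x in lebesgue_on \<Omega>. v x - v' x = 0"
  proof (rule fundamental_lemma)
    show "L2_inner \<Omega> (\<lambda>x. v x - v' x) \<phi> = 0" if \<phi>: "\<phi> \<in> test_functions \<Omega>" for \<phi>
    proof -
      have "(- 1) ^ length is * L2_inner \<Omega> v \<phi> = (- 1) ^ length is * L2_inner \<Omega> v' \<phi>"
        using assms \<phi> unfolding has_weak_deriv_def by metis
      then have "L2_inner \<Omega> v \<phi> = L2_inner \<Omega> v' \<phi>" by simp
      then show ?thesis
        using locally_integrable_mult_test[OF assms(1) _ \<phi>] li by (simp add: L2_inner_def left_diff_distrib)
    qed
  qed (use assms li in \<open>auto intro: locally_integrable_diff\<close>)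
  then show ?thesis by eventually_elim simp
qed

lemma has_weak_deriv_weak_deriv:
  "has_weak_deriv \<Omega> is u v \<Longrightarrow> has_weak_deriv \<Omega> is u (weak_deriv \<Omega> is u)"
  unfolding weak_deriv_def by (rule someI[of "has_weak_deriv \<Omega> is u"])

lemma weak_deriv_AE:
  "open \<Omega> \<Longrightarrow> has_weak_deriv \<Omega> is u v \<Longrightarrow> AE x in lebesgue_on \<Omega>. weak_deriv \<Omega> is u x = v x"
  by (rule weak_deriv_unique) (auto intro: has_weak_deriv_weak_deriv)

text \<open>In \<open>partial_derivs (is @ js)\<close> the directions \<open>is\<close> are
  outermost and are therefore moved onto \<open>u\<close> first. Further weak derivatives are thus
  appended on the right of a list of directions.\<close>

lemma has_weak_deriv_trans:
  assumes "has_weak_deriv \<Omega> (is @ js) u w" "has_weak_deriv \<Omega> is u v"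
  shows "has_weak_deriv \<Omega> js v w"
  unfolding has_weak_deriv_def
proof (intro conjI ballI)
  fix \<phi> assume \<phi>: "\<phi> \<in> test_functions \<Omega>"
  have "(- 1) ^ length is * L2_inner \<Omega> v (partial_derivs js \<phi>) = L2_inner \<Omega> u (partial_derivs (is @ js) \<phi>)"
    using assms(2) test_functions_partial_derivs[OF \<phi>] by (simp add: has_weak_deriv_def partial_derivs_append)
  also have "\<dots> = (- 1) ^ length is * ((- 1) ^ length js * L2_inner \<Omega> w \<phi>)"
    using assms(1) \<phi> by (simp add: has_weak_deriv_def power_add)
  finally show "L2_inner \<Omega> v (partial_derivs js \<phi>) = (- 1) ^ length js * L2_inner \<Omega> w \<phi>" by simp
qed (use assms in \<open>auto simp: has_weak_deriv_def\<close>)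

lemma test_functions_zero_outside:
  assumes "\<phi> \<in> test_functions \<Omega>" "x \<notin> \<Omega>" shows "\<phi> x = 0"
  using assms closure_subset[of "{x. \<phi> x \<noteq> 0}"] by (auto simp: test_functions_def)

lemma L2_inner_test_subset:
  assumes "S \<subseteq> \<Omega>" "open S" "open \<Omega>" "\<phi> \<in> test_functions S"
  shows "L2_inner \<Omega> v \<phi> = L2_inner S v \<phi>"
  unfolding L2_inner_def
  using assms by (intro integral_lebesgue_on_support) (auto simp: open_sets_lebesgue test_functions_zero_outside)

lemma has_weak_deriv_subset:
  assumes "has_weak_deriv \<Omega> is u v" "S \<subseteq> \<Omega>" "open S" "open \<Omega>"
  shows "has_weak_deriv S is u v"
  unfolding has_weak_deriv_def
proof (intro conjI ballI)
  fix \<phi> assume \<phi>: "\<phi> \<in> test_functions S"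
  then have "\<phi> \<in> test_functions \<Omega>" using test_functions_mono assms by blast
  with assms(1) have "L2_inner \<Omega> u (partial_derivs is \<phi>) = (- 1) ^ length is * L2_inner \<Omega> v \<phi>"
    by (simp add: has_weak_deriv_def)
  then show "L2_inner S u (partial_derivs is \<phi>) = (- 1) ^ length is * L2_inner S v \<phi>"
    using L2_inner_test_subset[OF assms(2-4)] test_functions_partial_derivs[OF \<phi>] \<phi> by metis
qed (use assms locally_integrable_subset in \<open>auto simp: has_weak_deriv_def\<close>)

section \<open>Weak derivatives of smooth functions and Sobolev spaces\<close>

lemma directional_has_real_derivative:
  assumes "\<And>x. f differentiable at x"
  shows "((\<lambda>t. f (x + t *\<^sub>R axis i 1)) has_real_derivative partial_deriv i f (x + t *\<^sub>R axis i 1)) (at t)"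
proof -
  let ?D = "frechet_derivative f (at (x + t *\<^sub>R axis i 1))"
  have D: "(f has_derivative ?D) (at (x + t *\<^sub>R axis i 1))"
    using assms frechet_derivative_works by blast
  have "((\<lambda>t. x + t *\<^sub>R axis i 1) has_derivative (\<lambda>s. s *\<^sub>R axis i 1)) (at t)"
    by (auto intro!: derivative_eq_intros)
  from has_derivative_compose[OF this D]
  have "((\<lambda>t. f (x + t *\<^sub>R axis i 1)) has_derivative (\<lambda>s. ?D (s *\<^sub>R axis i 1))) (at t)" .
  moreover have "?D (s *\<^sub>R axis i 1) = partial_deriv i f (x + t *\<^sub>R axis i 1) * s" for s
    using linear_cmul[OF has_derivative_linear[OF D]] by (simp add: partial_deriv_def)
  ultimately show ?thesis by (simp add: has_field_derivative_def)
qed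

text \<open>By translation invariance of Lebesgue measure every difference quotient of a compactly
  supported function has integral 0. The mean value theorem dominates the quotients, which pass to
  the derivative in the limit.\<close>

lemma integral_partial_deriv_eq_0:
  fixes \<Phi> :: "real^'n \<Rightarrow> real"
  assumes diff: "\<And>x. \<Phi> differentiable at x" and cont: "continuous_on UNIV (partial_deriv i \<Phi>)"
    and comp: "compact (closure {x. \<Phi> x \<noteq> 0})"
  shows "(\<integral>x. partial_deriv i \<Phi> x \<partial>lebesgue) = 0"
proof -
  have cPhi: "continuous_on UNIV \<Phi>"
    by (simp add: continuous_on_eq_continuous_within diff differentiable_imp_continuous_within)
  have [measurable]: "\<Phi> \<in> borel_measurable borel" "partial_deriv i \<Phi> \<in> borel_measurable borel"
    using cPhi cont by (auto intro: borel_measurable_continuous_onI)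
  obtain R where R: "\<And>x. \<Phi> x \<noteq> 0 \<Longrightarrow> norm x \<le> R"
    using compact_imp_bounded[OF comp] closure_subset[of "{x. \<Phi> x \<noteq> 0}"] unfolding bounded_iff by blast
  have "compact (partial_deriv i \<Phi> ` closure {x. \<Phi> x \<noteq> 0})"
    by (intro compact_continuous_image comp continuous_on_subset[OF cont]) auto
  then obtain B' where B': "\<forall>y \<in> partial_deriv i \<Phi> ` closure {x. \<Phi> x \<noteq> 0}. norm y \<le> B'"
    using compact_imp_bounded bounded_iff by metis
  define B where "B = max B' 0"
  have B: "\<bar>partial_deriv i \<Phi> x\<bar> \<le> B" for x
    using B' partial_deriv_outside_support[of x \<Phi> i]
    by (cases "x \<in> closure {x. \<Phi> x \<noteq> 0}") (auto simp: B_def le_max_iff_disj)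
  let ?e = "axis i 1 :: real^'n"
  define d where "d n = 1 / real (Suc n)" for n
  have d: "0 < d n" "d n \<le> 1" for n by (auto simp: d_def)
  define g where "g n x = (\<Phi> (d n *\<^sub>R ?e + x) - \<Phi> x) / d n" for n x
  have int: "integrable lborel \<Phi>"
  proof -
    have "integrable lborel (\<lambda>x. indicator (closure {x. \<Phi> x \<noteq> 0}) x *\<^sub>R \<Phi> x)"
      using comp by (rule borel_integrable_compact) (auto intro: continuous_on_subset[OF cPhi])
    also have "(\<lambda>x. indicator (closure {x. \<Phi> x \<noteq> 0}) x *\<^sub>R \<Phi> x) = \<Phi>"
      using closure_subset[of "{x. \<Phi> x \<noteq> 0}"] by (auto simp: indicator_def fun_eq_iff)
    finally show ?thesis .
  qed
  have tr: "integrable lborel (\<lambda>x. \<Phi> (c + x))" "(\<integral>x. \<Phi> (c + x) \<partial>lborel) = (\<integral>x. \<Phi> x \<partial>lborel)" for c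
  proof -
    show "integrable lborel (\<lambda>x. \<Phi> (c + x))"
      using int lborel_distr_plus[of c] integrable_distr_eq[of "(+) c" lborel borel \<Phi>] by simp
    show "(\<integral>x. \<Phi> (c + x) \<partial>lborel) = (\<integral>x. \<Phi> x \<partial>lborel)"
      using lborel_distr_plus[of c] integral_distr[of "(+) c" lborel borel \<Phi>] by simp
  qed
  have g0: "(\<integral>x. g n x \<partial>lborel) = 0" for n
    unfolding g_def using int tr by simp
  have "(\<lambda>n. \<integral>x. g n x \<partial>lborel) \<longlonglongrightarrow> (\<integral>x. partial_deriv i \<Phi> x \<partial>lborel)"
  \<comment> \<open>The steps \<open>d n\<close> are at most 1, so the quotients live in a ball
    whose radius exceeds that of the support by 1.\<close>
  proof (rule integral_dominated_convergence[where w = "\<lambda>x. indicator (cball 0 (R + 1)) x *\<^sub>R B"])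
    show "g n \<in> borel_measurable lborel" for n unfolding g_def by measurable
    show "integrable lborel (\<lambda>x::real^'n. indicator (cball 0 (R + 1)) x *\<^sub>R B)"
      by (rule borel_integrable_compact) auto
    show "AE x in lborel. (\<lambda>n. g n x) \<longlonglongrightarrow> partial_deriv i \<Phi> x"
    proof (rule AE_I2)
      fix x
      have "((\<lambda>t. \<Phi> (x + t *\<^sub>R ?e)) has_real_derivative partial_deriv i \<Phi> x) (at 0)"
        using directional_has_real_derivative[OF diff, of x i 0] by simp
      then have "((\<lambda>h. (\<Phi> (x + h *\<^sub>R ?e) - \<Phi> x) / h) \<longlongrightarrow> partial_deriv i \<Phi> x) (at 0)"
        by (simp add: DERIV_def)
      moreover have "filterlim d (at 0) sequentially"
        unfolding filterlim_at using d(1) LIMSEQ_inverse_real_of_nat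
        by (simp add: d_def[abs_def] inverse_eq_divide)
      ultimately show "(\<lambda>n. g n x) \<longlonglongrightarrow> partial_deriv i \<Phi> x"
        unfolding g_def by (subst add.commute) (rule filterlim_compose)
    qed
    show "AE x in lborel. norm (g n x) \<le> indicator (cball 0 (R + 1)) x *\<^sub>R B" for n
    proof (rule AE_I2)
      fix x
      show "norm (g n x) \<le> indicator (cball 0 (R + 1)) x *\<^sub>R B"
      proof (cases "norm x \<le> R + 1")
        case True
        obtain z where z: "\<Phi> (x + d n *\<^sub>R ?e) - \<Phi> (x + 0 *\<^sub>R ?e)
            = (d n - 0) * partial_deriv i \<Phi> (x + z *\<^sub>R ?e)"
          using MVT2[of 0 "d n" "\<lambda>t. \<Phi> (x + t *\<^sub>R ?e)" "\<lambda>t. partial_deriv i \<Phi> (x + t *\<^sub>R ?e)"]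
            directional_has_real_derivative[OF diff] d(1)[of n] by blast
        then have "g n x = partial_deriv i \<Phi> (x + z *\<^sub>R ?e)"
          using d(1)[of n] by (simp add: g_def add.commute)
        then show ?thesis using B True by (simp add: indicator_def)
      next
        case False
        have "norm x \<le> norm (d n *\<^sub>R ?e + x) + norm (d n *\<^sub>R ?e)"
          using norm_triangle_ineq4[of "d n *\<^sub>R ?e + x" "d n *\<^sub>R ?e"] by simp
        moreover have "norm (d n *\<^sub>R ?e) \<le> 1" using d[of n] by simp
        ultimately have "norm (d n *\<^sub>R ?e + x) > R" using False by linarith
        then have "\<Phi> (d n *\<^sub>R ?e + x) = 0" using R by fastforce
        moreover have "\<Phi> x = 0" using R False by fastforce
        ultimately show ?thesis by (simp add: g_def B_def)
      qed
    qed
  qed measurable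
  then have "(\<integral>x. partial_deriv i \<Phi> x \<partial>lborel) = 0"
    unfolding g0 using LIMSEQ_unique tendsto_const by blast
  then show ?thesis by (simp add: integral_completion)
qed

lemma continuous_locally_integrable:
  fixes g :: "real^'n \<Rightarrow> real"
  assumes "continuous_on UNIV g" shows "locally_integrable \<Omega> g"
  unfolding locally_integrable_def
proof safe
  fix C :: "(real^'n) set" assume C: "compact C"
  have i: "integrable lborel (\<lambda>x. indicator C x *\<^sub>R g x)"
    by (rule borel_integrable_compact[OF C]) (auto intro: continuous_on_subset[OF assms])
  then have "integrable lebesgue (\<lambda>x. indicator C x *\<^sub>R g x)"
    using integrable_completion[OF borel_measurable_integrable[OF i]] by blast
  then show "integrable (lebesgue_on C) g"
    using integrable_restrict_space[of C lebesgue g] compact_sets_lebesgue[OF C] by simp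
qed

lemma L2_inner_partial_deriv:
  fixes g :: "real^'n \<Rightarrow> real"
  assumes g: "smooth g" and \<phi>: "\<phi> \<in> test_functions \<Omega>" and "open \<Omega>"
  shows "L2_inner \<Omega> g (partial_deriv i \<phi>) = - L2_inner \<Omega> (partial_deriv i g) \<phi>"
proof -
  have s: "smooth \<phi>" by (rule smooth_test[OF \<phi>])
  let ?\<Phi> = "\<lambda>x. g x * \<phi> x"
  have c: "compact (closure {x. \<phi> x \<noteq> 0})" using \<phi> by (simp add: test_functions_def)
  have pd: "partial_deriv i ?\<Phi> = (\<lambda>x. g x * partial_deriv i \<phi> x + \<phi> x * partial_deriv i g x)"
    using g s by (simp add: fun_eq_iff partial_deriv_mult smooth_differentiable)
  have "(\<integral>x. partial_deriv i ?\<Phi> x \<partial>lebesgue) = 0"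
  proof (rule integral_partial_deriv_eq_0)
    show "continuous_on UNIV (partial_deriv i ?\<Phi>)"
      unfolding pd using g s by (intro continuous_intros smooth_continuous_on smooth_partial_deriv)
    have "closure {x. ?\<Phi> x \<noteq> 0} \<subseteq> closure {x. \<phi> x \<noteq> 0}" by (rule closure_mono) auto
    then show "compact (closure {x. ?\<Phi> x \<noteq> 0})"
      using compact_Int_closed[OF c closed_closure[of "{x. ?\<Phi> x \<noteq> 0}"]] by (simp add: Int_absorb1)
  qed (use g s in \<open>simp add: smooth_differentiable\<close>)
  moreover have d\<phi>: "partial_deriv i \<phi> \<in> test_functions \<Omega>"
    using test_functions_partial_derivs[OF \<phi>, of "[i]"] by simp
  have "(\<integral>x. partial_deriv i ?\<Phi> x \<partial>lebesgue) =
      (\<integral>x. g x * partial_deriv i \<phi> x + partial_deriv i g x * \<phi> x \<partial>lebesgue_on \<Omega>)"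
  proof -
    have "(\<integral>x. partial_deriv i ?\<Phi> x \<partial>lebesgue_on UNIV) = (\<integral>x. partial_deriv i ?\<Phi> x \<partial>lebesgue_on \<Omega>)"
      by (rule integral_lebesgue_on_support)
         (simp_all add: pd open_sets_lebesgue assms test_functions_zero_outside[OF \<phi>] test_functions_zero_outside[OF d\<phi>])
    then show ?thesis unfolding pd lebesgue_on_UNIV_eq by (simp add: mult.commute)
  qed
  ultimately have "(\<integral>x. g x * partial_deriv i \<phi> x + partial_deriv i g x * \<phi> x \<partial>lebesgue_on \<Omega>) = 0" by simp
  moreover have "integrable (lebesgue_on \<Omega>) (\<lambda>x. g x * partial_deriv i \<phi> x)"
    by (intro locally_integrable_mult_test assms d\<phi> continuous_locally_integrable smooth_continuous_on)
  moreover have "integrable (lebesgue_on \<Omega>) (\<lambda>x. partial_deriv i g x * \<phi> x)"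
    by (intro locally_integrable_mult_test assms continuous_locally_integrable smooth_continuous_on smooth_partial_deriv)
  ultimately show ?thesis by (simp add: L2_inner_def)
qed

text \<open>The outermost direction on the test function is the first one applied to
  \<open>g\<close>, and so it ends up innermost there; this is the source of
  \<open>rev\<close>.\<close>

lemma has_weak_deriv_smooth:
  fixes g :: "real^'n \<Rightarrow> real"
  assumes "smooth g" "open \<Omega>"
  shows "has_weak_deriv \<Omega> is g (partial_derivs (rev is) g)"
proof -
  have "L2_inner \<Omega> g (partial_derivs is \<phi>) = (- 1) ^ length is * L2_inner \<Omega> (partial_derivs (rev is) g) \<phi>"
    if "\<phi> \<in> test_functions \<Omega>" for \<phi>
    using assms(1)
  proof (induction "is" arbitrary: g)
    case (Cons i "is")
    have "L2_inner \<Omega> g (partial_derivs (i # is) \<phi>) = - L2_inner \<Omega> (partial_deriv i g) (partial_derivs is \<phi>)"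
      using L2_inner_partial_deriv[OF Cons.prems test_functions_partial_derivs[OF that] assms(2)] by simp
    then show ?case
      using Cons.IH[OF smooth_partial_deriv[OF Cons.prems]] by (simp add: partial_derivs_append)
  qed simp
  moreover have "locally_integrable \<Omega> g" "locally_integrable \<Omega> (partial_derivs (rev is) g)"
    by (intro continuous_locally_integrable smooth_continuous_on smooth_partial_derivs assms(1))+
  ultimately show ?thesis unfolding has_weak_deriv_def by blast
qed

section \<open>Square-integrable functions and Sobolev classes\<close>

lemma borel_measurable_lebesgue_on_AE:
  fixes f g :: "real^'n \<Rightarrow> real"
  assumes S: "S \<in> sets lebesgue" and f: "f \<in> borel_measurable (lebesgue_on S)"
    and fg: "AE x in lebesgue_on S. f x = g x"
  shows "g \<in> borel_measurable (lebesgue_on S)"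
proof -
  let ?F = "\<lambda>x. if x \<in> S then f x else 0" and ?G = "\<lambda>x. if x \<in> S then g x else 0"
  have F: "?F \<in> borel_measurable lebesgue" using f S by (simp add: borel_measurable_if)
  have FG: "AE x in lebesgue. ?F x = ?G x"
    using fg unfolding lebesgue_on_AE_iff[OF S] by eventually_elim simp
  have "?G \<in> borel_measurable lebesgue"
  proof (rule measurableI)
    fix A :: "real set" assume "A \<in> sets borel"
    then have m: "?F -` A \<inter> space lebesgue \<in> sets lebesgue" using F by (rule measurable_sets[rotated])
    \<comment> \<open>The two preimages differ by a null set, and completeness of Lebesgue measure
      makes the second one measurable as well.\<close>
    have ae: "AE x in lebesgue. x \<in> ?F -` A \<inter> space lebesgue \<longleftrightarrow> x \<in> ?G -` A \<inter> space lebesgue"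
      using FG by eventually_elim simp
    show "?G -` A \<inter> space lebesgue \<in> sets lebesgue"
      by (rule completion.in_sets_AE[OF ae m]) simp
  qed simp
  then show ?thesis using S by (simp add: borel_measurable_if)
qed

lemma L2_AE:
  fixes v w :: "real^'n \<Rightarrow> real"
  assumes "v \<in> L2 \<Omega>" "AE x in lebesgue_on \<Omega>. v x = w x" "\<Omega> \<in> sets lebesgue"
  shows "w \<in> L2 \<Omega>"
proof -
  have v: "v \<in> borel_measurable (lebesgue_on \<Omega>)" "integrable (lebesgue_on \<Omega>) (\<lambda>x. (v x)\<^sup>2)"
    using assms(1) by (auto simp: L2_def)
  have w: "w \<in> borel_measurable (lebesgue_on \<Omega>)"
    using borel_measurable_lebesgue_on_AE[OF assms(3) v(1) assms(2)] .
  have "AE x in lebesgue_on \<Omega>. (v x)\<^sup>2 = (w x)\<^sup>2"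
    using assms(2) by eventually_elim simp
  then have "integrable (lebesgue_on \<Omega>) (\<lambda>x. (w x)\<^sup>2)"
    using integrable_cong_AE_imp[OF v(2) borel_measurable_power[OF w]] by simp
  with w show ?thesis by (simp add: L2_def)
qed

lemma L2_mult_integrable:
  assumes "f \<in> L2 \<Omega>" "g \<in> L2 \<Omega>"
  shows "integrable (lebesgue_on \<Omega>) (\<lambda>x. f x * g x)"
proof (rule Bochner_Integration.integrable_bound[where f = "\<lambda>x. (f x)\<^sup>2 + (g x)\<^sup>2"])
  show "AE x in lebesgue_on \<Omega>. norm (f x * g x) \<le> norm ((f x)\<^sup>2 + (g x)\<^sup>2)"
  proof (rule AE_I2)
    fix x
    have "0 \<le> (\<bar>f x\<bar> - \<bar>g x\<bar>)\<^sup>2" by simp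
    then have "2 * (\<bar>f x\<bar> * \<bar>g x\<bar>) \<le> (f x)\<^sup>2 + (g x)\<^sup>2" by (simp add: power2_diff)
    moreover have "0 \<le> \<bar>f x\<bar> * \<bar>g x\<bar>" by simp
    ultimately show "norm (f x * g x) \<le> norm ((f x)\<^sup>2 + (g x)\<^sup>2)"
      unfolding real_norm_def abs_mult by linarith
  qed
next
  have "f \<in> borel_measurable (lebesgue_on \<Omega>)" "g \<in> borel_measurable (lebesgue_on \<Omega>)"
    "integrable (lebesgue_on \<Omega>) (\<lambda>x. (f x)\<^sup>2)" "integrable (lebesgue_on \<Omega>) (\<lambda>x. (g x)\<^sup>2)"
    using assms unfolding L2_def by simp_all
  then show "integrable (lebesgue_on \<Omega>) (\<lambda>x. (f x)\<^sup>2 + (g x)\<^sup>2)"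
    "(\<lambda>x. f x * g x) \<in> borel_measurable (lebesgue_on \<Omega>)"
    by (simp_all add: borel_measurable_times)
qed

lemma L2_subset:
  assumes "f \<in> L2 \<Omega>" "S \<subseteq> \<Omega>" "S \<in> sets lebesgue" "\<Omega> \<in> sets lebesgue"
  shows "f \<in> L2 S"
proof -
  have f: "f \<in> borel_measurable (lebesgue_on \<Omega>)" "integrable (lebesgue_on \<Omega>) (\<lambda>x. (f x)\<^sup>2)"
    using assms(1) unfolding L2_def by simp_all
  show ?thesis unfolding L2_def
    using measurable_restrict_mono[OF f(1) assms(2)] integrable_lebesgue_on_subset[OF assms(2-4) f(2)] by simp
qed

lemma continuous_L2:
  fixes f :: "real^'n \<Rightarrow> real"
  assumes "continuous_on UNIV f" "bounded S" "S \<in> sets lebesgue"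
  shows "f \<in> L2 S"
proof -
  have "integrable (lebesgue_on (closure S)) (\<lambda>x. (f x)\<^sup>2)"
    using continuous_locally_integrable[of "\<lambda>x. (f x)\<^sup>2" UNIV, OF continuous_on_power[OF assms(1)]] assms(2)
    unfolding locally_integrable_def by (simp add: compact_closure)
  moreover have "closure S \<in> sets lebesgue"
    using assms(2) by (intro compact_sets_lebesgue) (simp add: compact_closure)
  ultimately have "integrable (lebesgue_on S) (\<lambda>x. (f x)\<^sup>2)"
    using integrable_lebesgue_on_subset[OF closure_subset assms(3)] by blast
  moreover have "f \<in> borel_measurable (lebesgue_on S)"
    by (rule continuous_imp_measurable_on_sets_lebesgue) (use assms continuous_on_subset in auto)
  ultimately show ?thesis by (simp add: L2_def)
qed

lemma L2_integrable_bounded: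
  assumes "f \<in> L2 S" "bounded S" "S \<in> sets lebesgue"
  shows "integrable (lebesgue_on S) f"
  using L2_mult_integrable[OF assms(1) continuous_L2[of "\<lambda>_. 1" S]] assms by simp

lemma L2_locally_integrable:
  assumes "f \<in> L2 \<Omega>" "\<Omega> \<in> sets lebesgue" shows "locally_integrable \<Omega> f"
  unfolding locally_integrable_def
  using L2_integrable_bounded L2_subset[OF assms(1) _ _ assms(2)] compact_sets_lebesgue compact_imp_bounded
  by metis

text \<open>The representative picked by \<open>SOME\<close> may differ from the square-integrable
  one supplied by the definition; uniqueness almost everywhere transfers integrability to
  it.\<close>

lemma sobolev_weak_deriv:
  assumes "u \<in> sobolev k \<Omega>" "length is \<le> k" "open \<Omega>"
  shows "has_weak_deriv \<Omega> is u (weak_deriv \<Omega> is u)" "weak_deriv \<Omega> is u \<in> L2 \<Omega>"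
proof -
  obtain v where v: "v \<in> L2 \<Omega>" "has_weak_deriv \<Omega> is u v" using assms by (auto simp: sobolev_def)
  show "has_weak_deriv \<Omega> is u (weak_deriv \<Omega> is u)" by (rule has_weak_deriv_weak_deriv) fact
  have "AE x in lebesgue_on \<Omega>. v x = weak_deriv \<Omega> is u x"
    using weak_deriv_AE[OF assms(3) v(2)] by eventually_elim simp
  then show "weak_deriv \<Omega> is u \<in> L2 \<Omega>" by (rule L2_AE[OF v(1)]) (rule open_sets_lebesgue[OF assms(3)])
qed

lemma test_functions_sobolev0:
  fixes \<phi> :: "real^'n \<Rightarrow> real"
  assumes \<phi>: "\<phi> \<in> test_functions \<Omega>" and "open \<Omega>" "bounded \<Omega>"
  shows "\<phi> \<in> sobolev0 k \<Omega>"
proof -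
  have L: "partial_derivs is \<phi> \<in> L2 \<Omega>" for "is"
    by (intro continuous_L2 smooth_continuous_on smooth_partial_derivs smooth_test[OF \<phi>] open_sets_lebesgue assms)
  \<comment> \<open>In the constant approximating sequence the error is the zero function, but its
    chosen weak derivatives are known to vanish only almost everywhere.\<close>
  have z: "weak_deriv \<Omega> is (\<lambda>_. 0) \<in> L2 \<Omega> \<and> L2_norm \<Omega> (weak_deriv \<Omega> is (\<lambda>_. 0)) = 0" for "is"
  proof -
    have "has_weak_deriv \<Omega> is (\<lambda>_. 0) (\<lambda>_. 0)"
      using continuous_locally_integrable[of "\<lambda>_. 0" \<Omega>] by (simp add: has_weak_deriv_def L2_inner_def)
    then have ae: "AE x in lebesgue_on \<Omega>. weak_deriv \<Omega> is (\<lambda>_. 0) x = 0"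
      by (rule weak_deriv_AE[OF assms(2)])
    have "AE x in lebesgue_on \<Omega>. 0 = weak_deriv \<Omega> is (\<lambda>_. 0) x"
      using ae by eventually_elim simp
    then have w: "weak_deriv \<Omega> is (\<lambda>_. 0) \<in> L2 \<Omega>"
      using L2_AE[OF continuous_L2[OF continuous_on_const assms(3)]] open_sets_lebesgue[OF assms(2)] by blast
    have "L2_inner \<Omega> (weak_deriv \<Omega> is (\<lambda>_. 0)) (weak_deriv \<Omega> is (\<lambda>_. 0)) = 0"
      unfolding L2_inner_def
    proof (rule integral_eq_zero_AE)
      show "AE x in lebesgue_on \<Omega>. weak_deriv \<Omega> is (\<lambda>_. 0) x * weak_deriv \<Omega> is (\<lambda>_. 0) x = 0"
        using ae by eventually_elim simp
    qed
    with w show ?thesis by (simp add: L2_norm_def)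
  qed
  have "\<phi> \<in> sobolev k \<Omega>"
    unfolding sobolev_def mem_Collect_eq
    using L[of "[]"] L has_weak_deriv_smooth[OF smooth_test[OF \<phi>] assms(2)] unfolding partial_derivs_Nil by blast
  moreover have "sobolev_norm k \<Omega> (\<lambda>x. \<phi> x - \<phi> x) = 0"
    by (simp add: sobolev_norm_def sobolev_seminorm_def z)
  ultimately show ?thesis
    using \<phi> unfolding sobolev0_def by (auto intro!: exI[of _ "\<lambda>_. \<phi>"])
qed

lemma hessian_form_eq_sum:
  assumes "\<And>i j. weak_deriv \<Omega> [i, j] u \<in> L2 \<Omega>" "\<And>i j. weak_deriv \<Omega> [i, j] v \<in> L2 \<Omega>"
  shows "hessian_form \<Omega> u v = (\<Sum>i\<in>UNIV. \<Sum>j\<in>UNIV. L2_inner \<Omega> (weak_deriv \<Omega> [i, j] u) (weak_deriv \<Omega> [i, j] v))"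
  unfolding hessian_form_def L2_inner_def weak_hessian_def inner_vec_def
  using assms by (simp add: L2_mult_integrable Bochner_Integration.integral_sum Bochner_Integration.integrable_sum)

lemma L2_inner_cong_AE:
  fixes v v' w w' :: "real^'n \<Rightarrow> real"
  assumes "v \<in> L2 \<Omega>" "w \<in> L2 \<Omega>" "\<Omega> \<in> sets lebesgue"
    "AE x in lebesgue_on \<Omega>. v x = v' x" "AE x in lebesgue_on \<Omega>. w x = w' x"
  shows "L2_inner \<Omega> v w = L2_inner \<Omega> v' w'"
proof -
  have *: "v' \<in> L2 \<Omega>" "w' \<in> L2 \<Omega>"
    using L2_AE[OF assms(1,4,3)] L2_AE[OF assms(2,5,3)] by simp_all
  have "AE x in lebesgue_on \<Omega>. v x * w x = v' x * w' x"
    using assms(4,5) by eventually_elim simp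
  then show ?thesis unfolding L2_inner_def
    by (intro integral_cong_AE borel_measurable_integrable L2_mult_integrable assms *)
qed

text \<open>The variational equation is tested with smooth compactly supported functions. The
  \<open>[i, j]\<close> weak derivative of such a function is \<open>partial_derivs [j, i]\<close>;
  moving these two directions onto \<open>weak_deriv \<Omega> [i, j] u\<close> appends them, which
  explains the order \<open>[i, j, j, i]\<close>.\<close>

theorem biharmonic_strong_form:
  fixes u :: "real^'n \<Rightarrow> real"
  assumes "open \<Omega>" "bounded \<Omega>" "u \<in> sobolev 4 \<Omega>" "f \<in> L2 \<Omega>"
    and eq: "\<forall>v\<in>sobolev0 2 \<Omega>. hessian_form \<Omega> u v = L2_inner \<Omega> f v"
  shows "AE x in lebesgue_on \<Omega>. f x = (\<Sum>i\<in>UNIV. \<Sum>j\<in>UNIV. weak_deriv \<Omega> [i, j, j, i] u x)"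
proof -
  let ?U = "\<lambda>is. weak_deriv \<Omega> is u"
  have Om: "\<Omega> \<in> sets lebesgue" by (rule open_sets_lebesgue) fact
  have U: "has_weak_deriv \<Omega> is u (?U is)" "?U is \<in> L2 \<Omega>" if "length is \<le> 4" for "is"
    using sobolev_weak_deriv[OF assms(3) that assms(1)] .
  have li: "locally_integrable \<Omega> f" "length is \<le> 4 \<Longrightarrow> locally_integrable \<Omega> (?U is)" for "is"
    using L2_locally_integrable assms(4) U(2) Om by blast+
  have liS: "locally_integrable \<Omega> (\<lambda>x. \<Sum>i\<in>UNIV. \<Sum>j\<in>UNIV. ?U [i, j, j, i] x)"
    by (intro locally_integrable_sum li) simp
  have "AE x in lebesgue_on \<Omega>. f x - (\<Sum>i\<in>UNIV. \<Sum>j\<in>UNIV. ?U [i, j, j, i] x) = 0"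
  proof (rule fundamental_lemma[OF assms(1)])
    show "locally_integrable \<Omega> (\<lambda>x. f x - (\<Sum>i\<in>UNIV. \<Sum>j\<in>UNIV. ?U [i, j, j, i] x))"
      by (rule locally_integrable_diff[OF li(1) liS])
    fix \<phi> assume \<phi>: "\<phi> \<in> test_functions \<Omega>"
    have wd: "AE x in lebesgue_on \<Omega>. weak_deriv \<Omega> [i, j] \<phi> x = partial_derivs [j, i] \<phi> x" for i j
      using weak_deriv_AE[OF assms(1) has_weak_deriv_smooth[OF smooth_test[OF \<phi>] assms(1), of "[i, j]"]] by simp
    have \<phi>4: "\<phi> \<in> sobolev 2 \<Omega>" "\<phi> \<in> sobolev0 2 \<Omega>"
      using test_functions_sobolev0[OF \<phi> assms(1,2), of 2] by (auto simp: sobolev0_def)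
    have D2: "weak_deriv \<Omega> [i, j] \<phi> \<in> L2 \<Omega>" for i j
      using sobolev_weak_deriv(2)[OF \<phi>4(1) _ assms(1)] by simp
    have "L2_inner \<Omega> f \<phi> = hessian_form \<Omega> u \<phi>" using eq \<phi>4 by simp
    also have "\<dots> = (\<Sum>i\<in>UNIV. \<Sum>j\<in>UNIV. L2_inner \<Omega> (?U [i, j]) (weak_deriv \<Omega> [i, j] \<phi>))"
      by (rule hessian_form_eq_sum) (auto intro: U D2)
    also have "\<dots> = (\<Sum>i\<in>UNIV. \<Sum>j\<in>UNIV. L2_inner \<Omega> (?U [i, j, j, i]) \<phi>)"
    proof (intro sum.cong refl)
      fix i j
      have "L2_inner \<Omega> (?U [i, j]) (weak_deriv \<Omega> [i, j] \<phi>) = L2_inner \<Omega> (?U [i, j]) (partial_derivs [j, i] \<phi>)"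
        by (rule L2_inner_cong_AE) (use U D2 Om wd in auto)
      also have "has_weak_deriv \<Omega> [j, i] (?U [i, j]) (?U [i, j, j, i])"
        by (rule has_weak_deriv_trans[of _ "[i, j]" _ u]) (auto intro: U)
      then have "L2_inner \<Omega> (?U [i, j]) (partial_derivs [j, i] \<phi>) = L2_inner \<Omega> (?U [i, j, j, i]) \<phi>"
        using \<phi> by (simp add: has_weak_deriv_def)
      finally show "L2_inner \<Omega> (?U [i, j]) (weak_deriv \<Omega> [i, j] \<phi>) = L2_inner \<Omega> (?U [i, j, j, i]) \<phi>" .
    qed
    also have "\<dots> = L2_inner \<Omega> (\<lambda>x. \<Sum>i\<in>UNIV. \<Sum>j\<in>UNIV. ?U [i, j, j, i] x) \<phi>"
      unfolding L2_inner_def sum_distrib_right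
      by (simp add: Bochner_Integration.integral_sum Bochner_Integration.integrable_sum
          locally_integrable_mult_test[OF assms(1) li(2) \<phi>])
    finally show "L2_inner \<Omega> (\<lambda>x. f x - (\<Sum>i\<in>UNIV. \<Sum>j\<in>UNIV. ?U [i, j, j, i] x)) \<phi> = 0"
      using locally_integrable_mult_test[OF assms(1) li(1) \<phi>]
        locally_integrable_mult_test[OF assms(1) liS \<phi>]
      by (simp add: L2_inner_def left_diff_distrib)
  qed
  then show ?thesis by eventually_elim simp
qed

section \<open>Geometry of uniform cube partitions\<close>

lemma mem_cube: "x \<in> cube h c \<longleftrightarrow> (\<forall>k. \<bar>x $ k - c $ k\<bar> \<le> h)"
  unfolding cube_def mem_box_cart by (simp add: abs_le_iff algebra_simps) (meson add_le_cancel_left diff_le_eq le_diff_eq)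

lemma interior_cube_eq_box: "interior (cube h c) = box (\<chi> i. c $ i - h) (\<chi> i. c $ i + h)"
  by (simp add: cube_def interior_cbox)

lemma mem_interior_cube: "x \<in> interior (cube h c) \<longleftrightarrow> (\<forall>k. \<bar>x $ k - c $ k\<bar> < h)"
  unfolding interior_cube_eq_box mem_box_cart by (simp add: abs_less_iff) (smt (verit, best))

lemma convex_cube: "convex (cube h c)"
  by (simp add: cube_def)

lemma cube_inject:
  assumes "cube h c = cube h c'" "h > 0"
  shows "c = c'"
proof -
  have "\<bar>c' $ k + h - c $ k\<bar> \<le> h" "\<bar>c' $ k - h - c $ k\<bar> \<le> h" for k
  proof -
    have "(\<chi> j. c' $ j + h) \<in> cube h c" "(\<chi> j. c' $ j - h) \<in> cube h c"
      unfolding assms(1) using assms(2) by (auto simp: mem_cube)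
    then show "\<bar>c' $ k + h - c $ k\<bar> \<le> h" "\<bar>c' $ k - h - c $ k\<bar> \<le> h"
      unfolding mem_cube by (simp_all add: vec_lambda_beta)
  qed
  then have "c $ k = c' $ k" for k by (smt (verit, best))
  then show ?thesis by (simp add: vec_eq_iff)
qed

text \<open>The sign \<open>s\<close>, which is 1 or -1, selects one of the two opposite faces
  normal to direction \<open>i\<close>, so that both are treated at once.\<close>

definition cube_face :: "real \<Rightarrow> real^'n \<Rightarrow> 'n \<Rightarrow> real \<Rightarrow> (real^'n) set" where
  "cube_face h c i s = cube h c \<inter> {x. x $ i = c $ i + s * h}"

lemma mem_cube_face:
  assumes "h > 0" "\<bar>s\<bar> = 1"
  shows "x \<in> cube_face h c i s \<longleftrightarrow> x $ i = c $ i + s * h \<and> (\<forall>k. k \<noteq> i \<longrightarrow> \<bar>x $ k - c $ k\<bar> \<le> h)"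
proof -
  have "\<bar>s * h\<bar> \<le> h" using assms by (simp add: abs_mult)
  show ?thesis
  proof
    assume R: "x $ i = c $ i + s * h \<and> (\<forall>k. k \<noteq> i \<longrightarrow> \<bar>x $ k - c $ k\<bar> \<le> h)"
    then have "\<bar>x $ k - c $ k\<bar> \<le> h" for k using \<open>\<bar>s * h\<bar> \<le> h\<close> by (cases "k = i") auto
    with R show "x \<in> cube_face h c i s" by (simp add: cube_face_def mem_cube)
  qed (simp add: cube_face_def mem_cube)
qed

lemma cube_face_neighbour:
  assumes "h > 0" "\<bar>s\<bar> = 1"
  shows "cube_face h (c + (2 * s * h) *\<^sub>R axis i 1) i (- s) = cube_face h c i s"
proof -
  have "x \<in> cube_face h (c + (2 * s * h) *\<^sub>R axis i 1) i (- s) \<longleftrightarrow> x \<in> cube_face h c i s" for x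
    using assms by (subst (1 2) mem_cube_face) (auto simp: axis_def)
  then show ?thesis by blast
qed

text \<open>The hyperplane of the face supports the cube, which gives a face. Its dimension is that
  of the hyperplane because the face contains a relatively open piece of it.\<close>

lemma cube_face_facet_of:
  fixes c :: "real^'n"
  assumes "h > 0" "\<bar>s\<bar> = 1"
  shows "cube_face h c i s facet_of cube h c"
proof -
  let ?F = "cube_face h c i s" and ?H = "{x :: real^'n. axis i 1 \<bullet> x = c $ i + s * h}"
  have F: "?F = cube h c \<inter> ?H" by (simp add: cube_face_def inner_axis')
  have s: "s = 1 \<or> s = -1" using assms(2) by linarith
  have "?F face_of cube h c"
    using s
  proof
    assume "s = 1"
    show ?thesis unfolding F
      by (rule face_of_Int_supporting_hyperplane_le[OF convex_cube])
         (auto simp: inner_axis' mem_cube \<open>s = 1\<close> abs_le_iff diff_le_eq add.commute)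
  next
    assume "s = -1"
    have "c $ i - h \<le> x $ i" if "x \<in> cube h c" for x
      using that unfolding mem_cube by (smt (verit, best))
    then show ?thesis unfolding F
      by (intro face_of_Int_supporting_hyperplane_ge[OF convex_cube])
         (auto simp: inner_axis' \<open>s = -1\<close>)
  qed
  moreover have m: "c + (s * h) *\<^sub>R axis i 1 \<in> ?F"
    using assms by (subst mem_cube_face) (auto simp: axis_def)
  moreover have "aff_dim ?F = aff_dim (cube h c) - 1"
  proof -
    \<comment> \<open>An open tube around the axis in direction \<open>i\<close> through the centre;
      it cuts the relative interior of the face out of the hyperplane.\<close>
    let ?B = "{x :: real^'n. \<forall>k. k \<noteq> i \<longrightarrow> \<bar>x $ k - c $ k\<bar> < h}"
    have "?B = (\<Inter>k\<in>UNIV - {i}. {x. \<bar>x $ k - c $ k\<bar> < h})" by auto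
    moreover have "open {x::real^'n. \<bar>x $ k - c $ k\<bar> < h}" for k
      by (intro open_Collect_less continuous_intros)
    ultimately have "open ?B" by (metis (no_types, lifting) finite open_INT)
    moreover have "c + (s * h) *\<^sub>R axis i 1 \<in> ?H \<inter> ?B"
      using assms by (simp only: Int_iff mem_Collect_eq inner_axis') (auto simp: axis_def)
    then have "?H \<inter> ?B \<noteq> {}" by blast
    ultimately have a: "affine hull (?H \<inter> ?B) = affine hull ?H"
      by (intro affine_hull_affine_Int_open affine_hyperplane)
    have "?H \<inter> ?B \<subseteq> ?F"
    proof
      fix x assume "x \<in> ?H \<inter> ?B"
      then show "x \<in> ?F"
        by (subst mem_cube_face[OF assms]) (auto simp: inner_axis' less_imp_le)
    qed
    then have "affine hull ?H \<subseteq> affine hull ?F" unfolding a[symmetric] by (rule hull_mono)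
    moreover have "affine hull ?F \<subseteq> affine hull ?H" by (rule hull_mono) (auto simp: F)
    ultimately have "affine hull ?F = affine hull ?H" by blast
    then have "aff_dim ?F = aff_dim ?H" by (metis aff_dim_affine_hull)
    also have "\<dots> = int (DIM(real^'n) - 1)" by (rule aff_dim_hyperplane) (simp add: axis_eq_0_iff)
    finally have "aff_dim ?F = int (DIM(real^'n)) - 1" using DIM_positive[where 'a = "real^'n"] by linarith
    moreover have "c \<in> interior (cube h c)" using assms by (simp add: mem_interior_cube)
    then have "interior (cube h c) \<noteq> {}" by blast
    then have "aff_dim (cube h c) = int (DIM(real^'n))" by (rule aff_dim_nonempty_interior)
    ultimately show ?thesis by simp
  qed
  ultimately show ?thesis unfolding facet_of_def by blast
qed

text \<open>Coordinatewise: an endpoint of an interval is a proper convex combination of two points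
  of the interval only if both equal that endpoint.\<close>

lemma vertex_extreme_point_of_cube:
  assumes "\<And>k. \<bar>x $ k - c $ k\<bar> = h"
  shows "x extreme_point_of cube h c"
proof -
  have "x \<in> cube h c" using assms by (simp add: mem_cube)
  moreover have False if ab: "a \<in> cube h c" "b \<in> cube h c" and x: "x \<in> open_segment a b" for a b
  proof -
    obtain u where u: "0 < u" "u < 1" "x = (1 - u) *\<^sub>R a + u *\<^sub>R b" and "a \<noteq> b"
      using x unfolding in_segment by blast
    have "a $ k = b $ k" for k
    proof -
      define p q where "p = a $ k - c $ k" and "q = b $ k - c $ k"
      have "x $ k = (1 - u) * a $ k + u * b $ k" by (simp add: u(3))
      then have xk: "x $ k - c $ k = (1 - u) * p + u * q" by (simp add: p_def q_def algebra_simps)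
      have pq: "\<bar>p\<bar> \<le> h" "\<bar>q\<bar> \<le> h" using ab unfolding mem_cube p_def q_def by auto
      have "x $ k - c $ k = h \<or> x $ k - c $ k = - h" using assms[of k] by linarith
      then have "p = q"
      proof
        assume "x $ k - c $ k = h"
        then have "(1 - u) * (h - p) + u * (h - q) = 0" using xk by (simp add: algebra_simps)
        moreover have "0 \<le> (1 - u) * (h - p)" "0 \<le> u * (h - q)" using u pq by auto
        ultimately have "(1 - u) * (h - p) = 0" "u * (h - q) = 0" by linarith+
        then show ?thesis using u by simp
      next
        assume "x $ k - c $ k = - h"
        then have "(1 - u) * (h + p) + u * (h + q) = 0" using xk by (simp add: algebra_simps)
        moreover have "0 \<le> (1 - u) * (h + p)" "0 \<le> u * (h + q)" using u pq by auto
        ultimately have "(1 - u) * (h + p) = 0" "u * (h + q) = 0" by linarith+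
        then show ?thesis using u by simp
      qed
      then show ?thesis by (simp add: p_def q_def)
    qed
    then show False using \<open>a \<noteq> b\<close> by (simp add: vec_eq_iff)
  qed
  ultimately show ?thesis unfolding extreme_point_of_def by blast
qed

text \<open>A Lipschitz domain lies on one side of its boundary and so has no slits: below a
  boundary point, in the rotated vertical direction, there are points arbitrarily near with a
  neighbourhood disjoint from the domain. This is what puts the face between two adjacent cells
  inside the domain, up to its relative boundary.\<close>

lemma lipschitz_domain_interior_closure:
  assumes "lipschitz_domain \<Omega>"
  shows "interior (closure \<Omega>) \<subseteq> \<Omega>"
proof
  fix x assume x: "x \<in> interior (closure \<Omega>)"
  have "open \<Omega>" using assms by (simp add: lipschitz_domain_def)
  show "x \<in> \<Omega>"
  proof (rule ccontr)
    assume nx: "x \<notin> \<Omega>"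
    then have "x \<in> frontier \<Omega>"
      using x interior_subset[of "closure \<Omega>"] \<open>open \<Omega>\<close> by (auto simp: frontier_def interior_open)
    then obtain r and R :: "real^3 \<Rightarrow> real^3" and L and g :: "real \<times> real \<Rightarrow> real" where r: "r > 0"
      and R: "orthogonal_transformation R" and g: "L-lipschitz_on UNIV g"
      and eq: "\<Omega> \<inter> ball x r = {y \<in> ball x r. g (R y $ 1, R y $ 2) < R y $ 3}"
      using assms unfolding lipschitz_domain_def by blast
    have lin: "linear R" using R by (rule orthogonal_transformation_linear)
    have contR: "continuous_on UNIV R" using lin by (rule linear_continuous_on_compose[OF continuous_on_id, simplified])
    have contg: "continuous_on UNIV g" using g by (rule lipschitz_on_continuous_on)
    \<comment> \<open>The preimage of the vertical axis: subtracting a multiple of \<open>d\<close>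
      lowers the third rotated coordinate and keeps the other two.\<close>
    obtain d where d: "R d = axis 3 1" using orthogonal_transformation_surj[OF R] by (metis surjD)
    obtain e where e: "e > 0" "ball x e \<subseteq> interior (closure \<Omega>)" using x open_contains_ball by (metis open_interior)
    define q where "q = norm d + 1"
    have q: "q > 0" using norm_ge_zero[of d] unfolding q_def by linarith
    define t where "t = min r e / (2 * q)"
    have t: "t > 0" using r e q by (simp add: t_def)
    have "t * norm d < min r e"
    proof -
      have "t * norm d \<le> t * q" using t by (simp add: q_def)
      also have "\<dots> = min r e / 2" using q by (simp add: t_def)
      also have "\<dots> < min r e"
      proof -
        have "0 < min r e" using r e by simp
        then show ?thesis by linarith
      qed
      finally show ?thesis .
    qed
    define y where "y = x - t *\<^sub>R d"
    have y: "y \<in> ball x r" "y \<in> interior (closure \<Omega>)"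
      using \<open>t * norm d < min r e\<close> t e(2) by (auto simp: y_def dist_norm)
    have Ry: "R y = R x - t *\<^sub>R axis 3 1"
      unfolding y_def by (simp add: linear_diff[OF lin] linear_cmul[OF lin] d)
    have "R x $ 3 \<le> g (R x $ 1, R x $ 2)" using nx eq r by (metis (mono_tags, lifting) IntD1 centre_in_ball leI mem_Collect_eq)
    then have less: "R y $ 3 < g (R y $ 1, R y $ 2)" using t unfolding Ry by (simp add: axis_def)
    define W where "W = ball x r \<inter> {y. R y $ 3 < g (R y $ 1, R y $ 2)}"
    have "continuous_on UNIV (\<lambda>y. g (R y $ 1, R y $ 2))"
      by (rule continuous_on_compose2[OF contg]) (auto intro!: continuous_intros continuous_on_compose2[OF _ contR])
    moreover have "continuous_on UNIV (\<lambda>y. R y $ 3)" by (intro continuous_intros contR)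
    ultimately have "open W" unfolding W_def by (intro open_Int open_ball open_Collect_less)
    moreover have "y' \<notin> \<Omega>" if "y' \<in> W" for y'
    proof
      assume "y' \<in> \<Omega>"
      with that have "y' \<in> \<Omega> \<inter> ball x r" unfolding W_def by blast
      then have "g (R y' $ 1, R y' $ 2) < R y' $ 3" unfolding eq by blast
      with that show False unfolding W_def by simp
    qed
    then have "W \<inter> \<Omega> = {}" by blast
    ultimately have "W \<inter> closure \<Omega> = {}" by (metis open_Int_closure_eq_empty)
    moreover have "y \<in> W" using y(1) less by (simp add: W_def)
    ultimately show False using y(2) interior_subset[of "closure \<Omega>"] by blast
  qed
qed

text \<open>The Lipschitz property enters through its consequence \<open>interior_closure\<close>,
  which keeps the mesh arguments free of charts and of the dimension 3.\<close>

locale cube_mesh =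
  fixes \<Omega> :: "(real^'n) set" and h :: real and \<T> :: "(real^'n) set set"
  assumes open_domain: "open \<Omega>" and bounded_domain: "bounded \<Omega>"
    and interior_closure: "interior (closure \<Omega>) \<subseteq> \<Omega>"
    and h_pos: "h > 0" and partition: "uniform_cube_partition \<Omega> h \<T>"
begin

abbreviation step :: "'n \<Rightarrow> real^'n \<Rightarrow> real^'n" where
  "step i c \<equiv> c + (2 * h) *\<^sub>R axis i 1"

lemma finite_mesh: "finite \<T>" and Union_mesh: "\<Union>\<T> = closure \<Omega>"
  using partition by (simp_all add: uniform_cube_partition_def)

lemma cell_cube: assumes "K \<in> \<T>" obtains c where "K = cube h c"
  using partition assms unfolding uniform_cube_partition_def by blast

lemma cell_subset: "K \<in> \<T> \<Longrightarrow> K \<subseteq> closure \<Omega>"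
  using Union_mesh by blast

lemma interior_cell_subset: "K \<in> \<T> \<Longrightarrow> interior K \<subseteq> \<Omega>"
  using cell_subset interior_closure interior_mono by blast

lemma interior_cells_disjoint:
  assumes "K \<in> \<T>" "K' \<in> \<T>" "K \<noteq> K'"
  shows "interior K \<inter> interior K' = {}"
proof -
  have f: "(K \<inter> K') face_of K" "(K \<inter> K') face_of K'"
    using partition assms by (auto simp: uniform_cube_partition_def)
  consider "K \<inter> K' \<noteq> K" | "K \<inter> K' \<noteq> K'" using assms(3) by blast
  then show ?thesis
    using face_of_disjoint_interior[OF f(1)] face_of_disjoint_interior[OF f(2)]
      interior_subset[of K] interior_subset[of K'] by cases blast+
qed

text \<open>A face that is not in the boundary contains points of the domain. A point slightly
  beyond the face lies in some other cell; conformity aligns this cell with the given one in all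
  tangential directions, and disjointness of interiors fixes its position in direction
  \<open>i\<close>. Hence the cell is exactly the translate, which makes cancellation by translation
  possible later.\<close>

lemma neighbour_or_boundary:
  assumes K: "cube h c \<in> \<T>" and s: "\<bar>s\<bar> = 1"
  shows "cube h (c + (2 * s * h) *\<^sub>R axis i 1) \<in> \<T> \<or> cube_face h c i s \<subseteq> frontier \<Omega>"
proof (rule disjCI)
  assume "\<not> cube_face h c i s \<subseteq> frontier \<Omega>"
  then obtain z0 where z0: "z0 \<in> cube_face h c i s" "z0 \<notin> frontier \<Omega>" by blast
  then have "z0 \<in> closure \<Omega>" using cell_subset[OF K] by (auto simp: cube_face_def)
  with z0(2) have "z0 \<in> \<Omega>" by (simp add: frontier_def interior_open[OF open_domain])
  then obtain e where e: "e > 0" "ball z0 e \<subseteq> \<Omega>" using open_domain open_contains_ball by blast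
  define m where "m = c + (s * h) *\<^sub>R axis i 1"
  \<comment> \<open>Moving \<open>z0\<close> a little towards the centre \<open>m\<close> of the
    face makes the tangential coordinates lie strictly inside the cell, while the second term of the
    minimum keeps the point in the domain.\<close>
  define t where "t = min (1/2) (e / (2 * (norm (m - z0) + 1)))"
  have t: "0 < t" "t < 1" using e by (auto simp: t_def add_nonneg_pos)
  define z where "z = (1 - t) *\<^sub>R z0 + t *\<^sub>R m"
  have "dist z0 z < e"
  proof -
    have "z0 - z = (- t) *\<^sub>R (m - z0)" by (simp add: z_def algebra_simps)
    then have "dist z0 z = t * norm (m - z0)" using t by (simp add: dist_norm)
    also have "\<dots> \<le> e / (2 * (norm (m - z0) + 1)) * (norm (m - z0) + 1)"
      using t e by (intro mult_mono) (auto simp: t_def)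
    also have "\<dots> = e / 2"
      using norm_ge_zero[of "m - z0"] by (simp add: field_simps add_nonneg_eq_0_iff)
    also have "\<dots> < e" using e by simp
    finally show ?thesis .
  qed
  then have zO: "z \<in> \<Omega>" using e by auto
  have z0k: "z0 $ i = c $ i + s * h" "\<And>k. k \<noteq> i \<Longrightarrow> \<bar>z0 $ k - c $ k\<bar> \<le> h"
    using z0(1) unfolding mem_cube_face[OF h_pos s] by auto
  have zi: "z $ i = c $ i + s * h" by (simp add: z_def m_def z0k(1) algebra_simps)
  have zk: "\<bar>z $ k - c $ k\<bar> < h" if "k \<noteq> i" for k
  proof -
    have "z $ k - c $ k = (1 - t) * (z0 $ k - c $ k)" using that by (simp add: z_def m_def axis_def algebra_simps)
    then have "\<bar>z $ k - c $ k\<bar> = (1 - t) * \<bar>z0 $ k - c $ k\<bar>" using t by (simp add: abs_mult)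
    also have "\<dots> \<le> (1 - t) * h" using z0k(2)[OF that] t by (intro mult_left_mono) auto
    also have "\<dots> < h" using t h_pos by simp
    finally show ?thesis .
  qed
  \<comment> \<open>Near \<open>z\<close> only cells that contain \<open>z\<close> occur, so the
    cell found beyond the face meets the given cell at \<open>z\<close>.\<close>
  have "open (\<Omega> - \<Union>{K' \<in> \<T>. z \<notin> K'})"
  proof (intro open_Diff open_domain closed_Union)
    show "\<forall>S\<in>{K' \<in> \<T>. z \<notin> K'}. closed S" using cell_cube by (metis (no_types, lifting) closed_cbox cube_def mem_Collect_eq)
  qed (use finite_mesh in auto)
  moreover have "z \<in> \<Omega> - \<Union>{K' \<in> \<T>. z \<notin> K'}" using zO by blast
  ultimately obtain d where d: "d > 0" "ball z d \<subseteq> \<Omega> - \<Union>{K' \<in> \<T>. z \<notin> K'}"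
    using open_contains_ball by blast
  define y where "y = z + (s * (d / 2)) *\<^sub>R axis i 1"
  have "y \<in> ball z d" using d s by (simp add: y_def dist_norm abs_mult)
  then have "y \<in> \<Omega>" and y': "\<And>K'. K' \<in> \<T> \<Longrightarrow> y \<in> K' \<Longrightarrow> z \<in> K'" using d by blast+
  then obtain K' where K': "K' \<in> \<T>" "y \<in> K'" using Union_mesh closure_subset by blast
  then have zK': "z \<in> K'" using y' by blast
  obtain c' where c': "K' = cube h c'" using cell_cube[OF K'(1)] .
  have yi: "y $ i = c $ i + s * h + s * (d / 2)" by (simp add: y_def zi)
  have s': "s = 1 \<or> s = -1" using s by linarith
  have "y \<notin> cube h c"
    unfolding mem_cube using yi s' d(1) by (auto intro!: exI[of _ i])
  then have ne: "cube h c \<noteq> K'" using K'(2) by blast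
  have zK: "z \<in> cube h c"
    unfolding mem_cube using zi zk s h_pos by (metis abs_mult add_diff_cancel_left' abs_of_pos less_imp_le mult_1 order_refl)
  have face: "(cube h c \<inter> K') face_of cube h c"
    using partition K K'(1) by (auto simp: uniform_cube_partition_def)
  have ck: "c' $ k = c $ k" if k: "k \<noteq> i" for k
  proof -
    \<comment> \<open>The chord through \<open>z\<close> in direction \<open>k\<close>, of full
      length \<open>2 * h\<close>. As \<open>z\<close> is interior to it and lies in the common
      face, both endpoints belong to the other cell, which fixes the centre coordinate.\<close>
    define a where "a = (\<chi> j. if j = k then c $ k + h else z $ j)"
    define b where "b = (\<chi> j. if j = k then c $ k - h else z $ j)"
    have ab: "a \<in> cube h c" "b \<in> cube h c"
      using zK h_pos unfolding mem_cube a_def b_def by auto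
    define u where "u = (c $ k + h - z $ k) / (2 * h)"
    have u: "0 < u" "u < 1" using zk[OF k] h_pos by (auto simp: u_def field_simps abs_less_iff)
    have "z = (1 - u) *\<^sub>R a + u *\<^sub>R b"
    proof -
      have "z $ j = ((1 - u) *\<^sub>R a + u *\<^sub>R b) $ j" for j
      proof (cases "j = k")
        case True
        have "u * (2 * h) = c $ k + h - z $ k" using h_pos by (simp add: u_def)
        then show ?thesis using True by (simp add: a_def b_def algebra_simps)
      qed (simp add: a_def b_def algebra_simps)
      then show ?thesis by (simp add: vec_eq_iff)
    qed
    moreover have "a \<noteq> b"
    proof
      assume "a = b"
      then have "a $ k = b $ k" by simp
      then show False using h_pos by (simp add: a_def b_def)
    qed
    ultimately have "z \<in> open_segment a b" using u unfolding in_segment by blast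
    then have "a \<in> K'" "b \<in> K'"
      using face zK zK' ab unfolding face_of_def by blast+
    then have "\<bar>a $ k - c' $ k\<bar> \<le> h" "\<bar>b $ k - c' $ k\<bar> \<le> h" unfolding c' mem_cube by auto
    then show ?thesis by (simp add: a_def b_def)
  qed
  have i1: "\<bar>c $ i + s * h - c' $ i\<bar> \<le> h" using zK' zi unfolding c' mem_cube by metis
  have i2: "\<bar>c $ i + s * h + s * (d / 2) - c' $ i\<bar> \<le> h" using K'(2) yi unfolding c' mem_cube by metis
  have ci: "c' $ i = c $ i + 2 * s * h"
  proof (rule ccontr)
    assume "c' $ i \<noteq> c $ i + 2 * s * h"
    then have lt: "\<bar>c' $ i - c $ i\<bar> < 2 * h" using i1 i2 s' d(1) by auto
    \<comment> \<open>If the offset in direction \<open>i\<close> were below \<open>2 * h\<close>,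
      the midpoint of the centres would lie in both interiors.\<close>
    define p where "p = (\<chi> j. (c $ j + c' $ j) / 2)"
    have "\<bar>p $ k - c $ k\<bar> < h \<and> \<bar>p $ k - c' $ k\<bar> < h" for k
      using lt ck[of k] h_pos by (cases "k = i") (auto simp: p_def field_simps abs_if split: if_splits)
    then have "p \<in> interior (cube h c) \<inter> interior K'" unfolding c' by (simp add: mem_interior_cube)
    then show False using interior_cells_disjoint[OF K K'(1) ne] by blast
  qed
  have "c' = c + (2 * s * h) *\<^sub>R axis i 1"
    using ck ci by (simp add: vec_eq_iff axis_def)
  then show "cube h (c + (2 * s * h) *\<^sub>R axis i 1) \<in> \<T>" using K'(1) c' by simp
qed

text \<open>The open box is covered by the two closed cells, hence by the closure of the domain;
  being open, it lies in the domain itself, including the relative interior of the common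
  face.\<close>

lemma neighbour_box_subset:
  assumes "cube h c \<in> \<T>" "cube h (step i c) \<in> \<T>"
  shows "box (\<chi> k. c $ k - h) (\<chi> k. if k = i then c $ k + 3 * h else c $ k + h) \<subseteq> \<Omega>" (is "?B \<subseteq> _")
proof -
  have "?B \<subseteq> cube h c \<union> cube h (step i c)"
  proof
    fix x assume "x \<in> ?B"
    then have *: "\<And>k. c $ k - h < x $ k \<and> x $ k < (if k = i then c $ k + 3 * h else c $ k + h)"
      by (simp add: mem_box_cart)
    have k: "\<bar>x $ k - c $ k\<bar> \<le> h" if "k \<noteq> i" for k using *[of k] that by (simp add: abs_le_iff)
    consider "x $ i \<le> c $ i + h" | "x $ i > c $ i + h" by linarith
    then show "x \<in> cube h c \<union> cube h (step i c)"
    proof cases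
      case 1
      then have "\<bar>x $ i - c $ i\<bar> \<le> h" using *[of i] by (simp add: abs_le_iff)
      then have "x \<in> cube h c" using k unfolding mem_cube by metis
      then show ?thesis by blast
    next
      case 2
      then have "\<bar>x $ i - (c $ i + 2 * h)\<bar> \<le> h" using *[of i] by (simp add: abs_le_iff)
      then have "x \<in> cube h (step i c)" using k unfolding mem_cube by (auto simp: axis_def)
      then show ?thesis by blast
    qed
  qed
  also have "\<dots> \<subseteq> closure \<Omega>" using assms cell_subset by blast
  finally show ?thesis using interior_maximal[OF _ open_box] interior_closure by blast
qed

lemma neighbour_face_not_boundary:
  assumes "cube h c \<in> \<T>" "cube h (step i c) \<in> \<T>"
  shows "\<not> cube_face h c i 1 \<subseteq> frontier \<Omega>"
proof -
  have m: "c + h *\<^sub>R axis i 1 \<in> cube_face h c i 1"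
    using h_pos by (subst mem_cube_face) (auto simp: axis_def)
  have "c + h *\<^sub>R axis i 1 \<in> \<Omega>"
    by (rule subsetD[OF neighbour_box_subset[OF assms]]) (use h_pos in \<open>auto simp: mem_box_cart axis_def\<close>)
  then have "c + h *\<^sub>R axis i 1 \<notin> frontier \<Omega>" by (simp add: frontier_def interior_open[OF open_domain])
  with m show ?thesis by blast
qed

text \<open>The points missed are on cell frontiers, which are null sets as frontiers of convex
  sets.\<close>

lemma Omega_AE_interior: "AE x in lebesgue. x \<in> \<Omega> \<longleftrightarrow> (\<exists>K\<in>\<T>. x \<in> interior K)"
proof -
  have "negligible (frontier K)" if "K \<in> \<T>" for K
    using cell_cube[OF that] convex_cube negligible_convex_frontier by metis
  then have "negligible (\<Union>K\<in>\<T>. frontier K)" using finite_mesh by (intro negligible_Union) auto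
  then have "AE x in lebesgue. x \<notin> (\<Union>K\<in>\<T>. frontier K)"
    using AE_not_in negligible_iff_null_sets by blast
  then show ?thesis
  proof eventually_elim
    case (elim x)
    show ?case
    proof
      assume "x \<in> \<Omega>"
      then obtain K where K: "K \<in> \<T>" "x \<in> K" using Union_mesh closure_subset by blast
      then have "x \<in> interior K" using elim closure_subset unfolding frontier_def by blast
      then show "\<exists>K\<in>\<T>. x \<in> interior K" using K by blast
    qed (use interior_cell_subset in blast)
  qed
qed

lemma integral_cells:
  fixes f :: "real^'n \<Rightarrow> real"
  assumes f: "integrable (lebesgue_on \<Omega>) f"
  shows "(\<integral>x. f x \<partial>lebesgue_on \<Omega>) = (\<Sum>K\<in>\<T>. \<integral>x. f x \<partial>lebesgue_on (interior K))"
proof -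
  have Om: "\<Omega> \<in> sets lebesgue" by (rule open_sets_lebesgue[OF open_domain])
  have iK: "integrable lebesgue (\<lambda>x. if x \<in> interior K then f x else 0)" if "K \<in> \<T>" for K
    using integrable_lebesgue_on_subset[OF interior_cell_subset[OF that] _ Om f] open_sets_lebesgue[OF open_interior]
    by (simp add: Lebesgue_Measure.integrable_restrict_UNIV)
  have "(\<integral>x. f x \<partial>lebesgue_on \<Omega>) = (\<integral>x. (if x \<in> \<Omega> then f x else 0) \<partial>lebesgue)"
    by (simp add: Lebesgue_Measure.integral_restrict_UNIV Om)
  also have "\<dots> = (\<integral>x. (\<Sum>K\<in>\<T>. if x \<in> interior K then f x else 0) \<partial>lebesgue)"
  proof (rule integral_cong_AE)
    show "(\<lambda>x. if x \<in> \<Omega> then f x else 0) \<in> borel_measurable lebesgue"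
      using f Om by (simp add: borel_measurable_if)
    show "(\<lambda>x. \<Sum>K\<in>\<T>. if x \<in> interior K then f x else 0) \<in> borel_measurable lebesgue"
      using iK by (intro borel_measurable_sum borel_measurable_integrable)
    show "AE x in lebesgue. (if x \<in> \<Omega> then f x else 0) = (\<Sum>K\<in>\<T>. if x \<in> interior K then f x else 0)"
      using Omega_AE_interior
    proof eventually_elim
      case (elim x)
      show ?case
      proof (cases "x \<in> \<Omega>")
        case True
        then obtain K where K: "K \<in> \<T>" "x \<in> interior K" using elim by blast
        have "(\<Sum>L\<in>\<T>. if x \<in> interior L then f x else 0) = (\<Sum>L\<in>\<T>. if L = K then f x else 0)"
        proof (rule sum.cong)
          fix L assume "L \<in> \<T>"
          then show "(if x \<in> interior L then f x else 0) = (if L = K then f x else 0)"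
            using interior_cells_disjoint[OF \<open>L \<in> \<T>\<close> K(1)] K(2) by auto
        qed simp
        then show ?thesis using True K finite_mesh by simp
      next
        case False
        then have "(\<Sum>K\<in>\<T>. if x \<in> interior K then f x else 0) = 0"
          using elim by (intro sum.neutral) auto
        with False show ?thesis by simp
      qed
    qed
  qed
  also have "\<dots> = (\<Sum>K\<in>\<T>. \<integral>x. (if x \<in> interior K then f x else 0) \<partial>lebesgue)"
    by (rule Bochner_Integration.integral_sum) (rule iK)
  also have "\<dots> = (\<Sum>K\<in>\<T>. \<integral>x. f x \<partial>lebesgue_on (interior K))"
    by (intro sum.cong refl) (simp add: Lebesgue_Measure.integral_restrict_UNIV open_sets_lebesgue)
  finally show ?thesis .
qed

end

section \<open>Elementwise integration by parts\<close>

definition loc :: "real \<Rightarrow> real^'n \<Rightarrow> 'n \<Rightarrow> real^'n \<Rightarrow> real" where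
  "loc h c k x = (x $ k - c $ k) / h"

lemma loc_elementary: "elementary (loc h c k)"
  unfolding loc_def[abs_def] by (intro elementary_intros)

lemma loc_has_derivative: "(loc h c k has_derivative (\<lambda>v. v $ k / h)) (at x)"
proof -
  have "((\<lambda>x. x $ k - c $ k) has_derivative (\<lambda>v. v $ k)) (at x)"
    using has_derivative_diff[OF coord_has_derivative has_derivative_const] by simp
  from bounded_linear.has_derivative[OF bounded_linear_divide this, of h]
  show ?thesis unfolding loc_def[abs_def] .
qed

lemma abs_loc_le_1:
  assumes "x \<in> interior (cube h c)" "h > 0"
  shows "\<bar>loc h c k x\<bar> \<le> 1"
proof -
  have "\<bar>x $ k - c $ k\<bar> \<le> h" using assms(1) unfolding mem_interior_cube by (simp add: less_imp_le)
  then show ?thesis using assms(2) by (simp add: loc_def abs_divide)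
qed

context cube_mesh
begin

text \<open>Indexing cells by their centres turns passage to a neighbour into the translation
  \<open>step\<close>.\<close>

definition centres :: "(real^'n) set" where
  "centres = {c. cube h c \<in> \<T>}"

lemma sum_cells: "(\<Sum>K\<in>\<T>. f K) = (\<Sum>c\<in>centres. f (cube h c))"
proof (rule sum.reindex_bij_betw[symmetric])
  show "bij_betw (cube h) centres \<T>"
    unfolding bij_betw_def
  proof
    show "inj_on (cube h) centres" by (rule inj_onI) (rule cube_inject[OF _ h_pos])
    show "cube h ` centres = \<T>"
    proof
      show "\<T> \<subseteq> cube h ` centres"
      proof
        fix K assume K: "K \<in> \<T>"
        obtain c where "K = cube h c" using cell_cube[OF K] .
        with K show "K \<in> cube h ` centres" by (simp add: centres_def)
      qed
    qed (auto simp: centres_def)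
  qed
qed

lemma finite_centres: "finite centres"
proof -
  have "inj_on (cube h) centres" by (rule inj_onI) (rule cube_inject[OF _ h_pos])
  moreover have "finite (cube h ` centres)" by (rule finite_subset[OF _ finite_mesh]) (auto simp: centres_def)
  ultimately show ?thesis by (rule finite_imageD[rotated])
qed

lemma centre_interior: "c \<in> centres \<Longrightarrow> interior (cube h c) \<subseteq> \<Omega>"
  by (simp add: centres_def interior_cell_subset)

abbreviation cell_measure :: "real^'n \<Rightarrow> (real^'n) measure" where
  "cell_measure c \<equiv> lebesgue_on (interior (cube h c))"

abbreviation pairing :: "(real^'n \<Rightarrow> real) \<Rightarrow> (real^'n \<Rightarrow> real^'n \<Rightarrow> real) \<Rightarrow> real" where
  "pairing v \<phi> \<equiv> \<Sum>c\<in>centres. \<integral>x. v x * \<phi> c x \<partial>cell_measure c"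

lemma L2_cell: "v \<in> L2 \<Omega> \<Longrightarrow> c \<in> centres \<Longrightarrow> v \<in> L2 (interior (cube h c))"
  using L2_subset[of v \<Omega> "interior (cube h c)"] centre_interior open_sets_lebesgue[OF open_domain]
    open_sets_lebesgue[OF open_interior] by blast

lemma bounded_cell: "bounded (interior (cube h c))"
  by (simp add: interior_cube_eq_box bounded_box)

lemma elementary_L2_cell: "elementary g \<Longrightarrow> g \<in> L2 (interior (cube h c))"
  by (rule continuous_L2[OF smooth_continuous_on[OF elementary_smooth] bounded_cell open_sets_lebesgue[OF open_interior]])

lemma cell_integrable:
  assumes "v \<in> L2 \<Omega>" "c \<in> centres" "elementary g"
  shows "integrable (cell_measure c) (\<lambda>x. v x * g x)"
  by (rule L2_mult_integrable[OF L2_cell[OF assms(1,2)] elementary_L2_cell[OF assms(3)]])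

lemma elementary_cell_integrable:
  assumes "elementary g"
  shows "integrable (cell_measure c) g"
  by (rule L2_integrable_bounded[OF elementary_L2_cell[OF assms] bounded_cell open_sets_lebesgue[OF open_interior]])

text \<open>For smooth \<open>v\<close> with derivative \<open>v'\<close> this is the integral of
  the i-th derivative of the product, that is, the net flux of \<open>v * \<phi>\<close> through the
  two faces normal to \<open>i\<close>. It takes the place of a boundary integral.\<close>

definition ibp :: "'n \<Rightarrow> (real^'n \<Rightarrow> real) \<Rightarrow> (real^'n \<Rightarrow> real) \<Rightarrow> real^'n \<Rightarrow> (real^'n \<Rightarrow> real) \<Rightarrow> real" where
  "ibp i v v' c \<phi> = (\<integral>x. v x * partial_deriv i \<phi> x + v' x * \<phi> x \<partial>cell_measure c)"

context
  fixes i :: 'n and v v' :: "real^'n \<Rightarrow> real"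
  assumes v: "v \<in> L2 \<Omega>" and v': "v' \<in> L2 \<Omega>" and weak: "has_weak_deriv \<Omega> [i] v v'"
begin

lemma ibp_integrable:
  assumes "c \<in> centres" "elementary \<phi>"
  shows "integrable (cell_measure c) (\<lambda>x. v x * partial_deriv i \<phi> x + v' x * \<phi> x)"
  by (intro Bochner_Integration.integrable_add cell_integrable v v' assms elementary_partial_deriv)

lemma ibp_eq:
  assumes "c \<in> centres" "elementary \<phi>"
  shows "ibp i v v' c \<phi> = (\<integral>x. v x * partial_deriv i \<phi> x \<partial>cell_measure c) + (\<integral>x. v' x * \<phi> x \<partial>cell_measure c)"
  unfolding ibp_def
  by (intro Bochner_Integration.integral_add cell_integrable v v' assms elementary_partial_deriv)

lemma ibp_add:
  assumes "c \<in> centres" "elementary \<phi>" "elementary \<psi>"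
  shows "ibp i v v' c (\<lambda>x. \<phi> x + \<psi> x) = ibp i v v' c \<phi> + ibp i v v' c \<psi>"
proof -
  have "ibp i v v' c (\<lambda>x. \<phi> x + \<psi> x) = (\<integral>x. (v x * partial_deriv i \<phi> x + v' x * \<phi> x) +
      (v x * partial_deriv i \<psi> x + v' x * \<psi> x) \<partial>cell_measure c)"
    unfolding ibp_def using assms
    by (simp add: partial_deriv_add elementary_differentiable algebra_simps)
  also have "\<dots> = ibp i v v' c \<phi> + ibp i v v' c \<psi>"
    unfolding ibp_def by (intro Bochner_Integration.integral_add ibp_integrable assms)
  finally show ?thesis .
qed

lemma L2_box_integrable: "box a b \<subseteq> \<Omega> \<Longrightarrow> w \<in> L2 \<Omega> \<Longrightarrow> integrable (lebesgue_on (box a b)) w"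
  using L2_integrable_bounded[of w "box a b"] L2_subset[of w \<Omega> "box a b"]
    open_sets_lebesgue[OF open_domain] open_sets_lebesgue[OF open_box] bounded_box by blast

text \<open>Up to the factor \<open>h^2\<close> the expression \<open>1 - loc^2\<close> is the
  weight of \<open>integration_by_parts_box\<close>: a function with this factor has no
  flux.\<close>

lemma ibp_bubble:
  assumes c: "c \<in> centres" and A: "elementary A"
  shows "ibp i v v' c (\<lambda>x. (1 - (loc h c i x)\<^sup>2) * A x) = 0"
proof -
  let ?a = "\<chi> i. c $ i - h" and ?b = "\<chi> i. c $ i + h"
  have sub: "box ?a ?b \<subseteq> \<Omega>" using centre_interior[OF c] by (simp add: interior_cube_eq_box)
  have eq: "(\<lambda>x. (1 - (loc h c i x)\<^sup>2) * A x) = (\<lambda>x. (x $ i - ?a $ i) * (?b $ i - x $ i) * (A x / h\<^sup>2))"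
  proof
    fix x
    define s where "s = loc h c i x"
    have "x $ i = c $ i + h * s" using h_pos by (simp add: s_def loc_def)
    then show "(1 - (loc h c i x)\<^sup>2) * A x = (x $ i - ?a $ i) * (?b $ i - x $ i) * (A x / h\<^sup>2)"
      using h_pos by (simp add: s_def[symmetric] field_simps power2_eq_square)
  qed
  have el: "elementary (\<lambda>x. A x / h\<^sup>2)" by (intro elementary_intros A)
  show ?thesis
    unfolding ibp_def interior_cube_eq_box eq
    by (rule integration_by_parts_box[OF weak sub open_sets_lebesgue[OF open_domain]
        L2_box_integrable[OF sub v] L2_box_integrable[OF sub v'] el])
qed

text \<open>The two terms are the fluxes of \<open>v A\<close> through the common face, with opposite normals.\<close>

lemma ibp_neighbours:
  assumes c: "c \<in> centres" and c': "step i c \<in> centres" (is "?c' \<in> _") and A: "elementary A"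
  shows "ibp i v v' c (\<lambda>x. A x * ((1 + loc h c i x) / 2)) +
     ibp i v v' ?c' (\<lambda>x. A x * ((1 - loc h ?c' i x) / 2)) = 0"
proof -
  let ?a = "\<chi> k. c $ k - h" and ?b = "\<chi> k. if k = i then c $ k + 3 * h else c $ k + h"
  let ?A = "\<lambda>x. A x / (4 * h\<^sup>2)"
  \<comment> \<open>Up to the factor \<open>A\<close> this is
    \<open>(1 + loc) * (3 - loc) / 4\<close>, with the local coordinate of the first cell: zero on
    the two outer faces and 1 on the common one. On either cell it differs from the affine ramp in
    the statement by a quarter of \<open>1 - loc^2\<close>, which has no flux.\<close>
  define \<phi> where "\<phi> = (\<lambda>x. (x $ i - ?a $ i) * (?b $ i - x $ i) * ?A x)"
  define F where "F x = v x * partial_deriv i \<phi> x + v' x * \<phi> x" for x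
  have el: "elementary ?A" "elementary \<phi>" unfolding \<phi>_def by (intro elementary_intros A)+
  have el4: "elementary (\<lambda>x. A x / 4)" by (intro elementary_intros A)
  have sub: "box ?a ?b \<subseteq> \<Omega>" using neighbour_box_subset c c' by (simp add: centres_def)
  have xi: "loc h ?c' i x = loc h c i x - 2" for x
    using h_pos by (simp add: loc_def axis_def field_simps)
  have phi: "\<phi> x = (1 + loc h c i x) * (3 - loc h c i x) / 4 * A x" for x
  proof -
    have "x $ i = c $ i + h * loc h c i x" using h_pos by (simp add: loc_def)
    then show ?thesis using h_pos by (simp add: \<phi>_def field_simps power2_eq_square)
  qed
  have "ibp i v v' c \<phi> = ibp i v v' c (\<lambda>x. A x * ((1 + loc h c i x) / 2) + (1 - (loc h c i x)\<^sup>2) * (A x / 4))"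
    by (rule arg_cong[where f = "ibp i v v' c"]) (simp add: fun_eq_iff phi field_simps power2_eq_square)
  also have "\<dots> = ibp i v v' c (\<lambda>x. A x * ((1 + loc h c i x) / 2))"
    using ibp_bubble[OF c el4]
    by (subst ibp_add[OF c]) (intro elementary_intros A loc_elementary | simp)+
  finally have 1: "ibp i v v' c \<phi> = ibp i v v' c (\<lambda>x. A x * ((1 + loc h c i x) / 2))" .
  have "ibp i v v' ?c' \<phi> = ibp i v v' ?c' (\<lambda>x. A x * ((1 - loc h ?c' i x) / 2) + (1 - (loc h ?c' i x)\<^sup>2) * (A x / 4))"
    by (rule arg_cong[where f = "ibp i v v' ?c'"]) (intro ext, unfold phi xi, simp add: field_simps power2_eq_square)
  also have "\<dots> = ibp i v v' ?c' (\<lambda>x. A x * ((1 - loc h ?c' i x) / 2))"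
    using ibp_bubble[OF c' el4]
    by (subst ibp_add[OF c']) (intro elementary_intros A loc_elementary | simp)+
  finally have 2: "ibp i v v' ?c' \<phi> = ibp i v v' ?c' (\<lambda>x. A x * ((1 - loc h ?c' i x) / 2))" .
  let ?K = "interior (cube h c)" and ?K' = "interior (cube h ?c')"
  have iF: "integrable (lebesgue_on ?K) F" "integrable (lebesgue_on ?K') F"
    using ibp_integrable[OF c el(2)] ibp_integrable[OF c' el(2)] by (simp_all add: F_def[abs_def])
  have iFb: "integrable (lebesgue_on (box ?a ?b)) F"
    unfolding F_def[abs_def]
    by (intro Bochner_Integration.integrable_add integrable_mult_continuous_box L2_box_integrable sub v v'
        smooth_continuous_on elementary_smooth elementary_partial_deriv el)
  have op: "?K \<in> sets lebesgue" "?K' \<in> sets lebesgue" "box ?a ?b \<in> sets lebesgue"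
    by (intro open_sets_lebesgue open_interior open_box)+
  have ne: "cube h c \<noteq> cube h ?c'"
  proof
    assume "cube h c = cube h ?c'"
    then have "c = ?c'" using cube_inject h_pos by blast
    then have "c $ i = ?c' $ i" by simp
    then show False using h_pos by (simp add: axis_def)
  qed
  then have disj: "?K \<inter> ?K' = {}" using interior_cells_disjoint c c' by (simp add: centres_def)
  \<comment> \<open>Up to the hyperplane of the common face, the open box is the disjoint union of
    the two open cells.\<close>
  have "{x::real^'n. x $ i = c $ i + h} \<in> null_sets lebesgue"
    using negligible_hyperplane[of "axis i 1 :: real^'n" "c $ i + h"]
    by (simp add: negligible_iff_null_sets inner_axis' axis_eq_0_iff)
  then have "AE x in lebesgue. x \<notin> {x::real^'n. x $ i = c $ i + h}" by (rule AE_not_in)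
  then have "AE x in lebesgue. x \<in> box ?a ?b \<longleftrightarrow> x \<in> ?K \<or> x \<in> ?K'"
  proof eventually_elim
    case (elim x)
    have all: "(\<forall>k. P k) \<longleftrightarrow> P i \<and> (\<forall>k. k \<noteq> i \<longrightarrow> P k)" for P by metis
    have abs: "(c $ k - h < x $ k \<and> x $ k < c $ k + h) \<longleftrightarrow> \<bar>x $ k - c $ k\<bar> < h" for k
      by (simp add: abs_less_iff) linarith
    have K: "x \<in> ?K \<longleftrightarrow> \<bar>x $ i - c $ i\<bar> < h \<and> (\<forall>k. k \<noteq> i \<longrightarrow> \<bar>x $ k - c $ k\<bar> < h)"
      unfolding mem_interior_cube by (rule all)
    have K': "x \<in> ?K' \<longleftrightarrow> \<bar>x $ i - (c $ i + 2 * h)\<bar> < h \<and> (\<forall>k. k \<noteq> i \<longrightarrow> \<bar>x $ k - c $ k\<bar> < h)"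
      unfolding mem_interior_cube by (subst all) (simp add: axis_def)
    have B: "x \<in> box ?a ?b \<longleftrightarrow> c $ i - h < x $ i \<and> x $ i < c $ i + 3 * h \<and> (\<forall>k. k \<noteq> i \<longrightarrow> \<bar>x $ k - c $ k\<bar> < h)"
      unfolding mem_box_cart vec_lambda_beta by (subst all) (simp add: abs)
    have "c $ i - h < x $ i \<and> x $ i < c $ i + 3 * h \<longleftrightarrow>
        \<bar>x $ i - c $ i\<bar> < h \<or> \<bar>x $ i - (c $ i + 2 * h)\<bar> < h"
      using elim by (simp add: abs_less_iff) linarith
    then show ?case unfolding K K' B by blast
  qed
  then have AE: "AE x in lebesgue. (if x \<in> box ?a ?b then F x else 0)
      = (if x \<in> ?K then F x else 0) + (if x \<in> ?K' then F x else 0)"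
    by eventually_elim (use disj in auto)
  have "(\<integral>x. F x \<partial>lebesgue_on (box ?a ?b)) = (\<integral>x. (if x \<in> box ?a ?b then F x else 0) \<partial>lebesgue)"
    by (simp add: Lebesgue_Measure.integral_restrict_UNIV op)
  also have "\<dots> = (\<integral>x. (if x \<in> ?K then F x else 0) + (if x \<in> ?K' then F x else 0) \<partial>lebesgue)"
    by (rule integral_cong_AE)
       (use iF iFb op AE in \<open>auto simp: borel_measurable_if intro!: borel_measurable_add\<close>)
  also have "\<dots> = (\<integral>x. F x \<partial>lebesgue_on ?K) + (\<integral>x. F x \<partial>lebesgue_on ?K')"
    using iF op by (subst Bochner_Integration.integral_add)
      (auto simp: Lebesgue_Measure.integrable_restrict_UNIV Lebesgue_Measure.integral_restrict_UNIV)
  finally have "(\<integral>x. F x \<partial>lebesgue_on (box ?a ?b)) = ibp i v v' c \<phi> + ibp i v v' ?c' \<phi>"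
    by (simp add: ibp_def F_def)
  moreover have "(\<integral>x. F x \<partial>lebesgue_on (box ?a ?b)) = 0"
    unfolding F_def \<phi>_def
    by (rule integration_by_parts_box[OF weak sub open_sets_lebesgue[OF open_domain]
        L2_box_integrable[OF sub v] L2_box_integrable[OF sub v'] el(1)])
  ultimately show ?thesis using 1 2 by simp
qed

text \<open>The functions \<open>B c + D c\<close> and \<open>B c - D c\<close> are the traces of the integrand on the two faces of the
  cell with normal direction \<open>i\<close>.\<close>

theorem sum_ibp_eq_0:
  assumes B: "\<And>c. c \<in> centres \<Longrightarrow> elementary (B c)" and D: "\<And>c. c \<in> centres \<Longrightarrow> elementary (D c)"
    and E: "\<And>c. c \<in> centres \<Longrightarrow> elementary (E c)"
    and match: "\<And>c x. c \<in> centres \<Longrightarrow> step i c \<in> centres \<Longrightarrow>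
      B c x + D c x = B (step i c) x - D (step i c) x"
    and right: "\<And>c x. c \<in> centres \<Longrightarrow> step i c \<notin> centres \<Longrightarrow> B c x + D c x = 0"
    and left: "\<And>c x. c \<in> centres \<Longrightarrow> c - (2 * h) *\<^sub>R axis i 1 \<notin> centres \<Longrightarrow> B c x - D c x = 0"
  shows "(\<Sum>c\<in>centres. ibp i v v' c (\<lambda>x. B c x + loc h c i x * D c x + (1 - (loc h c i x)\<^sup>2) * E c x)) = 0"
proof -
  define S where "S c = step i c" for c :: "real^'n"
  \<comment> \<open>\<open>B + loc * D\<close> is
    \<open>(B + D) * (1 + loc) / 2 + (B - D) * (1 - loc) / 2\<close>. Each ramp vanishes on one of
    the two faces, so \<open>R c\<close> and \<open>L c\<close> are the fluxes through the right and
    the left face.\<close>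
  define R where "R c = ibp i v v' c (\<lambda>x. (B c x + D c x) * ((1 + loc h c i x) / 2))" for c
  define L where "L c = ibp i v v' c (\<lambda>x. (B c x - D c x) * ((1 - loc h c i x) / 2))" for c
  have split: "ibp i v v' c (\<lambda>x. B c x + loc h c i x * D c x + (1 - (loc h c i x)\<^sup>2) * E c x) = R c + L c"
    if c: "c \<in> centres" for c
  proof -
    have "ibp i v v' c (\<lambda>x. B c x + loc h c i x * D c x + (1 - (loc h c i x)\<^sup>2) * E c x)
      = ibp i v v' c (\<lambda>x. ((B c x + D c x) * ((1 + loc h c i x) / 2) + (B c x - D c x) * ((1 - loc h c i x) / 2))
          + (1 - (loc h c i x)\<^sup>2) * E c x)"
      by (rule arg_cong[where f = "ibp i v v' c"]) (simp add: fun_eq_iff field_simps)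
    also have "\<dots> = R c + L c"
      unfolding R_def L_def using B[OF c] D[OF c] E[OF c]
      by (subst ibp_add[OF c] | intro elementary_intros loc_elementary | assumption | simp add: ibp_bubble[OF c])+
    finally show ?thesis .
  qed
  have zero: "ibp i v v' c (\<lambda>x. 0) = 0" for c
    using partial_deriv_eq[OF has_derivative_const[of 0], of i] by (simp add: ibp_def)
  have RL: "R c + L (S c) = 0" if "c \<in> centres" "S c \<in> centres" for c
  proof -
    have "(\<lambda>x. (B (S c) x - D (S c) x) * ((1 - loc h (S c) i x) / 2))
       = (\<lambda>x. (B c x + D c x) * ((1 - loc h (S c) i x) / 2))"
      using match that by (simp add: S_def fun_eq_iff)
    moreover have "elementary (\<lambda>x. B c x + D c x)" using B D that by (intro elementary_intros)
    ultimately show ?thesis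
      unfolding R_def L_def using ibp_neighbours[of c "\<lambda>x. B c x + D c x"] that by (simp add: S_def)
  qed
  have R0: "R c = 0" if "c \<in> centres" "S c \<notin> centres" for c
    using right[of c] that zero by (simp add: R_def S_def)
  have L0: "L c = 0" if "c \<in> centres" "c \<notin> S ` centres" for c
  proof -
    have "c - (2 * h) *\<^sub>R axis i 1 \<notin> centres"
    proof
      assume "c - (2 * h) *\<^sub>R axis i 1 \<in> centres"
      moreover have "c = S (c - (2 * h) *\<^sub>R axis i 1)" by (simp add: S_def)
      ultimately show False using that by blast
    qed
    then show ?thesis using left[OF that(1)] zero by (simp add: L_def)
  qed
  have injS: "inj_on S A" for A by (simp add: inj_on_def S_def)
  \<comment> \<open>Right fluxes of cells without a right neighbour vanish; the others are minus the
    left fluxes of the translated cells. The left fluxes not reached in this way vanish too.\<close>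
  have "(\<Sum>c\<in>centres. R c) = (\<Sum>c\<in>{c \<in> centres. S c \<in> centres}. R c)"
    by (rule sum.mono_neutral_right) (use finite_centres R0 in auto)
  also have "\<dots> = (\<Sum>c\<in>{c \<in> centres. S c \<in> centres}. - L (S c))"
    using RL by (intro sum.cong refl) (simp add: eq_neg_iff_add_eq_0)
  also have "\<dots> = (\<Sum>c\<in>S ` {c \<in> centres. S c \<in> centres}. - L c)"
    by (simp add: sum.reindex[OF injS])
  also have "\<dots> = (\<Sum>c\<in>centres. - L c)"
    by (rule sum.mono_neutral_left) (use finite_centres L0 in auto)
  finally have "(\<Sum>c\<in>centres. R c) + (\<Sum>c\<in>centres. L c) = 0" by (simp add: sum_negf)
  then show ?thesis by (simp add: split sum.distrib cong: sum.cong)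
qed

end

section \<open>Moments and Cauchy-Schwarz bounds for sums over cells\<close>

lemma integral_centres:
  fixes f :: "real^'n \<Rightarrow> real"
  assumes "integrable (lebesgue_on \<Omega>) f"
  shows "(\<integral>x. f x \<partial>lebesgue_on \<Omega>) = (\<Sum>c\<in>centres. \<integral>x. f x \<partial>cell_measure c)"
  using integral_cells[OF assms] by (simp add: sum_cells)

text \<open>\<open>ibp_bubble\<close> applied to the constant function 1 states that the derivative
  of a bubble has integral 0. The bubbles \<open>1 - loc^2\<close> and
  \<open>(1 - loc^2) * loc\<close> have derivatives \<open>- 2 * loc / h\<close> and
  \<open>(1 - 3 * loc^2) / h\<close>.\<close>

lemma elementary_cell_moments:
  assumes "c \<in> centres"
  shows "(\<integral>x. loc h c k x \<partial>cell_measure c) = 0"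
    and "(\<integral>x. (loc h c k x)\<^sup>2 \<partial>cell_measure c) = (\<integral>x. 1 \<partial>cell_measure c) / 3"
proof -
  have L: "(\<lambda>_. 1) \<in> L2 \<Omega>" "(\<lambda>_. 0) \<in> L2 \<Omega>"
    by (intro continuous_L2 continuous_on_const bounded_domain open_sets_lebesgue open_domain)+
  have "partial_deriv k (\<lambda>_. 1) = (\<lambda>_. 0)" for k :: 'n
    using partial_deriv_eq[OF has_derivative_const[of 1], of k] by (simp add: fun_eq_iff)
  then have W: "has_weak_deriv \<Omega> [k] (\<lambda>_. 1) (\<lambda>_. 0)"
    using has_weak_deriv_smooth[OF elementary_smooth[OF elementary_const[of 1]] open_domain, of "[k]"] by simp
  have D: "((\<lambda>x. (1 - (loc h c k x)\<^sup>2) * 1) has_derivative (\<lambda>v. - 2 * loc h c k x * (v $ k / h))) (at x)"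
    "((\<lambda>x. (1 - (loc h c k x)\<^sup>2) * loc h c k x) has_derivative (\<lambda>v. (1 - 3 * (loc h c k x)\<^sup>2) * (v $ k / h))) (at x)" for x
    by (rule derivative_eq_intros loc_has_derivative refl ext | simp add: algebra_simps power2_eq_square)+
  have d: "partial_deriv k (\<lambda>x. (1 - (loc h c k x)\<^sup>2) * 1) x = - 2 * loc h c k x / h"
    "partial_deriv k (\<lambda>x. (1 - (loc h c k x)\<^sup>2) * loc h c k x) x = (1 - 3 * (loc h c k x)\<^sup>2) / h" for x
    by (simp_all only: partial_deriv_eq[OF D(1)] partial_deriv_eq[OF D(2)]) (simp_all add: axis_def)
  have "(\<integral>x. - 2 * loc h c k x / h \<partial>cell_measure c) = 0"
    using ibp_bubble[OF L W assms, of "\<lambda>_. 1"] unfolding ibp_def d by (simp add: elementary_const)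
  then show "(\<integral>x. loc h c k x \<partial>cell_measure c) = 0" using h_pos by simp
  have "(\<integral>x. (1 - 3 * (loc h c k x)\<^sup>2) / h \<partial>cell_measure c) = 0"
    using ibp_bubble[OF L W assms, of "loc h c k"] unfolding ibp_def d by (simp add: loc_elementary)
  then have "(\<integral>x. 1 - 3 * (loc h c k x)\<^sup>2 \<partial>cell_measure c) = 0" using h_pos by simp
  moreover have "(\<integral>x. 1 - 3 * (loc h c k x)\<^sup>2 \<partial>cell_measure c)
     = (\<integral>x. 1 \<partial>cell_measure c) - (\<integral>x. 3 * (loc h c k x)\<^sup>2 \<partial>cell_measure c)"
    by (intro Bochner_Integration.integral_diff elementary_cell_integrable elementary_intros loc_elementary)
  ultimately show "(\<integral>x. (loc h c k x)\<^sup>2 \<partial>cell_measure c) = (\<integral>x. 1 \<partial>cell_measure c) / 3" by simp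
qed

text \<open>A Cauchy-Schwarz inequality over all cells with a cellwise maximum bound. Young's
  inequality is used on every cell with one common parameter \<open>t\<close>, which is optimised
  after summation.\<close>

lemma sum_cell_integrals_le:
  assumes V: "V \<in> L2 \<Omega>" and \<Phi>: "\<And>c. c \<in> centres \<Longrightarrow> elementary (\<Phi> c)"
    and bound: "\<And>c x. c \<in> centres \<Longrightarrow> x \<in> interior (cube h c) \<Longrightarrow> \<bar>\<Phi> c x\<bar> \<le> S c"
  shows "\<bar>pairing V \<Phi>\<bar>
     \<le> L2_norm \<Omega> V * sqrt (\<Sum>c\<in>centres. (S c)\<^sup>2 * (\<integral>x. 1 \<partial>cell_measure c))" (is "\<bar>?X\<bar> \<le> _ * sqrt ?Y")
proof -
  define N where "N = (\<integral>x. V x * V x \<partial>lebesgue_on \<Omega>)"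
  have N: "N = pairing V (\<lambda>c. V)"
    unfolding N_def by (rule integral_centres) (rule L2_mult_integrable[OF V V])
  have N0: "0 \<le> N" unfolding N_def by (rule integral_nonneg_AE) simp
  have Y0: "0 \<le> ?Y" by (intro sum_nonneg mult_nonneg_nonneg integral_nonneg_AE) auto
  have key: "2 * \<bar>?X\<bar> \<le> t * N + ?Y / t" if t: "t > 0" for t
  proof -
    have "2 * \<bar>\<integral>x. V x * \<Phi> c x \<partial>cell_measure c\<bar>
      \<le> t * (\<integral>x. V x * V x \<partial>cell_measure c) + (S c)\<^sup>2 * (\<integral>x. 1 \<partial>cell_measure c) / t" if c: "c \<in> centres" for c
    proof -
      have iV: "integrable (cell_measure c) (\<lambda>x. V x * V x)"
        by (intro L2_mult_integrable L2_cell V c)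
      have i1: "integrable (cell_measure c) (\<lambda>x. 1::real)" by (rule elementary_cell_integrable[OF elementary_const])
      have iP: "integrable (cell_measure c) (\<lambda>x. V x * \<Phi> c x)" by (rule cell_integrable[OF V c \<Phi>[OF c]])
      have "2 * \<bar>\<integral>x. V x * \<Phi> c x \<partial>cell_measure c\<bar> \<le> 2 * (\<integral>x. \<bar>V x * \<Phi> c x\<bar> \<partial>cell_measure c)"
        using integral_abs_bound by simp
      also have "\<dots> = (\<integral>x. 2 * \<bar>V x * \<Phi> c x\<bar> \<partial>cell_measure c)" by simp
      also have "\<dots> \<le> (\<integral>x. t * (V x * V x) + (S c)\<^sup>2 / t * 1 \<partial>cell_measure c)"
      proof (rule integral_mono)
        fix x assume "x \<in> space (cell_measure c)"
        then have b: "\<bar>\<Phi> c x\<bar> \<le> S c" using bound[OF c] by simp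
        then have "\<bar>\<Phi> c x\<bar>\<^sup>2 \<le> (S c)\<^sup>2" by (intro power_mono) auto
        have "0 \<le> (t * \<bar>V x\<bar> - \<bar>\<Phi> c x\<bar>)\<^sup>2" by simp
        then have "2 * t * (\<bar>V x\<bar> * \<bar>\<Phi> c x\<bar>) \<le> t\<^sup>2 * (V x)\<^sup>2 + \<bar>\<Phi> c x\<bar>\<^sup>2"
          by (simp add: power2_diff power_mult_distrib algebra_simps)
        also have "\<dots> \<le> t\<^sup>2 * (V x)\<^sup>2 + (S c)\<^sup>2" using \<open>\<bar>\<Phi> c x\<bar>\<^sup>2 \<le> (S c)\<^sup>2\<close> by simp
        finally show "2 * \<bar>V x * \<Phi> c x\<bar> \<le> t * (V x * V x) + (S c)\<^sup>2 / t * 1"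
          using t by (simp add: abs_mult field_simps power2_eq_square)
      next
        show "integrable (cell_measure c) (\<lambda>x. 2 * \<bar>V x * \<Phi> c x\<bar>)"
          using iP by (intro integrable_mult_right integrable_abs)
        show "integrable (cell_measure c) (\<lambda>x. t * (V x * V x) + (S c)\<^sup>2 / t * 1)"
          by (intro Bochner_Integration.integrable_add integrable_mult_right iV i1)
      qed
      also have "\<dots> = t * (\<integral>x. V x * V x \<partial>cell_measure c) + (S c)\<^sup>2 / t * (\<integral>x. 1 \<partial>cell_measure c)"
        using Bochner_Integration.integral_add[OF integrable_mult_right[OF iV, of t]
            integrable_mult_right[OF i1, of "(S c)\<^sup>2 / t"]]
        by (simp only: Bochner_Integration.integral_mult_right_zero)
      finally show ?thesis by (simp del: integral_const)
    qed
    then have "(\<Sum>c\<in>centres. 2 * \<bar>\<integral>x. V x * \<Phi> c x \<partial>cell_measure c\<bar>)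
      \<le> (\<Sum>c\<in>centres. t * (\<integral>x. V x * V x \<partial>cell_measure c) + (S c)\<^sup>2 * (\<integral>x. 1 \<partial>cell_measure c) / t)"
      by (rule sum_mono)
    moreover have "\<dots> = t * N + ?Y / t"
      unfolding N by (simp add: sum.distrib sum_distrib_left sum_divide_distrib del: integral_const)
    moreover have "2 * \<bar>?X\<bar> \<le> (\<Sum>c\<in>centres. 2 * \<bar>\<integral>x. V x * \<Phi> c x \<partial>cell_measure c\<bar>)"
      unfolding sum_distrib_left[symmetric] using sum_abs by (rule mult_left_mono) simp
    ultimately show ?thesis by linarith
  qed
  have "\<bar>?X\<bar> \<le> sqrt N * sqrt ?Y"
  proof (rule field_le_epsilon)
    fix e :: real assume e: "e > 0"
    define s where "s = sqrt N" define y where "y = sqrt ?Y"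
    have sy: "0 \<le> s" "0 \<le> y" "N = s\<^sup>2" "?Y = y\<^sup>2" using N0 Y0 by (auto simp: s_def y_def)
    \<comment> \<open>The optimal parameter is \<open>y / s\<close>. If \<open>s\<close> or
      \<open>y\<close> is 0, no positive optimum exists, and \<open>t\<close> is chosen so that the
      term that remains is at most \<open>e\<close>.\<close>
    show "\<bar>?X\<bar> \<le> sqrt N * sqrt ?Y + e"
    proof (cases "s = 0 \<or> y = 0")
      case True
      then show ?thesis
      proof
        assume s0: "s = 0"
        define t where "t = (y\<^sup>2 + 1) / e"
        have t: "t > 0" using e by (simp add: t_def add_nonneg_pos)
        have "0 < y\<^sup>2 + 1" by (simp add: add_nonneg_pos)
        moreover have "y\<^sup>2 / t = y\<^sup>2 * e / (y\<^sup>2 + 1)" by (simp add: t_def)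
        ultimately have "y\<^sup>2 / t \<le> e" using e by (simp only: pos_divide_le_eq) (simp add: algebra_simps)
        then show ?thesis using key[OF t] s0 sy e by (simp add: s_def[symmetric])
      next
        assume y0: "y = 0"
        define t where "t = e / (s\<^sup>2 + 1)"
        have t: "t > 0" using e by (simp add: t_def add_nonneg_pos)
        have "0 < s\<^sup>2 + 1" by (simp add: add_nonneg_pos)
        moreover have "t * s\<^sup>2 = e * s\<^sup>2 / (s\<^sup>2 + 1)" by (simp add: t_def)
        ultimately have "t * s\<^sup>2 \<le> e" using e by (simp only: pos_divide_le_eq) (simp add: algebra_simps)
        then show ?thesis using key[OF t] y0 sy e by (simp add: y_def[symmetric])
      qed
    next
      case False
      then have t: "y / s > 0" using sy by simp
      have "2 * \<bar>?X\<bar> \<le> y / s * s\<^sup>2 + y\<^sup>2 / (y / s)" using key[OF t] unfolding sy(3,4) .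
      also have "\<dots> = 2 * (s * y)" using False by (simp add: power2_eq_square)
      finally show ?thesis using e by (simp add: s_def y_def)
    qed
  qed
  then show ?thesis by (simp add: L2_norm_def L2_inner_def N_def)
qed

end

section \<open>The cubic Morley shape functions\<close>

text \<open>The cyclic successor; together with \<open>prv\<close> it lists the two directions
  tangential to a face normal to \<open>i\<close>, so that statements about \<open>i\<close> cover
  all three directions.\<close>

definition nxt :: "3 \<Rightarrow> 3" where "nxt i = (if i = 1 then 2 else if i = 2 then 3 else 1)"
definition prv :: "3 \<Rightarrow> 3" where "prv i = (if i = 1 then 3 else if i = 2 then 1 else 2)"

lemma nxt_prv_neq [simp]:
  "nxt i \<noteq> i" "prv i \<noteq> i" "nxt i \<noteq> prv i" "i \<noteq> nxt i" "i \<noteq> prv i" "prv i \<noteq> nxt i"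
  using exhaust_3[of i] by (auto simp: nxt_def prv_def)

lemma nxt_prv_simps [simp]:
  "nxt (nxt i) = prv i" "nxt (prv i) = i" "prv (nxt i) = i" "prv (prv i) = nxt i"
  using exhaust_3[of i] by (auto simp: nxt_def prv_def)

lemma UNIV_nxt_prv: "UNIV = {i, nxt i, prv i}"
  using exhaust_3[of i] by (auto simp: UNIV_3 nxt_def prv_def)

lemma sum_nxt_prv: "sum f UNIV = f i + f (nxt i) + f (prv i)"
  by (subst UNIV_nxt_prv[of i]) (simp add: ac_simps)

lemma index_cases: "k = i \<or> k = nxt i \<or> k = prv i"
  using UNIV_nxt_prv[of i] by blast

text \<open>The coefficient \<open>g k\<close> belongs to the product of the two coordinates other
  than \<open>k\<close>.\<close>

definition trilinear ::
    "real \<Rightarrow> real^3 \<Rightarrow> real \<Rightarrow> (3 \<Rightarrow> real) \<Rightarrow> (3 \<Rightarrow> real) \<Rightarrow> real \<Rightarrow> real^3 \<Rightarrow> real" where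
  "trilinear h c a l g d x = a + (\<Sum>k\<in>UNIV. l k * loc h c k x)
     + (\<Sum>k\<in>UNIV. g k * (loc h c (nxt k) x * loc h c (prv k) x)) + d * (loc h c 1 x * loc h c 2 x * loc h c 3 x)"

text \<open>Both one-dimensional polynomials vanish at 1 and -1, so the sum vanishes at all vertices
  and the vertex values are carried by \<open>trilinear\<close>.\<close>

definition bubble :: "real \<Rightarrow> real^3 \<Rightarrow> (3 \<Rightarrow> real) \<Rightarrow> (3 \<Rightarrow> real) \<Rightarrow> real^3 \<Rightarrow> real" where
  "bubble h c \<alpha> \<beta> x = (\<Sum>k\<in>UNIV. \<alpha> k * ((loc h c k x)\<^sup>2 - 1) + \<beta> k * ((loc h c k x) ^ 3 - loc h c k x))"

lemma trilinear_eq: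
  "trilinear h c a l g d x = a + l i * loc h c i x + l (nxt i) * loc h c (nxt i) x + l (prv i) * loc h c (prv i) x
     + g i * (loc h c (nxt i) x * loc h c (prv i) x) + g (nxt i) * (loc h c (prv i) x * loc h c i x)
     + g (prv i) * (loc h c i x * loc h c (nxt i) x) + d * (loc h c i x * loc h c (nxt i) x * loc h c (prv i) x)"
proof -
  have "loc h c 1 x * loc h c 2 x * loc h c 3 x = loc h c i x * loc h c (nxt i) x * loc h c (prv i) x"
    using exhaust_3[of i] by (auto simp: nxt_def prv_def)
  then show ?thesis unfolding trilinear_def sum_nxt_prv[of _ i] by simp
qed

lemma bubble_eq:
  "bubble h c \<alpha> \<beta> x = \<alpha> i * ((loc h c i x)\<^sup>2 - 1) + \<beta> i * ((loc h c i x) ^ 3 - loc h c i x)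
     + (\<alpha> (nxt i) * ((loc h c (nxt i) x)\<^sup>2 - 1) + \<beta> (nxt i) * ((loc h c (nxt i) x) ^ 3 - loc h c (nxt i) x))
     + (\<alpha> (prv i) * ((loc h c (prv i) x)\<^sup>2 - 1) + \<beta> (prv i) * ((loc h c (prv i) x) ^ 3 - loc h c (prv i) x))"
  unfolding bubble_def sum_nxt_prv[of _ i] by simp

lemma trilinear_elementary: "elementary (trilinear h c a l g d)"
  unfolding trilinear_def[abs_def] by (intro elementary_intros loc_elementary finite)

lemma bubble_elementary: "elementary (bubble h c \<alpha> \<beta>)"
  unfolding bubble_def[abs_def] by (intro elementary_intros loc_elementary finite)

text \<open>Hiding the coefficients gives a class closed under linear combinations, which reduces
  the change to local coordinates to single monomials.\<close>

definition local_shape :: "real \<Rightarrow> real^3 \<Rightarrow> (real^3 \<Rightarrow> real) \<Rightarrow> bool" where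
  "local_shape h c f \<longleftrightarrow> (\<exists>a l g d \<alpha> \<beta>. \<forall>x. f x = trilinear h c a l g d x + bubble h c \<alpha> \<beta> x)"

lemma local_shape_cmult: "local_shape h c f \<Longrightarrow> local_shape h c (\<lambda>x. r * f x)"
proof -
  assume "local_shape h c f"
  then obtain a l g d \<alpha> \<beta> where f: "\<And>x. f x = trilinear h c a l g d x + bubble h c \<alpha> \<beta> x"
    unfolding local_shape_def by blast
  have "\<forall>x. r * f x = trilinear h c (r * a) (\<lambda>k. r * l k) (\<lambda>k. r * g k) (r * d) x
      + bubble h c (\<lambda>k. r * \<alpha> k) (\<lambda>k. r * \<beta> k) x"
    unfolding f by (simp add: trilinear_def bubble_def sum_3 algebra_simps)
  then show ?thesis unfolding local_shape_def by blast
qed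

lemma local_shape_add: "local_shape h c f \<Longrightarrow> local_shape h c f' \<Longrightarrow> local_shape h c (\<lambda>x. f x + f' x)"
proof -
  assume "local_shape h c f" "local_shape h c f'"
  then obtain a l g d \<alpha> \<beta> a' l' g' d' \<alpha>' \<beta>' where
    f: "\<And>x. f x = trilinear h c a l g d x + bubble h c \<alpha> \<beta> x"
    "\<And>x. f' x = trilinear h c a' l' g' d' x + bubble h c \<alpha>' \<beta>' x"
    unfolding local_shape_def by blast
  have "\<forall>x. f x + f' x = trilinear h c (a + a') (\<lambda>k. l k + l' k) (\<lambda>k. g k + g' k) (d + d') x
      + bubble h c (\<lambda>k. \<alpha> k + \<alpha>' k) (\<lambda>k. \<beta> k + \<beta>' k) x"
    unfolding f by (simp add: trilinear_def bubble_def sum_3 algebra_simps)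
  then show ?thesis unfolding local_shape_def by blast
qed

lemma local_shape_const: "local_shape h c (\<lambda>_. r)"
proof -
  have "\<forall>x. r = trilinear h c r (\<lambda>_. 0) (\<lambda>_. 0) 0 x + bubble h c (\<lambda>_. 0) (\<lambda>_. 0) x"
    by (simp add: trilinear_def bubble_def)
  then show ?thesis unfolding local_shape_def by blast
qed

lemma local_shape_sum:
  "(\<And>j. j \<in> J \<Longrightarrow> local_shape h c (f j)) \<Longrightarrow> local_shape h c (\<lambda>x. \<Sum>j\<in>J. f j x)"
  by (induction J rule: infinite_finite_induct) (simp_all add: local_shape_const local_shape_add)

lemma local_shape_loc: "local_shape h c (loc h c k)"
proof -
  have "\<forall>x. loc h c k x = trilinear h c 0 (\<lambda>j. if j = k then 1 else 0) (\<lambda>_. 0) 0 x + bubble h c (\<lambda>_. 0) (\<lambda>_. 0) x"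
    unfolding trilinear_eq[where i = k] bubble_def by simp
  then show ?thesis unfolding local_shape_def by blast
qed

lemma local_shape_loc_square: "local_shape h c (\<lambda>x. loc h c k x * loc h c k x)"
proof -
  have "\<forall>x. loc h c k x * loc h c k x = trilinear h c 1 (\<lambda>_. 0) (\<lambda>_. 0) 0 x
      + bubble h c (\<lambda>j. if j = k then 1 else 0) (\<lambda>_. 0) x"
    unfolding bubble_eq[where i = k] trilinear_def by (simp add: power2_eq_square)
  then show ?thesis unfolding local_shape_def by blast
qed

lemma local_shape_loc_cube: "local_shape h c (\<lambda>x. loc h c k x * loc h c k x * loc h c k x)"
proof -
  have "\<forall>x. loc h c k x * loc h c k x * loc h c k x = trilinear h c 0 (\<lambda>j. if j = k then 1 else 0) (\<lambda>_. 0) 0 x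
      + bubble h c (\<lambda>_. 0) (\<lambda>j. if j = k then 1 else 0) x"
    unfolding bubble_eq[where i = k] trilinear_eq[where i = k] by (simp add: power3_eq_cube)
  then show ?thesis unfolding local_shape_def by blast
qed

lemma local_shape_loc_nxt: "local_shape h c (\<lambda>x. loc h c k x * loc h c (nxt k) x)"
proof -
  have "\<forall>x. loc h c k x * loc h c (nxt k) x = trilinear h c 0 (\<lambda>_. 0) (\<lambda>j. if j = prv k then 1 else 0) 0 x
      + bubble h c (\<lambda>_. 0) (\<lambda>_. 0) x"
    unfolding trilinear_eq[where i = k] bubble_def by simp
  then show ?thesis unfolding local_shape_def by blast
qed

lemma local_shape_loc_mult: "local_shape h c (\<lambda>x. loc h c j x * loc h c k x)"
proof -
  consider "k = j" | "k = nxt j" | "j = nxt k" using index_cases[of k j] by force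
  then show ?thesis
  proof cases
    case 3
    have "(\<lambda>x. loc h c j x * loc h c k x) = (\<lambda>x. loc h c k x * loc h c j x)" by (rule ext) (rule mult.commute)
    then show ?thesis using local_shape_loc_nxt[of h c k] 3 by (simp only:)
  qed (simp_all only: local_shape_loc_square local_shape_loc_nxt)
qed

lemma local_shape_loc_123: "local_shape h c (\<lambda>x. loc h c 1 x * loc h c 2 x * loc h c 3 x)"
proof -
  have "\<forall>x. loc h c 1 x * loc h c 2 x * loc h c 3 x = trilinear h c 0 (\<lambda>_. 0) (\<lambda>_. 0) 1 x
      + bubble h c (\<lambda>_. 0) (\<lambda>_. 0) x"
    unfolding trilinear_def bubble_def by simp
  then show ?thesis unfolding local_shape_def by blast
qed

lemmas local_shape_intros = local_shape_add local_shape_cmult local_shape_const local_shape_loc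
  local_shape_loc_mult local_shape_loc_123 local_shape_loc_cube

lemma coord_eq_loc: "h > 0 \<Longrightarrow> x $ k = c $ k + h * loc h c k x"
  by (simp add: loc_def)

text \<open>Expanding about the centre produces only lower-order monomials of the same space; the
  space is invariant under translation and scaling.\<close>

lemma local_shape_coord:
  assumes h: "h > 0"
  shows "local_shape h c (\<lambda>x. x $ k)" and "local_shape h c (\<lambda>x. x $ j * x $ k)"
    and "local_shape h c (\<lambda>x. (x $ k) ^ 3)" and "local_shape h c (\<lambda>x. x $ 1 * x $ 2 * x $ 3)"
proof -
  have "(\<lambda>x. x $ k) = (\<lambda>x. c $ k + h * loc h c k x)" by (rule ext) (rule coord_eq_loc[OF h])
  moreover have "local_shape h c (\<lambda>x. c $ k + h * loc h c k x)" by (intro local_shape_intros)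
  ultimately show "local_shape h c (\<lambda>x. x $ k)" by (simp only:)
  have "local_shape h c (\<lambda>x. c $ j * c $ k + (h * c $ j) * loc h c k x + (h * c $ k) * loc h c j x
      + (h * h) * (loc h c j x * loc h c k x))" by (intro local_shape_intros)
  moreover have "(\<lambda>x. x $ j * x $ k) = (\<lambda>x. c $ j * c $ k + (h * c $ j) * loc h c k x + (h * c $ k) * loc h c j x
      + (h * h) * (loc h c j x * loc h c k x))"
  proof
    fix x
    show "x $ j * x $ k = c $ j * c $ k + (h * c $ j) * loc h c k x + (h * c $ k) * loc h c j x
      + (h * h) * (loc h c j x * loc h c k x)"
      unfolding coord_eq_loc[OF h, of x j c] coord_eq_loc[OF h, of x k c] by (simp add: algebra_simps)
  qed
  ultimately show "local_shape h c (\<lambda>x. x $ j * x $ k)" by (simp only:)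
  have "local_shape h c (\<lambda>x. (c $ k) ^ 3 + (3 * (c $ k)\<^sup>2 * h) * loc h c k x + (3 * c $ k * h\<^sup>2) * (loc h c k x * loc h c k x)
      + h ^ 3 * (loc h c k x * loc h c k x * loc h c k x))" by (intro local_shape_intros)
  moreover have "(\<lambda>x. (x $ k) ^ 3) = (\<lambda>x. (c $ k) ^ 3 + (3 * (c $ k)\<^sup>2 * h) * loc h c k x + (3 * c $ k * h\<^sup>2) * (loc h c k x * loc h c k x)
      + h ^ 3 * (loc h c k x * loc h c k x * loc h c k x))"
  proof
    fix x
    show "(x $ k) ^ 3 = (c $ k) ^ 3 + (3 * (c $ k)\<^sup>2 * h) * loc h c k x + (3 * c $ k * h\<^sup>2) * (loc h c k x * loc h c k x)
      + h ^ 3 * (loc h c k x * loc h c k x * loc h c k x)"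
      unfolding coord_eq_loc[OF h, of x k c] by (simp add: algebra_simps power2_eq_square power3_eq_cube)
  qed
  ultimately show "local_shape h c (\<lambda>x. (x $ k) ^ 3)" by (simp only:)
  have "local_shape h c (\<lambda>x. c $ 1 * c $ 2 * c $ 3 + (h * c $ 2 * c $ 3) * loc h c 1 x
      + (h * c $ 1 * c $ 3) * loc h c 2 x + (h * c $ 1 * c $ 2) * loc h c 3 x
      + (h * h * c $ 3) * (loc h c 1 x * loc h c 2 x) + (h * h * c $ 2) * (loc h c 1 x * loc h c 3 x)
      + (h * h * c $ 1) * (loc h c 2 x * loc h c 3 x) + (h * h * h) * (loc h c 1 x * loc h c 2 x * loc h c 3 x))"
    by (intro local_shape_intros)
  moreover have "(\<lambda>x. x $ 1 * x $ 2 * x $ 3) = (\<lambda>x. c $ 1 * c $ 2 * c $ 3 + (h * c $ 2 * c $ 3) * loc h c 1 x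
      + (h * c $ 1 * c $ 3) * loc h c 2 x + (h * c $ 1 * c $ 2) * loc h c 3 x
      + (h * h * c $ 3) * (loc h c 1 x * loc h c 2 x) + (h * h * c $ 2) * (loc h c 1 x * loc h c 3 x)
      + (h * h * c $ 1) * (loc h c 2 x * loc h c 3 x) + (h * h * h) * (loc h c 1 x * loc h c 2 x * loc h c 3 x))"
  proof
    fix x
    show "x $ 1 * x $ 2 * x $ 3 = c $ 1 * c $ 2 * c $ 3 + (h * c $ 2 * c $ 3) * loc h c 1 x
      + (h * c $ 1 * c $ 3) * loc h c 2 x + (h * c $ 1 * c $ 2) * loc h c 3 x
      + (h * h * c $ 3) * (loc h c 1 x * loc h c 2 x) + (h * h * c $ 2) * (loc h c 1 x * loc h c 3 x)
      + (h * h * c $ 1) * (loc h c 2 x * loc h c 3 x) + (h * h * h) * (loc h c 1 x * loc h c 2 x * loc h c 3 x)"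
      unfolding coord_eq_loc[OF h, of x 1 c] coord_eq_loc[OF h, of x 2 c] coord_eq_loc[OF h, of x 3 c]
      by (simp add: algebra_simps)
  qed
  ultimately show "local_shape h c (\<lambda>x. x $ 1 * x $ 2 * x $ 3)" by (simp only:)
qed

lemma local_shape_monomial:
  fixes e :: "3 \<Rightarrow> nat"
  assumes h: "h > 0" and e: "(\<Sum>i\<in>UNIV. e i) \<le> 2"
  shows "local_shape h c (\<lambda>x. \<Prod>i\<in>UNIV. (x $ i) ^ e i)"
proof -
  have s: "e 1 + e 2 + e 3 \<le> 2" using e by (simp add: sum_3)
  have P: "(\<lambda>x :: real^3. \<Prod>i\<in>UNIV. (x $ i) ^ e i) = (\<lambda>x. (x $ 1) ^ e 1 * (x $ 2) ^ e 2 * (x $ 3) ^ e 3)"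
    unfolding UNIV_3 by (simp add: mult.assoc)
  have cases: "m = 0 \<or> m = 1 \<or> m = 2" if "m \<le> 2" for m :: nat using that by linarith
  have e3: "e 1 \<le> 2" "e 2 \<le> 2" "e 3 \<le> 2" using s by linarith+
  note pw = power_0 power_one_right power2_eq_square mult_1_left mult_1_right
  note sh = local_shape_const local_shape_coord[OF h]
  show ?thesis
    unfolding P
    using cases[OF e3(1)]
  proof (elim disjE)
    assume 1: "e 1 = 0"
    show "local_shape h c (\<lambda>x. (x $ 1) ^ e 1 * (x $ 2) ^ e 2 * (x $ 3) ^ e 3)"
      using cases[OF e3(2)]
    proof (elim disjE)
      assume 2: "e 2 = 0"
      show ?thesis using cases[OF e3(3)]
        by (elim disjE) (simp_all only: 1 2 pw sh)
    next
      assume 2: "e 2 = 1"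
      have "e 3 = 0 \<or> e 3 = 1" using s 1 2 by linarith
      then show ?thesis by (elim disjE) (simp_all only: 1 2 pw sh)
    next
      assume 2: "e 2 = 2"
      have "e 3 = 0" using s 1 2 by linarith
      then show ?thesis by (simp only: 1 2 pw sh)
    qed
  next
    assume 1: "e 1 = 1"
    have "(e 2 = 0 \<and> e 3 = 0) \<or> (e 2 = 1 \<and> e 3 = 0) \<or> (e 2 = 0 \<and> e 3 = 1)" using s 1 by linarith
    then show "local_shape h c (\<lambda>x. (x $ 1) ^ e 1 * (x $ 2) ^ e 2 * (x $ 3) ^ e 3)"
      by (elim disjE conjE) (simp_all only: 1 pw sh)
  next
    assume 1: "e 1 = 2"
    have "e 2 = 0" "e 3 = 0" using s 1 by linarith+
    then show "local_shape h c (\<lambda>x. (x $ 1) ^ e 1 * (x $ 2) ^ e 2 * (x $ 3) ^ e 3)"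
      by (simp only: 1 pw sh)
  qed
qed

lemma morley_shape_local:
  assumes h: "h > 0" and p: "p \<in> morley_shape"
  shows "local_shape h c p"
proof -
  obtain q a1 a2 a3 b where q: "q \<in> poly_functions 2" and
    eq: "\<forall>x. p x = q x + a1 * (x $ 1) ^ 3 + a2 * (x $ 2) ^ 3 + a3 * (x $ 3) ^ 3 + b * (x $ 1 * x $ 2 * x $ 3)"
    using p unfolding morley_shape_def by blast
  obtain r where r: "\<forall>x. q x = (\<Sum>e :: 3 \<Rightarrow> nat | (\<Sum>i\<in>UNIV. e i) \<le> 2. r e * (\<Prod>i\<in>UNIV. (x $ i) ^ e i))"
    using q unfolding poly_functions_def by blast
  have "local_shape h c (\<lambda>x. \<Sum>e :: 3 \<Rightarrow> nat | (\<Sum>i\<in>UNIV. e i) \<le> 2. r e * (\<Prod>i\<in>UNIV. (x $ i) ^ e i))"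
    by (intro local_shape_sum local_shape_cmult local_shape_monomial h) simp
  moreover have "q = (\<lambda>x. \<Sum>e :: 3 \<Rightarrow> nat | (\<Sum>i\<in>UNIV. e i) \<le> 2. r e * (\<Prod>i\<in>UNIV. (x $ i) ^ e i))"
    by (rule ext) (rule r[rule_format])
  ultimately have q': "local_shape h c q" by (simp only:)
  have "local_shape h c (\<lambda>x. q x + a1 * (x $ 1) ^ 3 + a2 * (x $ 2) ^ 3 + a3 * (x $ 3) ^ 3 + b * (x $ 1 * x $ 2 * x $ 3))"
    by (intro local_shape_add local_shape_cmult local_shape_coord h q')
  moreover have "p = (\<lambda>x. q x + a1 * (x $ 1) ^ 3 + a2 * (x $ 2) ^ 3 + a3 * (x $ 3) ^ 3 + b * (x $ 1 * x $ 2 * x $ 3))"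
    by (rule ext) (rule eq[rule_format])
  ultimately show ?thesis by (simp only:)
qed

section \<open>Derivatives of shape functions in local coordinates\<close>

lemma elementary_partial_deriv_rules:
  "partial_deriv i (\<lambda>_. r) x = 0"
  "partial_deriv i (loc h c k) x = (if k = i then 1 / h else 0)"
  "elementary f \<Longrightarrow> elementary g \<Longrightarrow> partial_deriv i (\<lambda>x. f x + g x) x = partial_deriv i f x + partial_deriv i g x"
  "elementary f \<Longrightarrow> elementary g \<Longrightarrow> partial_deriv i (\<lambda>x. f x - g x) x = partial_deriv i f x - partial_deriv i g x"
  "elementary f \<Longrightarrow> elementary g \<Longrightarrow>
     partial_deriv i (\<lambda>x. f x * g x) x = f x * partial_deriv i g x + g x * partial_deriv i f x"
  "elementary f \<Longrightarrow> partial_deriv i (\<lambda>x. f x / r) x = partial_deriv i f x / r"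
proof -
  show c: "partial_deriv i (\<lambda>_. r) x = 0" for r
    by (rule partial_deriv_eq[OF has_derivative_const])
  show "partial_deriv i (loc h c k) x = (if k = i then 1 / h else 0)"
    by (simp add: partial_deriv_eq[OF loc_has_derivative] axis_def)
  show add: "partial_deriv i (\<lambda>x. f x + g x) x = partial_deriv i f x + partial_deriv i g x"
    if "elementary f" "elementary g" for f g
    using that by (intro partial_deriv_add elementary_differentiable)
  show mult: "partial_deriv i (\<lambda>x. f x * g x) x = f x * partial_deriv i g x + g x * partial_deriv i f x"
    if "elementary f" "elementary g" for f g
    using that by (intro partial_deriv_mult elementary_differentiable)
  show "partial_deriv i (\<lambda>x. f x - g x) x = partial_deriv i f x - partial_deriv i g x"
    if "elementary f" "elementary g"
    using add[OF that(1) elementary_mult[OF elementary_const that(2)], of "-1"]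
      mult[OF elementary_const that(2), of "-1"] by (simp add: c)
  show "partial_deriv i (\<lambda>x. f x / r) x = partial_deriv i f x / r" if "elementary f"
    using mult[OF that elementary_const, of "1 / r"] by (simp add: c)
qed

lemmas elementary_simps = elementary_const elementary_add elementary_mult elementary_diff elementary_divide
  loc_elementary

lemma partial_deriv_trilinear:
  "partial_deriv i (trilinear h c a l g d) x = (l i + g (nxt i) * loc h c (prv i) x + g (prv i) * loc h c (nxt i) x
     + d * (loc h c (nxt i) x * loc h c (prv i) x)) / h"
proof -
  have eq: "trilinear h c a l g d = (\<lambda>x. a + l i * loc h c i x + l (nxt i) * loc h c (nxt i) x + l (prv i) * loc h c (prv i) x
     + g i * (loc h c (nxt i) x * loc h c (prv i) x) + g (nxt i) * (loc h c (prv i) x * loc h c i x)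
     + g (prv i) * (loc h c i x * loc h c (nxt i) x) + d * (loc h c i x * loc h c (nxt i) x * loc h c (prv i) x))"
    by (rule ext) (rule trilinear_eq)
  show ?thesis unfolding eq
    by (simp add: elementary_partial_deriv_rules elementary_simps add_divide_distrib)
qed

lemma partial_deriv_bubble:
  "partial_deriv i (bubble h c \<alpha> \<beta>) x = (2 * \<alpha> i * loc h c i x + \<beta> i * (3 * (loc h c i x)\<^sup>2 - 1)) / h"
proof -
  have eq: "bubble h c \<alpha> \<beta> = (\<lambda>x. \<alpha> i * (loc h c i x * loc h c i x - 1)
     + \<beta> i * (loc h c i x * (loc h c i x * loc h c i x) - loc h c i x)
     + (\<alpha> (nxt i) * (loc h c (nxt i) x * loc h c (nxt i) x - 1)
       + \<beta> (nxt i) * (loc h c (nxt i) x * (loc h c (nxt i) x * loc h c (nxt i) x) - loc h c (nxt i) x))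
     + (\<alpha> (prv i) * (loc h c (prv i) x * loc h c (prv i) x - 1)
       + \<beta> (prv i) * (loc h c (prv i) x * (loc h c (prv i) x * loc h c (prv i) x) - loc h c (prv i) x)))"
    by (rule ext) (simp add: bubble_eq[where i = i] power2_eq_square power3_eq_cube mult.assoc)
  show ?thesis unfolding eq
    by (simp add: elementary_partial_deriv_rules elementary_simps)
       (simp add: add_divide_distrib diff_divide_distrib algebra_simps power2_eq_square)
qed

text \<open>One form for three uses: \<open>grad\<close> is the case \<open>k4 = k5 = 0\<close>,
  \<open>mean\<close> the case \<open>k1 = k2 = k3 = 0\<close>, and the i-th derivative of the full
  shape function has all terms.\<close>

lemma partial_deriv_gradient_form:
  fixes h k0 k1 k2 k3 k4 k5 :: real and c :: "real^3" and i :: 3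
  defines "F \<equiv> \<lambda>x. (k0 + k1 * loc h c (prv i) x + k2 * loc h c (nxt i) x + k3 * (loc h c (nxt i) x * loc h c (prv i) x)
       + k4 * loc h c i x + k5 * (3 * (loc h c i x * loc h c i x) - 1)) / h"
  shows "partial_deriv i F x = (k4 + 6 * k5 * loc h c i x) / h\<^sup>2"
    and "partial_deriv (nxt i) F x = (k2 + k3 * loc h c (prv i) x) / h\<^sup>2"
    and "partial_deriv (prv i) F x = (k1 + k3 * loc h c (nxt i) x) / h\<^sup>2"
  unfolding F_def
  by (simp_all add: elementary_partial_deriv_rules elementary_simps power2_eq_square add_divide_distrib)

section \<open>Degrees of freedom of the Morley space\<close>

definition vertex :: "real \<Rightarrow> real^3 \<Rightarrow> 3 \<Rightarrow> real \<Rightarrow> real \<Rightarrow> real \<Rightarrow> real^3" where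
  "vertex h c i s \<sigma> \<tau> = (\<chi> k. c $ k + h * (if k = i then s else if k = nxt i then \<sigma> else \<tau>))"

lemma loc_vertex:
  assumes "h > 0"
  shows "loc h c i (vertex h c i s \<sigma> \<tau>) = s" "loc h c (nxt i) (vertex h c i s \<sigma> \<tau>) = \<sigma>"
    "loc h c (prv i) (vertex h c i s \<sigma> \<tau>) = \<tau>"
  using assms by (simp_all add: loc_def vertex_def)

text \<open>The bubble vanishes here. The grouping displays the trace on the face with sign
  \<open>s\<close> as a bilinear function of the two tangential coordinates.\<close>

lemma shape_vertex:
  assumes "h > 0" "\<bar>s\<bar> = 1" "\<bar>\<sigma>\<bar> = 1" "\<bar>\<tau>\<bar> = 1"
  shows "trilinear h c a l g d (vertex h c i s \<sigma> \<tau>) + bubble h c \<alpha> \<beta> (vertex h c i s \<sigma> \<tau>) =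
    (a + s * l i) + (l (nxt i) + s * g (prv i)) * \<sigma> + (l (prv i) + s * g (nxt i)) * \<tau> + (g i + s * d) * (\<sigma> * \<tau>)"
proof -
  have sq: "s\<^sup>2 = 1" "\<sigma>\<^sup>2 = 1" "\<tau>\<^sup>2 = 1" using assms by (simp_all add: abs_square_eq_1)
  then have "s ^ 3 = s" "\<sigma> ^ 3 = \<sigma>" "\<tau> ^ 3 = \<tau>" by (simp_all add: power3_eq_cube power2_eq_square)
  then show ?thesis
    unfolding trilinear_eq[where i = i] bubble_eq[where i = i] loc_vertex[OF assms(1)] sq
    by (simp add: algebra_simps)
qed

lemma vertex_neighbour:
  "s' = - s \<Longrightarrow> vertex h (c + (2 * s * h) *\<^sub>R axis i 1) i s' \<sigma> \<tau> = vertex h c i s \<sigma> \<tau>"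
  by (simp add: vertex_def vec_eq_iff axis_def)

lemma vertex_extreme_point_of:
  assumes "h > 0" "\<bar>s\<bar> = 1" "\<bar>\<sigma>\<bar> = 1" "\<bar>\<tau>\<bar> = 1"
  shows "vertex h c i s \<sigma> \<tau> extreme_point_of cube h c"
  by (rule vertex_extreme_point_of_cube) (use assms in \<open>auto simp: vertex_def abs_mult\<close>)

lemma vertex_in_face:
  assumes "h > 0" "\<bar>s\<bar> = 1" "\<bar>\<sigma>\<bar> = 1" "\<bar>\<tau>\<bar> = 1"
  shows "vertex h c i s \<sigma> \<tau> \<in> cube_face h c i s"
  using assms by (subst mem_cube_face) (auto simp: vertex_def abs_mult)

text \<open>A bilinear function is determined by its values at the four corners of a square. This
  converts vertex conditions into equations between coefficients, hence into continuity of the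
  interpolant on the whole face.\<close>

lemma face_coefficients_unique:
  fixes A B C D :: real
  assumes "\<And>\<sigma> \<tau>. \<bar>\<sigma>\<bar> = 1 \<Longrightarrow> \<bar>\<tau>\<bar> = 1 \<Longrightarrow>
    A + B * \<sigma> + C * \<tau> + D * (\<sigma> * \<tau>) = A' + B' * \<sigma> + C' * \<tau> + D' * (\<sigma> * \<tau>)"
  shows "A = A'" "B = B'" "C = C'" "D = D'"
  using assms[of 1 1] assms[of 1 "-1"] assms[of "-1" 1] assms[of "-1" "-1"] by simp_all

lemma plane_embedding_measurable:
  "(\<lambda>y. \<chi> j. if j = i then r else y j) \<in> measurable (\<Pi>\<^sub>M j\<in>UNIV - {i}. lborel) (borel :: (real^'n) measure)"
proof (subst borel_measurable_euclidean_space, rule ballI)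
  fix b :: "real^'n" assume "b \<in> Basis"
  then obtain j where b: "b = axis j 1" by (auto simp: Basis_vec_def)
  have "(\<lambda>y. if j = i then r else y j) \<in> borel_measurable (\<Pi>\<^sub>M j\<in>UNIV - {i}. lborel)"
    by (cases "j = i") (auto intro!: measurable_component_singleton[of j "UNIV - {i}" "\<lambda>_. lborel", simplified])
  then show "(\<lambda>y. (\<chi> j. if j = i then r else y j) \<bullet> b) \<in> borel_measurable (\<Pi>\<^sub>M j\<in>UNIV - {i}. lborel)"
    by (simp add: b inner_axis)
qed

lemma integral_plane_product:
  fixes u w :: "real \<Rightarrow> real"
  assumes "integrable lborel u" "integrable lborel w"
  shows "integrable (\<Pi>\<^sub>M j\<in>UNIV - {i}. lborel) (\<lambda>y. u (y (nxt i)) * w (y (prv i)))"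
    and "(\<integral>y. u (y (nxt i)) * w (y (prv i)) \<partial>(\<Pi>\<^sub>M j\<in>UNIV - {i}. lborel))
      = (\<integral>t. u t \<partial>lborel) * (\<integral>t. w t \<partial>lborel)"
proof -
  interpret product_sigma_finite "\<lambda>_ :: 3. lborel :: real measure" by standard
  define f where "f k = (if k = nxt i then u else w)" for k
  have I: "UNIV - {i} = {nxt i, prv i}" using UNIV_nxt_prv[of i] by auto
  have P: "(\<Prod>k\<in>UNIV - {i}. f k (y k)) = u (y (nxt i)) * w (y (prv i))" for y
    unfolding I by (simp add: f_def)
  have f: "integrable lborel (f k)" for k using assms by (simp add: f_def)
  show "integrable (\<Pi>\<^sub>M j\<in>UNIV - {i}. lborel) (\<lambda>y. u (y (nxt i)) * w (y (prv i)))"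
    using product_integrable_prod[of "UNIV - {i}" f] f unfolding P by simp
  have "(\<integral>y. u (y (nxt i)) * w (y (prv i)) \<partial>(\<Pi>\<^sub>M j\<in>UNIV - {i}. lborel)) = (\<Prod>k\<in>UNIV - {i}. \<integral>t. f k t \<partial>lborel)"
    using product_integral_prod[of "UNIV - {i}" f] f unfolding P by simp
  then show "(\<integral>y. u (y (nxt i)) * w (y (prv i)) \<partial>(\<Pi>\<^sub>M j\<in>UNIV - {i}. lborel))
      = (\<integral>t. u t \<partial>lborel) * (\<integral>t. w t \<partial>lborel)"
    unfolding I by (simp add: f_def)
qed

lemma interval_moments:
  fixes c h :: real
  assumes "h > 0"
  shows "has_bochner_integral lborel (\<lambda>t. indicator {c - h..c + h} t) (2 * h)"
    and "has_bochner_integral lborel (\<lambda>t. (t - c) / h * indicator {c - h..c + h} t) 0"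
proof -
  have "has_bochner_integral lborel (\<lambda>t. 1 * indicator {c - h..c + h} t) ((c + h) - (c - h))"
    by (rule has_bochner_integral_FTC_Icc_real[where F = "\<lambda>t. t"])
       (use assms in \<open>auto intro!: derivative_eq_intros\<close>)
  then show "has_bochner_integral lborel (\<lambda>t. indicator {c - h..c + h} t) (2 * h)" by simp
  have "has_bochner_integral lborel (\<lambda>t. (t - c) / h * indicator {c - h..c + h} t)
     (((c + h) - c)\<^sup>2 / (2 * h) - ((c - h) - c)\<^sup>2 / (2 * h))"
    by (rule has_bochner_integral_FTC_Icc_real[where F = "\<lambda>t. (t - c)\<^sup>2 / (2 * h)"])
       (use assms in \<open>auto intro!: derivative_eq_intros continuous_intros simp: field_simps\<close>)
  then show "has_bochner_integral lborel (\<lambda>t. (t - c) / h * indicator {c - h..c + h} t) 0" by simp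
qed

text \<open>Every term besides the constant is odd in some tangential local coordinate and
  integrates to 0; \<open>(2 * h)^2\<close> is the area of the face.\<close>

lemma face_integral:
  fixes c :: "real^3"
  assumes h: "h > 0" and s: "\<bar>s\<bar> = 1"
  shows "(LINT x:cube_face h c i s|hyperplane_measure i (c $ i + s * h).
      m + k1 * loc h c (nxt i) x + k2 * loc h c (prv i) x + k3 * (loc h c (nxt i) x * loc h c (prv i) x)) = (2 * h)\<^sup>2 * m"
proof -
  let ?M = "\<Pi>\<^sub>M j\<in>UNIV - {i}. (lborel :: real measure)"
  let ?e = "\<lambda>y. (\<chi> j. if j = i then c $ i + s * h else y j) :: real^3"
  let ?f = "\<lambda>x. m + k1 * loc h c (nxt i) x + k2 * loc h c (prv i) x + k3 * (loc h c (nxt i) x * loc h c (prv i) x)"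
  define u where "u k t = indicat_real {c $ k - h..c $ k + h} t" for k t
  define w where "w k t = (t - c $ k) / h * indicat_real {c $ k - h..c $ k + h} t" for k t
  have uw: "integrable lborel (u k)" "(\<integral>t. u k t \<partial>lborel) = 2 * h"
      "integrable lborel (w k)" "(\<integral>t. w k t \<partial>lborel) = 0" for k
    using interval_moments[OF h, of "c $ k"]
    unfolding u_def[abs_def] w_def[abs_def] has_bochner_integral_iff by blast+
  have cl: "closed (cube_face h c i s)"
    unfolding cube_face_def cube_def
    by (intro closed_Int closed_cbox closed_Collect_eq continuous_intros)
  have "continuous_on UNIV ?f" unfolding loc_def using h by (intro continuous_intros) auto
  then have bm: "(\<lambda>x. indicator (cube_face h c i s) x *\<^sub>R ?f x) \<in> borel_measurable borel"
    by (intro borel_measurable_scaleR borel_measurable_indicator borel_closed[OF cl] borel_measurable_continuous_onI)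
  have ind: "indicat_real (cube_face h c i s) (?e y) = u (nxt i) (y (nxt i)) * u (prv i) (y (prv i))" for y
  proof -
    have "?e y \<in> cube_face h c i s \<longleftrightarrow> \<bar>y (nxt i) - c $ nxt i\<bar> \<le> h \<and> \<bar>y (prv i) - c $ prv i\<bar> \<le> h"
      unfolding mem_cube_face[OF h s] using index_cases[of _ i] by (auto; metis nxt_prv_neq)
    then show ?thesis by (auto simp: u_def indicator_def abs_le_iff)
  qed
  have "(LINT x:cube_face h c i s|hyperplane_measure i (c $ i + s * h). ?f x)
      = (\<integral>y. indicator (cube_face h c i s) (?e y) *\<^sub>R ?f (?e y) \<partial>?M)"
    unfolding set_lebesgue_integral_def hyperplane_measure_def
    by (rule integral_distr[OF plane_embedding_measurable bm])
  also have "\<dots> = (\<integral>y. m * (u (nxt i) (y (nxt i)) * u (prv i) (y (prv i)))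
      + k1 * (w (nxt i) (y (nxt i)) * u (prv i) (y (prv i))) + k2 * (u (nxt i) (y (nxt i)) * w (prv i) (y (prv i)))
      + k3 * (w (nxt i) (y (nxt i)) * w (prv i) (y (prv i))) \<partial>?M)"
    unfolding ind
    by (rule Bochner_Integration.integral_cong) (auto simp: loc_def u_def w_def algebra_simps)
  also have "\<dots> = m * (2 * h * (2 * h))"
    by (simp add: integral_plane_product uw)
  finally show ?thesis by (simp add: power2_eq_square)
qed

text \<open>On the face the local coordinate is \<open>s\<close> with \<open>s^2 = 1\<close>, so
  \<open>3 * s^2 - 1 = 2\<close>; this is the source of the two bubble contributions.\<close>

lemma face_integral_normal_derivative:
  assumes h: "h > 0" and s: "\<bar>s\<bar> = 1" and p: "\<And>x. p x = trilinear h c a l g d x + bubble h c \<alpha> \<beta> x"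
  shows "(LINT x:cube_face h c i s|hyperplane_measure i (c $ i + s * h). partial_deriv i p x)
     = (2 * h)\<^sup>2 * ((l i + 2 * s * \<alpha> i + 2 * \<beta> i) / h)"
proof -
  have pe: "p = (\<lambda>x. trilinear h c a l g d x + bubble h c \<alpha> \<beta> x)" using p by blast
  have "partial_deriv i p x = (l i + 2 * s * \<alpha> i + 2 * \<beta> i) / h + g (prv i) / h * loc h c (nxt i) x
     + g (nxt i) / h * loc h c (prv i) x + d / h * (loc h c (nxt i) x * loc h c (prv i) x)"
    if "x \<in> cube_face h c i s" for x
  proof -
    have "x $ i = c $ i + s * h" using that by (simp add: cube_face_def)
    then have xi: "loc h c i x = s" using h by (simp add: loc_def)
    have "s\<^sup>2 = 1" using s by (simp add: abs_square_eq_1)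
    moreover have "partial_deriv i p x = partial_deriv i (trilinear h c a l g d) x + partial_deriv i (bubble h c \<alpha> \<beta>) x"
      unfolding pe by (intro partial_deriv_add elementary_differentiable trilinear_elementary bubble_elementary)
    ultimately show ?thesis
      unfolding partial_deriv_trilinear partial_deriv_bubble xi by (simp add: add_divide_distrib algebra_simps)
  qed
  then have "(LINT x:cube_face h c i s|hyperplane_measure i (c $ i + s * h). partial_deriv i p x)
    = (LINT x:cube_face h c i s|hyperplane_measure i (c $ i + s * h). (l i + 2 * s * \<alpha> i + 2 * \<beta> i) / h
     + g (prv i) / h * loc h c (nxt i) x
     + g (nxt i) / h * loc h c (prv i) x + d / h * (loc h c (nxt i) x * loc h c (prv i) x))"
    unfolding set_lebesgue_integral_def
    by (intro Bochner_Integration.integral_cong refl) (auto simp: indicator_def)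
  then show ?thesis unfolding face_integral[OF h s] .
qed

text \<open>The degrees of freedom in coefficient form. The four vertex equations compare the
  coefficients of bilinear traces on a face, taken with sign plus from the left cell and minus from
  the right one; the mean equations compare face means of normal derivatives after removal of a
  common factor. A missing translate identifies a boundary face, by
  \<open>neighbour_or_boundary\<close>.\<close>

locale morley_function = cube_mesh \<Omega> h \<T> for \<Omega> :: "(real^3) set" and h \<T> +
  fixes a d :: "real^3 \<Rightarrow> real" and l g \<alpha> \<beta> :: "real^3 \<Rightarrow> 3 \<Rightarrow> real"
  assumes vertex_match: "\<And>c i. \<lbrakk>c \<in> centres; step i c \<in> centres\<rbrakk> \<Longrightarrow>
      (let c' = step i c in
        a c + l c i = a c' - l c' i \<and> l c (nxt i) + g c (prv i) = l c' (nxt i) - g c' (prv i) \<and>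
        l c (prv i) + g c (nxt i) = l c' (prv i) - g c' (nxt i) \<and> g c i + d c = g c' i - d c')"
    and vertex_zero: "\<And>c i s. \<lbrakk>c \<in> centres; \<bar>s\<bar> = 1; c + (2 * s * h) *\<^sub>R axis i 1 \<notin> centres\<rbrakk> \<Longrightarrow>
        a c + s * l c i = 0 \<and> l c (nxt i) + s * g c (prv i) = 0 \<and>
        l c (prv i) + s * g c (nxt i) = 0 \<and> g c i + s * d c = 0"
    and mean_match: "\<And>c i. \<lbrakk>c \<in> centres; step i c \<in> centres\<rbrakk> \<Longrightarrow>
      (let c' = step i c in l c i + 2 * \<alpha> c i + 2 * \<beta> c i = l c' i - 2 * \<alpha> c' i + 2 * \<beta> c' i)"
    and mean_zero: "\<And>c i s. \<lbrakk>c \<in> centres; \<bar>s\<bar> = 1; c + (2 * s * h) *\<^sub>R axis i 1 \<notin> centres\<rbrakk> \<Longrightarrow>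
        l c i + 2 * s * \<alpha> c i + 2 * \<beta> c i = 0"
begin

definition q :: "real^3 \<Rightarrow> real^3 \<Rightarrow> real" where
  "q c = trilinear h c (a c) (l c) (g c) (d c)"

definition b :: "real^3 \<Rightarrow> real^3 \<Rightarrow> real" where
  "b c = bubble h c (\<alpha> c) (\<beta> c)"

end

lemma morley_space_function:
  fixes \<Omega> :: "(real^3) set"
  assumes mesh: "cube_mesh \<Omega> h \<T>" and w: "w \<in> morley_space \<Omega> \<T>"
  obtains a d l g \<alpha> \<beta> where "morley_function \<Omega> h \<T> a d l g \<alpha> \<beta>"
    and "\<And>c. cube h c \<in> \<T> \<Longrightarrow>
      AE x in lebesgue_on (cube h c). w x = trilinear h c (a c) (l c) (g c) (d c) x + bubble h c (\<alpha> c) (\<beta> c) x"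
proof -
  interpret cube_mesh \<Omega> h \<T> by (rule mesh)
  obtain p where
    D1: "\<forall>K\<in>\<T>. p K \<in> morley_shape \<and> (AE x in lebesgue_on K. w x = p K x)"
    and D2: "\<forall>K\<in>\<T>. \<forall>K'\<in>\<T>. \<forall>z\<in>\<Omega>. z extreme_point_of K \<and> z extreme_point_of K' \<longrightarrow> p K z = p K' z"
    and D3: "\<forall>K\<in>\<T>. \<forall>z\<in>frontier \<Omega>. z extreme_point_of K \<longrightarrow> p K z = 0"
    and D4: "\<forall>K\<in>\<T>. \<forall>K'\<in>\<T>. \<forall>F i r.
        F facet_of K \<and> F facet_of K' \<and> F \<subseteq> {x. x $ i = r} \<and> \<not> F \<subseteq> frontier \<Omega> \<longrightarrow>
        (LINT x:F|hyperplane_measure i r. partial_deriv i (p K) x) =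
        (LINT x:F|hyperplane_measure i r. partial_deriv i (p K') x)"
    and D5: "\<forall>K\<in>\<T>. \<forall>F i r. F facet_of K \<and> F \<subseteq> {x. x $ i = r} \<and> F \<subseteq> frontier \<Omega> \<longrightarrow>
        (LINT x:F|hyperplane_measure i r. partial_deriv i (p K) x) = 0"
    using w unfolding morley_space_def mem_Collect_eq by (elim conjE exE) (rule that, assumption+)
  have p: "p K \<in> morley_shape" "AE x in lebesgue_on K. w x = p K x" if "K \<in> \<T>" for K
    using D1 that by simp_all
  have int_vertex: "p K z = p K' z"
    if "K \<in> \<T>" "K' \<in> \<T>" "z \<in> \<Omega>" "z extreme_point_of K" "z extreme_point_of K'" for K K' z
    using D2[rule_format, OF that(1-3)] that(4,5) by simp
  have bd_vertex: "p K z = 0" if "K \<in> \<T>" "z \<in> frontier \<Omega>" "z extreme_point_of K" for K z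
    using D3[rule_format, OF that] .
  have int_face: "(LINT x:F|hyperplane_measure i r. partial_deriv i (p K) x) =
        (LINT x:F|hyperplane_measure i r. partial_deriv i (p K') x)"
    if "K \<in> \<T>" "K' \<in> \<T>" "F facet_of K" "F facet_of K'" "F \<subseteq> {x. x $ i = r}" "\<not> F \<subseteq> frontier \<Omega>" for K K' F i r
    using D4[rule_format, OF that(1,2) conjI[OF that(3) conjI[OF that(4) conjI[OF that(5,6)]]]] .
  have bd_face: "(LINT x:F|hyperplane_measure i r. partial_deriv i (p K) x) = 0"
    if "K \<in> \<T>" "F facet_of K" "F \<subseteq> {x. x $ i = r}" "F \<subseteq> frontier \<Omega>" for K F i r
    using D5[rule_format, OF that(1) conjI[OF that(2) conjI[OF that(3,4)]]] .
  \<comment> \<open>The guard \<open>c \<in> centres\<close> makes existence hold for every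
    \<open>c\<close>, so that choice produces total coefficient functions, one at a time.\<close>
  have ex0: "\<forall>c. \<exists>a l g d \<alpha> \<beta>. c \<in> centres \<longrightarrow> (\<forall>x. p (cube h c) x = trilinear h c a l g d x + bubble h c \<alpha> \<beta> x)"
  proof
    fix c
    show "\<exists>a l g d \<alpha> \<beta>. c \<in> centres \<longrightarrow> (\<forall>x. p (cube h c) x = trilinear h c a l g d x + bubble h c \<alpha> \<beta> x)"
      using morley_shape_local[OF h_pos p(1), of "cube h c" c] unfolding centres_def local_shape_def mem_Collect_eq
      by (cases "cube h c \<in> \<T>") simp_all
  qed
  from choice[OF ex0] obtain a where ex1: "\<forall>c. \<exists>l g d \<alpha> \<beta>. c \<in> centres \<longrightarrow> (\<forall>x. p (cube h c) x = trilinear h c (a c) l g d x + bubble h c \<alpha> \<beta> x)" ..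
  from choice[OF ex1] obtain l where ex2: "\<forall>c. \<exists>g d \<alpha> \<beta>. c \<in> centres \<longrightarrow> (\<forall>x. p (cube h c) x = trilinear h c (a c) (l c) g d x + bubble h c \<alpha> \<beta> x)" ..
  from choice[OF ex2] obtain g where ex3: "\<forall>c. \<exists>d \<alpha> \<beta>. c \<in> centres \<longrightarrow> (\<forall>x. p (cube h c) x = trilinear h c (a c) (l c) (g c) d x + bubble h c \<alpha> \<beta> x)" ..
  from choice[OF ex3] obtain d where ex4: "\<forall>c. \<exists>\<alpha> \<beta>. c \<in> centres \<longrightarrow> (\<forall>x. p (cube h c) x = trilinear h c (a c) (l c) (g c) (d c) x + bubble h c \<alpha> \<beta> x)" ..
  from choice[OF ex4] obtain \<alpha> where ex5: "\<forall>c. \<exists>\<beta>. c \<in> centres \<longrightarrow> (\<forall>x. p (cube h c) x = trilinear h c (a c) (l c) (g c) (d c) x + bubble h c (\<alpha> c) \<beta> x)" ..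
  from choice[OF ex5] obtain \<beta> where ex6: "\<forall>c. c \<in> centres \<longrightarrow> (\<forall>x. p (cube h c) x = trilinear h c (a c) (l c) (g c) (d c) x + bubble h c (\<alpha> c) (\<beta> c) x)" ..
  have P: "p (cube h c) x = trilinear h c (a c) (l c) (g c) (d c) x + bubble h c (\<alpha> c) (\<beta> c) x"
    if "c \<in> centres" for c x
    using ex6[rule_format, OF that] .
  note hp = h_pos
  have cell: "cube h c \<in> \<T>" if "c \<in> centres" for c using that by (simp add: centres_def)
  have pv: "p (cube h c) (vertex h c i s \<sigma> \<tau>) = (a c + s * l c i) + (l c (nxt i) + s * g c (prv i)) * \<sigma>
      + (l c (prv i) + s * g c (nxt i)) * \<tau> + (g c i + s * d c) * (\<sigma> * \<tau>)"
    if "c \<in> centres" "\<bar>s\<bar> = 1" "\<bar>\<sigma>\<bar> = 1" "\<bar>\<tau>\<bar> = 1" for c i s \<sigma> \<tau>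
    using that by (simp only: P shape_vertex[OF hp])
  have facet: "cube_face h c i s \<subseteq> {x. x $ i = c $ i + s * h}" for c :: "real^3" and i s
    by (auto simp: cube_face_def)
  have pf: "(LINT x:cube_face h c i s|hyperplane_measure i (c $ i + s * h). partial_deriv i (p (cube h c)) x)
     = (2 * h)\<^sup>2 * ((l c i + 2 * s * \<alpha> c i + 2 * \<beta> c i) / h)" if "c \<in> centres" "\<bar>s\<bar> = 1" for c i s
    by (rule face_integral_normal_derivative[OF hp that(2) P[OF that(1)]])
  have boundary: "cube_face h c i s \<subseteq> frontier \<Omega>"
    if "c \<in> centres" "\<bar>s\<bar> = 1" "c + (2 * s * h) *\<^sub>R axis i 1 \<notin> centres" for c i s
    using neighbour_or_boundary[OF cell[OF that(1)] that(2), of i] that(3) by (simp add: centres_def)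
  have "morley_function \<Omega> h \<T> a d l g \<alpha> \<beta>"
  proof (intro morley_function.intro morley_function_axioms.intro mesh)
    fix c i assume c: "c \<in> centres" and c': "step i c \<in> centres"
    define c' where "c' = step i c"
    have c'C: "c' \<in> centres" using c' by (simp add: c'_def)
    have v: "vertex h c' i (- 1) \<sigma> \<tau> = vertex h c i 1 \<sigma> \<tau>" for \<sigma> \<tau>
      using vertex_neighbour[of "-1" 1 h c i] by (simp add: c'_def)
    have F: "cube_face h c' i (- 1) = cube_face h c i 1"
      using cube_face_neighbour[OF hp, of 1 c i] by (simp add: c'_def)
    have r: "c' $ i + - 1 * h = c $ i + 1 * h" by (simp add: c'_def axis_def)
    have eq: "(a c + 1 * l c i) + (l c (nxt i) + 1 * g c (prv i)) * \<sigma>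
      + (l c (prv i) + 1 * g c (nxt i)) * \<tau> + (g c i + 1 * d c) * (\<sigma> * \<tau>) =
      (a c' + - 1 * l c' i) + (l c' (nxt i) + - 1 * g c' (prv i)) * \<sigma>
      + (l c' (prv i) + - 1 * g c' (nxt i)) * \<tau> + (g c' i + - 1 * d c') * (\<sigma> * \<tau>)"
      if st: "\<bar>\<sigma>\<bar> = 1" "\<bar>\<tau>\<bar> = 1" for \<sigma> \<tau>
    proof -
      have e: "vertex h c i 1 \<sigma> \<tau> extreme_point_of cube h c" "vertex h c i 1 \<sigma> \<tau> extreme_point_of cube h c'"
        using vertex_extreme_point_of[OF hp _ st, of 1 c i] vertex_extreme_point_of[OF hp _ st, of "-1" c' i]
        by (simp_all add: v)
      have "vertex h c i 1 \<sigma> \<tau> \<in> cube h c" using e(1) by (simp add: extreme_point_of_def)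
      then have "vertex h c i 1 \<sigma> \<tau> \<in> closure \<Omega>" using cell_subset[OF cell[OF c]] by blast
      then have "vertex h c i 1 \<sigma> \<tau> \<in> \<Omega> \<or> vertex h c i 1 \<sigma> \<tau> \<in> frontier \<Omega>"
        by (simp add: frontier_def interior_open[OF open_domain])
      \<comment> \<open>A vertex of an interior face may still lie on the boundary of the domain;
        then both values are 0.\<close>
      then have "p (cube h c) (vertex h c i 1 \<sigma> \<tau>) = p (cube h c') (vertex h c i 1 \<sigma> \<tau>)"
      proof
        assume "vertex h c i 1 \<sigma> \<tau> \<in> \<Omega>"
        then show ?thesis by (rule int_vertex[OF cell[OF c] cell[OF c'C] _ e])
      next
        assume "vertex h c i 1 \<sigma> \<tau> \<in> frontier \<Omega>"
        then show ?thesis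
          by (simp only: bd_vertex[OF cell[OF c] _ e(1)] bd_vertex[OF cell[OF c'C] _ e(2)])
      qed
      then show ?thesis
        using pv[OF c _ st, of 1 i] pv[OF c'C _ st, of "-1" i] by (simp add: v)
    qed
    have "a c + 1 * l c i = a c' + - 1 * l c' i"
      "l c (nxt i) + 1 * g c (prv i) = l c' (nxt i) + - 1 * g c' (prv i)"
      "l c (prv i) + 1 * g c (nxt i) = l c' (prv i) + - 1 * g c' (nxt i)"
      "g c i + 1 * d c = g c' i + - 1 * d c'"
      by (rule face_coefficients_unique[OF eq]; assumption)+
    then show "let c' = step i c in
        a c + l c i = a c' - l c' i \<and> l c (nxt i) + g c (prv i) = l c' (nxt i) - g c' (prv i) \<and>
        l c (prv i) + g c (nxt i) = l c' (prv i) - g c' (nxt i) \<and> g c i + d c = g c' i - d c'"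
      unfolding Let_def c'_def[symmetric] by simp
    have "cube_face h c i 1 facet_of cube h c" "cube_face h c i 1 facet_of cube h c'"
      using cube_face_facet_of[OF hp, of 1 c i] cube_face_facet_of[OF hp, of "-1" c' i] by (simp_all add: F)
    moreover have "\<not> cube_face h c i 1 \<subseteq> frontier \<Omega>"
      using neighbour_face_not_boundary[OF cell[OF c]] cell[OF c'C] by (simp add: c'_def)
    ultimately have "(LINT x:cube_face h c i 1|hyperplane_measure i (c $ i + 1 * h). partial_deriv i (p (cube h c)) x)
      = (LINT x:cube_face h c i 1|hyperplane_measure i (c $ i + 1 * h). partial_deriv i (p (cube h c')) x)"
      by (intro int_face[OF cell[OF c] cell[OF c'C] _ _ facet])
    then have "(2 * h)\<^sup>2 * ((l c i + 2 * 1 * \<alpha> c i + 2 * \<beta> c i) / h) = (2 * h)\<^sup>2 * ((l c' i + 2 * - 1 * \<alpha> c' i + 2 * \<beta> c' i) / h)"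
      using pf[OF c, of 1 i] pf[OF c'C, of "-1" i] unfolding F r by simp
    then show "let c' = step i c in l c i + 2 * \<alpha> c i + 2 * \<beta> c i = l c' i - 2 * \<alpha> c' i + 2 * \<beta> c' i"
      unfolding Let_def c'_def[symmetric] using hp by simp
  next
    fix c i and s :: real assume c: "c \<in> centres" and s: "\<bar>s\<bar> = 1" and n: "c + (2 * s * h) *\<^sub>R axis i 1 \<notin> centres"
    have F: "cube_face h c i s \<subseteq> frontier \<Omega>" by (rule boundary[OF c s n])
    have eq: "(a c + s * l c i) + (l c (nxt i) + s * g c (prv i)) * \<sigma>
      + (l c (prv i) + s * g c (nxt i)) * \<tau> + (g c i + s * d c) * (\<sigma> * \<tau>) = 0 + 0 * \<sigma> + 0 * \<tau> + 0 * (\<sigma> * \<tau>)"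
      if st: "\<bar>\<sigma>\<bar> = 1" "\<bar>\<tau>\<bar> = 1" for \<sigma> \<tau>
    proof -
      have "vertex h c i s \<sigma> \<tau> \<in> frontier \<Omega>" using vertex_in_face[OF hp s st] F by blast
      then have "p (cube h c) (vertex h c i s \<sigma> \<tau>) = 0"
        using bd_vertex[OF cell[OF c]] vertex_extreme_point_of[OF hp s st] by blast
      then show ?thesis using pv[OF c s st, of i] by simp
    qed
    show "a c + s * l c i = 0 \<and> l c (nxt i) + s * g c (prv i) = 0 \<and>
        l c (prv i) + s * g c (nxt i) = 0 \<and> g c i + s * d c = 0"
      by (intro conjI) (rule face_coefficients_unique[OF eq]; assumption)+
    have "(2 * h)\<^sup>2 * ((l c i + 2 * s * \<alpha> c i + 2 * \<beta> c i) / h) = 0"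
      using bd_face[OF cell[OF c] cube_face_facet_of[OF hp s] facet F] pf[OF c s, of i] by simp
    then show "l c i + 2 * s * \<alpha> c i + 2 * \<beta> c i = 0" using hp by simp
  qed
  moreover have "AE x in lebesgue_on (cube h c). w x = trilinear h c (a c) (l c) (g c) (d c) x + bubble h c (\<alpha> c) (\<beta> c) x"
    if "cube h c \<in> \<T>" for c
    using p(2)[OF that] P[of c] that by (simp add: centres_def)
  ultimately show thesis by (rule that)
qed

section \<open>The consistency error\<close>

lemma loc_shift: "k \<noteq> i \<Longrightarrow> loc h (c + t *\<^sub>R axis i 1) k x = loc h c k x"
  by (simp add: loc_def axis_def)

text \<open>Transfers the classical derivatives of the cell polynomial to \<open>w\<close>, which
  agrees with it only almost everywhere.\<close>

lemma has_weak_deriv_cong_AE: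
  assumes "has_weak_deriv \<Omega> is p v" "open \<Omega>" "bounded \<Omega>" "w \<in> L2 \<Omega>" "AE x in lebesgue_on \<Omega>. w x = p x"
  shows "has_weak_deriv \<Omega> is w v"
  unfolding has_weak_deriv_def
proof (intro conjI ballI)
  have Om: "\<Omega> \<in> sets lebesgue" by (rule open_sets_lebesgue) fact
  show "locally_integrable \<Omega> w" by (rule L2_locally_integrable) fact+
  show "locally_integrable \<Omega> v" using assms(1) by (simp add: has_weak_deriv_def)
  fix \<phi> assume \<phi>: "\<phi> \<in> test_functions \<Omega>"
  have "partial_derivs is \<phi> \<in> L2 \<Omega>"
    by (rule continuous_L2[OF smooth_continuous_on[OF smooth_partial_derivs[OF smooth_test[OF \<phi>]]] assms(3) Om])
  then have "L2_inner \<Omega> w (partial_derivs is \<phi>) = L2_inner \<Omega> p (partial_derivs is \<phi>)"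
    by (rule L2_inner_cong_AE[OF assms(4) _ Om assms(5)]) simp
  also have "\<dots> = (- 1) ^ length is * L2_inner \<Omega> v \<phi>"
    using assms(1) \<phi> by (simp add: has_weak_deriv_def)
  finally show "L2_inner \<Omega> w (partial_derivs is \<phi>) = (- 1) ^ length is * L2_inner \<Omega> v \<phi>" .
qed

lemma hessian_form_eq_sum_AE:
  fixes V W :: "'n \<Rightarrow> 'n \<Rightarrow> real^'n \<Rightarrow> real"
  assumes Om: "\<Omega> \<in> sets lebesgue"
    and V: "\<And>i j. V i j \<in> L2 \<Omega>" "\<And>i j. AE x in lebesgue_on \<Omega>. weak_deriv \<Omega> [i, j] v x = V i j x"
    and W: "\<And>i j. W i j \<in> L2 \<Omega>" "\<And>i j. AE x in lebesgue_on \<Omega>. weak_deriv \<Omega> [i, j] w x = W i j x"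
  shows "hessian_form \<Omega> v w = (\<Sum>i\<in>UNIV. \<Sum>j\<in>UNIV. L2_inner \<Omega> (V i j) (W i j))"
proof -
  have v: "AE x in lebesgue_on \<Omega>. V i j x = weak_deriv \<Omega> [i, j] v x" for i j
    using V(2)[of i j] by eventually_elim simp
  have w: "AE x in lebesgue_on \<Omega>. W i j x = weak_deriv \<Omega> [i, j] w x" for i j
    using W(2)[of i j] by eventually_elim simp
  have "hessian_form \<Omega> v w =
      (\<Sum>i\<in>UNIV. \<Sum>j\<in>UNIV. L2_inner \<Omega> (weak_deriv \<Omega> [i, j] v) (weak_deriv \<Omega> [i, j] w))"
    by (rule hessian_form_eq_sum) (rule L2_AE[OF V(1) v Om], rule L2_AE[OF W(1) w Om])
  also have "\<dots> = (\<Sum>i\<in>UNIV. \<Sum>j\<in>UNIV. L2_inner \<Omega> (V i j) (W i j))"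
    by (intro sum.cong refl L2_inner_cong_AE[symmetric] V(1) W(1) Om v w)
  finally show ?thesis .
qed

lemma L2_norm_le_sobolev_seminorm:
  fixes u :: "real^'n \<Rightarrow> real"
  assumes "length is = k"
  shows "L2_norm \<Omega> (weak_deriv \<Omega> is u) \<le> sobolev_seminorm k \<Omega> u"
proof -
  have fin: "finite {is :: 'n list. length is = k}"
    using finite_lists_length_eq[of "UNIV :: 'n set" k] by simp
  have "(L2_norm \<Omega> (weak_deriv \<Omega> is u))\<^sup>2 \<le> (\<Sum>is | length is = k. (L2_norm \<Omega> (weak_deriv \<Omega> is u))\<^sup>2)"
    by (rule member_le_sum) (use fin assms in auto)
  then show ?thesis unfolding sobolev_seminorm_def by (rule real_le_rsqrt)
qed

context cube_mesh
begin

lemma sum_ibp_eq: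
  assumes v: "v \<in> L2 \<Omega>" and v': "v' \<in> L2 \<Omega>" and weak: "has_weak_deriv \<Omega> [i] v v'"
    and \<phi>: "\<And>c x. \<phi> c x = B c x + loc h c i x * D c x + (1 - (loc h c i x)\<^sup>2) * E c x"
    and el: "\<And>c. elementary (B c)" "\<And>c. elementary (D c)" "\<And>c. elementary (E c)"
    and match: "\<And>c x. c \<in> centres \<Longrightarrow> step i c \<in> centres \<Longrightarrow>
      B c x + D c x = B (step i c) x - D (step i c) x"
    and right: "\<And>c x. c \<in> centres \<Longrightarrow> step i c \<notin> centres \<Longrightarrow> B c x + D c x = 0"
    and left: "\<And>c x. c \<in> centres \<Longrightarrow> c - (2 * h) *\<^sub>R axis i 1 \<notin> centres \<Longrightarrow> B c x - D c x = 0"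
  shows "pairing v (\<lambda>c. partial_deriv i (\<phi> c))
     = - pairing v' \<phi>"
proof -
  have eq: "\<phi> c = (\<lambda>x. B c x + loc h c i x * D c x + (1 - (loc h c i x)\<^sup>2) * E c x)" for c
    by (rule ext) (rule \<phi>)
  have e: "elementary (\<phi> c)" for c unfolding eq by (intro elementary_intros loc_elementary el)
  have "(\<Sum>c\<in>centres. ibp i v v' c (\<phi> c)) = 0"
    unfolding eq by (rule sum_ibp_eq_0[OF v v' weak, of B D E]) (rule el match right left; assumption)+
  moreover have "(\<Sum>c\<in>centres. ibp i v v' c (\<phi> c)) =
     (\<Sum>c\<in>centres. (\<integral>x. v x * partial_deriv i (\<phi> c) x \<partial>cell_measure c) + (\<integral>x. v' x * \<phi> c x \<partial>cell_measure c))"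
    by (intro sum.cong refl ibp_eq[OF v v' weak _ e])
  ultimately show ?thesis by (simp add: sum.distrib eq_neg_iff_add_eq_0)
qed

lemma cell_quadratic_moment:
  assumes "c \<in> centres"
  shows "(\<integral>x. (A + B * loc h c k x) * (A + B * loc h c k x) \<partial>cell_measure c)
     = (A\<^sup>2 + B\<^sup>2 / 3) * (\<integral>x. 1 \<partial>cell_measure c)"
proof -
  note int = elementary_cell_integrable[of _ c]
  have i: "integrable (cell_measure c) (\<lambda>x. A\<^sup>2 * (1::real))" "integrable (cell_measure c) (\<lambda>x. 2 * A * B * loc h c k x)"
    "integrable (cell_measure c) (\<lambda>x. B\<^sup>2 * (loc h c k x)\<^sup>2)"
    by (intro int elementary_intros loc_elementary)+
  have "(\<integral>x. (A + B * loc h c k x) * (A + B * loc h c k x) \<partial>cell_measure c)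
    = (\<integral>x. (A\<^sup>2 * 1 + 2 * A * B * loc h c k x) + B\<^sup>2 * (loc h c k x)\<^sup>2 \<partial>cell_measure c)"
    by (rule Bochner_Integration.integral_cong) (simp_all add: power2_eq_square algebra_simps)
  also have "\<dots> = (\<integral>x. A\<^sup>2 * 1 \<partial>cell_measure c) + (\<integral>x. 2 * A * B * loc h c k x \<partial>cell_measure c)
      + (\<integral>x. B\<^sup>2 * (loc h c k x)\<^sup>2 \<partial>cell_measure c)"
    using Bochner_Integration.integral_add[OF Bochner_Integration.integrable_add[OF i(1,2)] i(3)]
      Bochner_Integration.integral_add[OF i(1,2)] by (simp only:)
  also have "\<dots> = (A\<^sup>2 + B\<^sup>2 / 3) * (\<integral>x. 1 \<partial>cell_measure c)"
    by (simp only: Bochner_Integration.integral_mult_right_zero elementary_cell_moments[OF assms])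
       (simp add: algebra_simps)
  finally show ?thesis .
qed

end

lemma square_sum3_le:
  fixes x y z :: real
  shows "(x + y + z)\<^sup>2 \<le> 3 * (x\<^sup>2 + y\<^sup>2 + z\<^sup>2)"
proof -
  have "3 * (x\<^sup>2 + y\<^sup>2 + z\<^sup>2) - (x + y + z)\<^sup>2 = (x - y)\<^sup>2 + (y - z)\<^sup>2 + (x - z)\<^sup>2"
    by (simp add: power2_eq_square algebra_simps)
  moreover have "0 \<le> (x - y)\<^sup>2 + (y - z)\<^sup>2 + (x - z)\<^sup>2" by simp
  ultimately show ?thesis by linarith
qed

section \<open>Integration by parts of the Hessian entries and of the interpolant\<close>

context morley_function
begin

lemma vertex_right:
  assumes "c \<in> centres" "step i c \<notin> centres"
  shows "a c + l c i = 0" "l c (nxt i) + g c (prv i) = 0" "l c (prv i) + g c (nxt i) = 0" "g c i + d c = 0"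
  using vertex_zero[OF assms(1), of 1 i] assms(2) by simp_all

lemma vertex_left:
  assumes "c \<in> centres" "c - (2 * h) *\<^sub>R axis i 1 \<notin> centres"
  shows "a c - l c i = 0" "l c (nxt i) - g c (prv i) = 0" "l c (prv i) - g c (nxt i) = 0" "g c i - d c = 0"
  using vertex_zero[OF assms(1), of "-1" i] assms(2) by simp_all

lemma vertex_neighbours:
  assumes "c \<in> centres" "step i c \<in> centres"
  shows "a c + l c i = a (step i c) - l (step i c) i"
    "l c (nxt i) + g c (prv i) = l (step i c) (nxt i) - g (step i c) (prv i)"
    "l c (prv i) + g c (nxt i) = l (step i c) (prv i) - g (step i c) (nxt i)"
    "g c i + d c = g (step i c) i - d (step i c)"
  using vertex_match[OF assms] unfolding Let_def by blast+

text \<open>\<open>mean c i\<close> depends on the \<open>i\<close>-th coordinate only and interpolates the face means of the \<open>i\<close>-th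
  partial derivative of the shape function.\<close>

definition grad :: "real^3 \<Rightarrow> 3 \<Rightarrow> real^3 \<Rightarrow> real" where
  "grad c i x = (l c i + g c (nxt i) * loc h c (prv i) x + g c (prv i) * loc h c (nxt i) x
     + d c * (loc h c (nxt i) x * loc h c (prv i) x)) / h"

definition mean :: "real^3 \<Rightarrow> 3 \<Rightarrow> real^3 \<Rightarrow> real" where
  "mean c i x = (l c i + 2 * \<alpha> c i * loc h c i x + \<beta> c i * (3 * (loc h c i x)\<^sup>2 - 1)) / h"

text \<open>Each entry is affine in a single local coordinate: the own one on the diagonal, the
  third one off it. Its cell norm is therefore given by
  \<open>cell_quadratic_moment\<close>.\<close>

definition hess :: "real^3 \<Rightarrow> 3 \<Rightarrow> 3 \<Rightarrow> real^3 \<Rightarrow> real" where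
  "hess c i j x = (if j = i then 2 * \<alpha> c i + 6 * \<beta> c i * loc h c i x
     else if j = nxt i then g c (prv i) + d c * loc h c (prv i) x
     else g c (nxt i) + d c * loc h c (nxt i) x) / h\<^sup>2"

lemma partial_deriv_q: "partial_deriv i (q c) = grad c i"
  by (rule ext) (simp add: q_def grad_def partial_deriv_trilinear)

lemma q_elementary: "elementary (q c)" and b_elementary: "elementary (b c)"
  unfolding q_def b_def by (rule trilinear_elementary bubble_elementary)+

lemma grad_elementary: "elementary (grad c i)"
  unfolding partial_deriv_q[symmetric] by (rule elementary_partial_deriv[OF q_elementary])

lemma mean_elementary: "elementary (mean c i)"
  unfolding mean_def[abs_def] by (intro elementary_intros loc_elementary)

lemma hess_elementary: "elementary (hess c i j)"
proof -
  consider "j = i" | "j = nxt i" | "j = prv i" using index_cases by blast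
  then show ?thesis
    by cases (simp_all add: hess_def[abs_def] elementary_simps)
qed

lemma partial_deriv_mean: "partial_deriv i (mean c i) x = hess c i i x"
  using partial_deriv_gradient_form(1)[of i "l c i" 0 h c 0 0 "2 * \<alpha> c i" "\<beta> c i" x]
  by (simp add: mean_def[abs_def] hess_def power2_eq_square)

lemma partial_deriv_grad:
  "partial_deriv (nxt i) (grad c i) x = hess c i (nxt i) x" "partial_deriv (prv i) (grad c i) x = hess c i (prv i) x"
  using partial_deriv_gradient_form(2,3)[of i "l c i" "g c (nxt i)" h c "g c (prv i)" "d c" 0 0 x]
  by (simp_all add: grad_def[abs_def] hess_def)

lemma partial_deriv_shape: "partial_deriv j (partial_deriv i (\<lambda>x. q c x + b c x)) x = hess c i j x"
proof -
  have pb: "partial_deriv i (b c) x = (2 * \<alpha> c i * loc h c i x + \<beta> c i * (3 * (loc h c i x)\<^sup>2 - 1)) / h" for x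
    by (simp add: b_def partial_deriv_bubble)
  have e: "partial_deriv i (\<lambda>x. q c x + b c x) = (\<lambda>x. (l c i + g c (nxt i) * loc h c (prv i) x
      + g c (prv i) * loc h c (nxt i) x + d c * (loc h c (nxt i) x * loc h c (prv i) x)
      + 2 * \<alpha> c i * loc h c i x + \<beta> c i * (3 * (loc h c i x * loc h c i x) - 1)) / h)"
    by (rule ext) (simp add: elementary_partial_deriv_rules q_elementary b_elementary partial_deriv_q grad_def
      pb power2_eq_square add_divide_distrib)
  consider "j = i" | "j = nxt i" | "j = prv i" using index_cases by blast
  then show ?thesis unfolding e
    by cases (simp_all add: partial_deriv_gradient_form hess_def)
qed

context
  fixes u :: "real^3 \<Rightarrow> real"
  assumes u: "u \<in> sobolev 4 \<Omega>"
begin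

abbreviation U :: "3 list \<Rightarrow> real^3 \<Rightarrow> real" where
  "U is \<equiv> weak_deriv \<Omega> is u"

lemma U_L2: "length is \<le> 4 \<Longrightarrow> U is \<in> L2 \<Omega>"
  by (rule sobolev_weak_deriv(2)[OF u _ open_domain])

lemma U_weak: "length is \<le> 3 \<Longrightarrow> has_weak_deriv \<Omega> [j] (U is) (U (is @ [j]))"
  by (rule has_weak_deriv_trans[of _ "is" _ u]) (auto intro!: sobolev_weak_deriv(1)[OF u _ open_domain])

text \<open>Writing \<open>3 * loc^2 - 1\<close> as \<open>2 - 3 * (1 - loc^2)\<close> splits off
  the part of \<open>mean c i\<close> without flux. The traces \<open>B + D\<close> and
  \<open>B - D\<close> of the rest are the face means, whose matching is assumed.\<close>

lemma sum_hess_diagonal: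
  "pairing (U [i, i]) (\<lambda>c. hess c i i)
     = - pairing (U [i, i, i]) (\<lambda>c. mean c i)"
proof -
  have "pairing (U [i, i]) (\<lambda>c. partial_deriv i (mean c i))
     = - pairing (U [i, i, i]) (\<lambda>c. mean c i)"
  proof (rule sum_ibp_eq[where B = "\<lambda>c _. (l c i + 2 * \<beta> c i) / h" and D = "\<lambda>c _. 2 * \<alpha> c i / h" and E = "\<lambda>c _. - 3 * \<beta> c i / h"])
    show "has_weak_deriv \<Omega> [i] (U [i, i]) (U [i, i, i])" using U_weak[of "[i, i]" i] by simp
    show "mean c i x = (l c i + 2 * \<beta> c i) / h + loc h c i x * (2 * \<alpha> c i / h) + (1 - (loc h c i x)\<^sup>2) * (- 3 * \<beta> c i / h)"
      for c x using h_pos by (simp add: mean_def field_simps)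
    show "(l c i + 2 * \<beta> c i) / h + 2 * \<alpha> c i / h = (l (step i c) i + 2 * \<beta> (step i c) i) / h
        - 2 * \<alpha> (step i c) i / h"
      if "c \<in> centres" "step i c \<in> centres" for c
    proof -
      have "l c i + 2 * \<beta> c i + 2 * \<alpha> c i = l (step i c) i + 2 * \<beta> (step i c) i
        - 2 * \<alpha> (step i c) i"
        using mean_match[OF that] unfolding Let_def by linarith
      then show ?thesis by (simp only: add_divide_distrib[symmetric] diff_divide_distrib[symmetric])
    qed
    show "(l c i + 2 * \<beta> c i) / h + 2 * \<alpha> c i / h = 0"
      if "c \<in> centres" "step i c \<notin> centres" for c
      using mean_zero[OF that(1), of 1 i] that(2) by (simp add: add_divide_distrib[symmetric] algebra_simps)
    show "(l c i + 2 * \<beta> c i) / h - 2 * \<alpha> c i / h = 0"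
      if "c \<in> centres" "c - (2 * h) *\<^sub>R axis i 1 \<notin> centres" for c
      using mean_zero[OF that(1), of "-1" i] that(2) by (simp add: diff_divide_distrib[symmetric] algebra_simps)
  qed (simp_all add: U_L2 elementary_const)
  then show ?thesis by (simp only: partial_deriv_mean)
qed

text \<open>On a face normal to \<open>j\<close> the direction \<open>i\<close> is tangential, so
  the i-th derivative of \<open>q\<close> inherits continuity from \<open>q\<close>. It is affine in
  the j-th local coordinate, hence \<open>E = 0\<close>; \<open>k\<close> is the third
  direction.\<close>

lemma sum_hess_off_diagonal:
  assumes "j \<noteq> i"
  shows "pairing (U [i, j]) (\<lambda>c. hess c i j) = - pairing (U [i, j, j]) (\<lambda>c. grad c i)"
proof -
  obtain k where k: "j = nxt i \<and> k = prv i \<or> j = prv i \<and> k = nxt i"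
    using index_cases[of j i] assms by blast
  then have ne: "k \<noteq> j" by auto
  have pd: "partial_deriv j (grad c i) x = hess c i j x" for c x
    using k by (elim disjE conjE) (simp_all only: partial_deriv_grad)
  have idx: "nxt j = k \<and> prv j = i \<or> nxt j = i \<and> prv j = k"
    using k by (elim disjE conjE) (simp_all only: nxt_prv_simps simp_thms)
  have "pairing (U [i, j]) (\<lambda>c. partial_deriv j (grad c i)) = - pairing (U [i, j, j]) (\<lambda>c. grad c i)"
  proof (rule sum_ibp_eq[where B = "\<lambda>c x. (l c i + g c j * loc h c k x) / h"
        and D = "\<lambda>c x. (g c k + d c * loc h c k x) / h" and E = "\<lambda>c _. 0"])
    show "has_weak_deriv \<Omega> [j] (U [i, j]) (U [i, j, j])" using U_weak[of "[i, j]" j] by simp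
    show "grad c i x = (l c i + g c j * loc h c k x) / h
        + loc h c j x * ((g c k + d c * loc h c k x) / h) + (1 - (loc h c j x)\<^sup>2) * 0" for c x
      using k by (elim disjE conjE) (simp_all add: grad_def add_divide_distrib algebra_simps)
    have plus: "(l c i + g c j * loc h c k x) / h + (g c k + d c * loc h c k x) / h
        = ((l c i + g c k) + (g c j + d c) * loc h c k x) / h" for c x
      by (simp add: add_divide_distrib[symmetric] algebra_simps)
    have minus: "(l c i + g c j * loc h c k x) / h - (g c k + d c * loc h c k x) / h
        = ((l c i - g c k) + (g c j - d c) * loc h c k x) / h" for c x
      by (simp add: diff_divide_distrib[symmetric] algebra_simps)
    show "(l c i + g c j * loc h c k x) / h + (g c k + d c * loc h c k x) / h =
      (l (step j c) i + g (step j c) j * loc h (step j c) k x) / h -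
      (g (step j c) k + d (step j c) * loc h (step j c) k x) / h"
      if "c \<in> centres" "step j c \<in> centres" for c x
    proof -
      have "l c i + g c k = l (step j c) i - g (step j c) k"
        using idx vertex_neighbours(2,3)[OF that] by (elim disjE conjE) (simp_all only:)
      moreover note vertex_neighbours(4)[OF that]
      ultimately show ?thesis unfolding plus minus by (simp only: loc_shift[OF ne])
    qed
    show "(l c i + g c j * loc h c k x) / h + (g c k + d c * loc h c k x) / h = 0"
      if "c \<in> centres" "step j c \<notin> centres" for c x
    proof -
      have "l c i + g c k = 0"
        using idx vertex_right(2,3)[OF that] by (elim disjE conjE) (simp_all only:)
      then show ?thesis unfolding plus vertex_right(4)[OF that] by simp
    qed
    show "(l c i + g c j * loc h c k x) / h - (g c k + d c * loc h c k x) / h = 0"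
      if "c \<in> centres" "c - (2 * h) *\<^sub>R axis j 1 \<notin> centres" for c x
    proof -
      have "l c i - g c k = 0"
        using idx vertex_left(2,3)[OF that] by (elim disjE conjE) (simp_all only:)
      then show ?thesis unfolding minus vertex_left(4)[OF that] by simp
    qed
  qed (simp_all add: U_L2 elementary_simps)
  then show ?thesis by (simp only: pd)
qed

text \<open>The traces of \<open>q\<close> on faces normal to \<open>i\<close> are the bilinear
  interpolants of the vertex values, which match across cells; \<open>q\<close> is affine in the
  i-th local coordinate, hence \<open>E = 0\<close>.\<close>

lemma sum_grad:
  "pairing (U [i, j, j]) (\<lambda>c. grad c i)
     = - pairing (U [i, j, j, i]) q"
proof -
  define B where "B c x = a c + l c (nxt i) * loc h c (nxt i) x + l c (prv i) * loc h c (prv i) x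
      + g c i * (loc h c (nxt i) x * loc h c (prv i) x)" for c x
  define D where "D c x = l c i + g c (prv i) * loc h c (nxt i) x + g c (nxt i) * loc h c (prv i) x
      + d c * (loc h c (nxt i) x * loc h c (prv i) x)" for c x
  have "pairing (U [i, j, j]) (\<lambda>c. partial_deriv i (q c))
     = - pairing (U [i, j, j, i]) q"
  proof (rule sum_ibp_eq[where B = B and D = D and E = "\<lambda>c _. 0"])
    show "has_weak_deriv \<Omega> [i] (U [i, j, j]) (U [i, j, j, i])" using U_weak[of "[i, j, j]" i] by simp
    show "q c x = B c x + loc h c i x * D c x + (1 - (loc h c i x)\<^sup>2) * 0" for c x
      unfolding q_def trilinear_eq[where i = i] B_def D_def by (simp add: algebra_simps)
    show "elementary (B c)" "elementary (D c)" for c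
      unfolding B_def[abs_def] D_def[abs_def] by (simp_all add: elementary_simps)
    have plus: "B c x + D c x = (a c + l c i) + (l c (nxt i) + g c (prv i)) * loc h c (nxt i) x
        + (l c (prv i) + g c (nxt i)) * loc h c (prv i) x + (g c i + d c) * (loc h c (nxt i) x * loc h c (prv i) x)" for c x
      unfolding B_def D_def by (simp add: algebra_simps)
    have minus: "B c x - D c x = (a c - l c i) + (l c (nxt i) - g c (prv i)) * loc h c (nxt i) x
        + (l c (prv i) - g c (nxt i)) * loc h c (prv i) x + (g c i - d c) * (loc h c (nxt i) x * loc h c (prv i) x)" for c x
      unfolding B_def D_def by (simp add: algebra_simps)
    show "B c x + D c x = B (step i c) x - D (step i c) x"
      if "c \<in> centres" "step i c \<in> centres" for c x
      unfolding plus minus vertex_neighbours[OF that] loc_shift[OF nxt_prv_neq(1)] loc_shift[OF nxt_prv_neq(2)] ..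
    show "B c x + D c x = 0" if "c \<in> centres" "step i c \<notin> centres" for c x
      unfolding plus vertex_right[OF that] by simp
    show "B c x - D c x = 0" if "c \<in> centres" "c - (2 * h) *\<^sub>R axis i 1 \<notin> centres" for c x
      unfolding minus vertex_left[OF that] by simp
  qed (simp_all add: U_L2 elementary_const)
  then show ?thesis by (simp only: partial_deriv_q)
qed

end

end

context morley_function
begin

text \<open>The vector field \<open>corr c i\<close> exhibits \<open>grad c i - mean c i\<close> as a divergence; its \<open>k\<close>-th component
  vanishes on the two faces of the cell with normal direction \<open>k\<close>.\<close>

definition corr_factor :: "real^3 \<Rightarrow> 3 \<Rightarrow> 3 \<Rightarrow> real^3 \<Rightarrow> real" where
  "corr_factor c i k x = (if k = i then \<alpha> c i + \<beta> c i * loc h c i x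
     else if k = nxt i then - g c (prv i) / 2 + (- d c / 2) * loc h c (prv i) x else - g c (nxt i) / 2)"

definition corr :: "real^3 \<Rightarrow> 3 \<Rightarrow> 3 \<Rightarrow> real^3 \<Rightarrow> real" where
  "corr c i k x = (1 - (loc h c k x)\<^sup>2) * corr_factor c i k x"

lemma corr_factor_simps:
  "corr_factor c i i = (\<lambda>x. \<alpha> c i + \<beta> c i * loc h c i x)"
  "corr_factor c i (nxt i) = (\<lambda>x. - g c (prv i) / 2 + (- d c / 2) * loc h c (prv i) x)"
  "corr_factor c i (prv i) = (\<lambda>_. - g c (nxt i) / 2)"
  by (rule ext, simp add: corr_factor_def)+

lemma corr_factor_elementary: "elementary (corr_factor c i k)"
proof -
  consider "k = i" | "k = nxt i" | "k = prv i" using index_cases by blast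
  then show ?thesis by cases (simp_all only: corr_factor_simps elementary_simps)
qed

lemma corr_elementary: "elementary (corr c i k)"
  unfolding corr_def[abs_def] by (intro elementary_intros loc_elementary corr_factor_elementary)

lemma partial_deriv_corr:
  "partial_deriv k (corr c i k) x =
     (1 - (loc h c k x)\<^sup>2) * partial_deriv k (corr_factor c i k) x - 2 * loc h c k x / h * corr_factor c i k x"
proof -
  have "corr c i k = (\<lambda>x. (1 - loc h c k x * loc h c k x) * corr_factor c i k x)"
    by (rule ext) (simp add: corr_def power2_eq_square)
  then show ?thesis
    by (simp add: elementary_partial_deriv_rules elementary_simps corr_factor_elementary power2_eq_square
        corr_factor_elementary)
qed

text \<open>The constant \<open>l c i\<close> cancels. The terms in the i-th coordinate alone are
  derivatives of the bubbles \<open>1 - loc^2\<close> and \<open>(1 - loc^2) * loc\<close>. Every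
  other term is linear in a tangential coordinate; the mixed product is assigned to direction
  \<open>nxt i\<close>.\<close>

lemma sum_partial_deriv_corr:
  "(\<Sum>k\<in>UNIV. partial_deriv k (corr c i k) x) = grad c i x - mean c i x"
proof -
  have 1: "partial_deriv i (corr c i i) x = - (2 * \<alpha> c i * loc h c i x + \<beta> c i * (3 * (loc h c i x)\<^sup>2 - 1)) / h"
    unfolding partial_deriv_corr corr_factor_simps using h_pos
    by (simp add: elementary_partial_deriv_rules elementary_simps field_simps power2_eq_square)
  have 2: "partial_deriv (nxt i) (corr c i (nxt i)) x = (g c (prv i) + d c * loc h c (prv i) x) * loc h c (nxt i) x / h"
    unfolding partial_deriv_corr corr_factor_simps using h_pos
    by (simp add: elementary_partial_deriv_rules elementary_simps field_simps)
  have 3: "partial_deriv (prv i) (corr c i (prv i)) x = g c (nxt i) * loc h c (prv i) x / h"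
    unfolding partial_deriv_corr corr_factor_simps using h_pos
    by (simp add: elementary_partial_deriv_rules elementary_simps field_simps)
  show ?thesis
    unfolding sum_nxt_prv[of _ i] 1 2 3 grad_def mean_def
    by (simp add: add_divide_distrib diff_divide_distrib algebra_simps)
qed

text \<open>Contains exactly the coefficients visible in the Hessian: \<open>a\<close> and
  \<open>l\<close> describe the affine part and are left out.\<close>

definition coef_size :: "real^3 \<Rightarrow> real" where
  "coef_size c = \<bar>d c\<bar> + (\<Sum>k\<in>UNIV. \<bar>g c k\<bar> + \<bar>\<alpha> c k\<bar> + \<bar>\<beta> c k\<bar>)"

lemma coef_size_ge: "\<bar>d c\<bar> + (\<bar>g c k\<bar> + \<bar>\<alpha> c k\<bar> + \<bar>\<beta> c k\<bar>) \<le> coef_size c"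
  unfolding coef_size_def by (rule add_left_mono, rule member_le_sum) simp_all

lemma corr_bound:
  assumes "x \<in> interior (cube h c)"
  shows "\<bar>corr c i k x\<bar> \<le> coef_size c"
proof -
  have xi: "\<bar>loc h c j x\<bar> \<le> 1" for j by (rule abs_loc_le_1[OF assms h_pos])
  have mult: "\<bar>A * loc h c j x\<bar> \<le> \<bar>A\<bar>" for A j
    unfolding abs_mult by (rule mult_left_le[OF xi abs_ge_zero])
  have f: "\<bar>corr_factor c i k x\<bar> \<le> coef_size c"
  proof -
    consider "k = i" | "k = nxt i" | "k = prv i" using index_cases by blast
    then show ?thesis
    proof cases
      case 1
      have "\<bar>\<alpha> c i + \<beta> c i * loc h c i x\<bar> \<le> \<bar>\<alpha> c i\<bar> + \<bar>\<beta> c i\<bar>"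
        by (rule order_trans[OF abs_triangle_ineq add_left_mono[OF mult]])
      also have "\<dots> \<le> \<bar>d c\<bar> + (\<bar>g c i\<bar> + \<bar>\<alpha> c i\<bar> + \<bar>\<beta> c i\<bar>)" by simp
      also have "\<dots> \<le> coef_size c" by (rule coef_size_ge)
      finally show ?thesis by (simp only: 1 corr_factor_simps)
    next
      case 2
      have "\<bar>- g c (prv i) / 2 + (- d c / 2) * loc h c (prv i) x\<bar> \<le> \<bar>- g c (prv i) / 2\<bar> + \<bar>- d c / 2\<bar>"
        by (rule order_trans[OF abs_triangle_ineq add_left_mono[OF mult]])
      also have "\<dots> \<le> \<bar>d c\<bar> + (\<bar>g c (prv i)\<bar> + \<bar>\<alpha> c (prv i)\<bar> + \<bar>\<beta> c (prv i)\<bar>)" by simp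
      also have "\<dots> \<le> coef_size c" by (rule coef_size_ge)
      finally show ?thesis by (simp only: 2 corr_factor_simps)
    next
      case 3
      have "\<bar>- g c (nxt i) / 2\<bar> \<le> \<bar>d c\<bar> + (\<bar>g c (nxt i)\<bar> + \<bar>\<alpha> c (nxt i)\<bar> + \<bar>\<beta> c (nxt i)\<bar>)" by simp
      also have "\<dots> \<le> coef_size c" by (rule coef_size_ge)
      finally show ?thesis by (simp only: 3 corr_factor_simps)
    qed
  qed
  have "(loc h c k x)\<^sup>2 \<le> 1" by (rule abs_square_le_1[THEN iffD2, OF xi])
  moreover have "0 \<le> (loc h c k x)\<^sup>2" by (rule zero_le_power2)
  ultimately have "\<bar>1 - (loc h c k x)\<^sup>2\<bar> \<le> 1" by linarith
  then have "\<bar>1 - (loc h c k x)\<^sup>2\<bar> * \<bar>corr_factor c i k x\<bar> \<le> 1 * coef_size c"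
    by (rule mult_mono[OF _ f]) simp_all
  then show ?thesis by (simp only: corr_def abs_mult mult_1_left)
qed

lemma b_bound:
  assumes "x \<in> interior (cube h c)"
  shows "\<bar>b c x\<bar> \<le> coef_size c"
proof -
  have t: "\<bar>\<alpha> c k * ((loc h c k x)\<^sup>2 - 1) + \<beta> c k * ((loc h c k x) ^ 3 - loc h c k x)\<bar> \<le> \<bar>g c k\<bar> + \<bar>\<alpha> c k\<bar> + \<bar>\<beta> c k\<bar>" for k
  proof -
    have xi: "\<bar>loc h c k x\<bar> \<le> 1" by (rule abs_loc_le_1[OF assms h_pos])
    have "(loc h c k x)\<^sup>2 \<le> 1" by (rule abs_square_le_1[THEN iffD2, OF xi])
    moreover have "0 \<le> (loc h c k x)\<^sup>2" by (rule zero_le_power2)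
    ultimately have 1: "\<bar>(loc h c k x)\<^sup>2 - 1\<bar> \<le> 1" by linarith
    have "(loc h c k x) ^ 3 - loc h c k x = loc h c k x * ((loc h c k x)\<^sup>2 - 1)"
      by (simp add: algebra_simps power2_eq_square power3_eq_cube)
    then have "\<bar>(loc h c k x) ^ 3 - loc h c k x\<bar> = \<bar>loc h c k x\<bar> * \<bar>(loc h c k x)\<^sup>2 - 1\<bar>"
      by (simp only: abs_mult)
    also have "\<dots> \<le> 1 * 1" by (rule mult_mono[OF xi 1]) simp_all
    finally have 2: "\<bar>(loc h c k x) ^ 3 - loc h c k x\<bar> \<le> 1" by simp
    have "\<bar>\<alpha> c k * ((loc h c k x)\<^sup>2 - 1) + \<beta> c k * ((loc h c k x) ^ 3 - loc h c k x)\<bar>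
        \<le> \<bar>\<alpha> c k\<bar> * \<bar>(loc h c k x)\<^sup>2 - 1\<bar> + \<bar>\<beta> c k\<bar> * \<bar>(loc h c k x) ^ 3 - loc h c k x\<bar>"
      unfolding abs_mult[symmetric] by (rule abs_triangle_ineq)
    also have "\<dots> \<le> \<bar>\<alpha> c k\<bar> + \<bar>\<beta> c k\<bar>"
      by (intro add_mono mult_left_le 1 2 abs_ge_zero)
    also have "\<dots> \<le> \<bar>g c k\<bar> + \<bar>\<alpha> c k\<bar> + \<bar>\<beta> c k\<bar>" by simp
    finally show ?thesis .
  qed
  have "\<bar>b c x\<bar> \<le> (\<Sum>k\<in>UNIV. \<bar>g c k\<bar> + \<bar>\<alpha> c k\<bar> + \<bar>\<beta> c k\<bar>)"
    unfolding b_def bubble_def by (rule order_trans[OF sum_abs sum_mono[OF t]])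
  then show ?thesis by (simp add: coef_size_def)
qed

text \<open>The squared cell norms of the Hessian entries are sums of squares of the coefficients
  with positive weights, times the volume divided by \<open>h^4\<close>. Comparing with
  \<open>X\<close>, the plain sum of squares, gives the factor 18 on one side and 2 on the other,
  hence 9.\<close>

lemma coef_size_le_hess:
  assumes "c \<in> centres"
  shows "(coef_size c)\<^sup>2 * (\<integral>x. 1 \<partial>cell_measure c)
    \<le> 9 * h ^ 4 * (\<Sum>i\<in>UNIV. \<Sum>j\<in>UNIV. \<integral>x. hess c i j x * hess c i j x \<partial>cell_measure c)"
proof -
  define V where "V = (\<integral>x. (1::real) \<partial>cell_measure c)"
  have V: "0 \<le> V" unfolding V_def by (rule integral_nonneg_AE) simp
  have sq: "(\<integral>x. (A + B * loc h c k x) / h\<^sup>2 * ((A + B * loc h c k x) / h\<^sup>2) \<partial>cell_measure c) = (A\<^sup>2 + B\<^sup>2 / 3) * V / h ^ 4"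
    for A B k
  proof -
    have "(\<integral>x. (A + B * loc h c k x) / h\<^sup>2 * ((A + B * loc h c k x) / h\<^sup>2) \<partial>cell_measure c)
      = (\<integral>x. (A + B * loc h c k x) * (A + B * loc h c k x) / h ^ 4 \<partial>cell_measure c)"
      by (rule Bochner_Integration.integral_cong) (simp_all add: power4_eq_xxxx power2_eq_square)
    then show ?thesis
      by (simp only: Bochner_Integration.integral_divide_zero cell_quadratic_moment[OF assms] V_def)
  qed
  have H: "hess c i i = (\<lambda>x. (2 * \<alpha> c i + (6 * \<beta> c i) * loc h c i x) / h\<^sup>2)"
    "hess c i (nxt i) = (\<lambda>x. (g c (prv i) + d c * loc h c (prv i) x) / h\<^sup>2)"
    "hess c i (prv i) = (\<lambda>x. (g c (nxt i) + d c * loc h c (nxt i) x) / h\<^sup>2)" for i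
    by (rule ext, simp add: hess_def)+
  \<comment> \<open>From \<open>A^2 + B^2 / 3\<close>: the weight 12 is \<open>6^2 / 3\<close>, and
    \<open>d c\<close> contributes one third in each of the two off-diagonal entries.\<close>
  have row: "(\<Sum>j\<in>UNIV. \<integral>x. hess c i j x * hess c i j x \<partial>cell_measure c)
      = (4 * (\<alpha> c i)\<^sup>2 + 12 * (\<beta> c i)\<^sup>2 + (g c (prv i))\<^sup>2 + (g c (nxt i))\<^sup>2 + 2 / 3 * (d c)\<^sup>2) * V / h ^ 4" for i
    unfolding sum_nxt_prv[of _ i] H sq using h_pos by (simp add: field_simps)
  have pn: "nxt 1 = 2" "nxt 2 = 3" "nxt 3 = 1" "prv 1 = 3" "prv 2 = 1" "prv 3 = 2"
    by (simp_all add: nxt_def prv_def)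
  define X where "X = (d c)\<^sup>2 + ((g c 1)\<^sup>2 + (\<alpha> c 1)\<^sup>2 + (\<beta> c 1)\<^sup>2) + ((g c 2)\<^sup>2 + (\<alpha> c 2)\<^sup>2 + (\<beta> c 2)\<^sup>2)
      + ((g c 3)\<^sup>2 + (\<alpha> c 3)\<^sup>2 + (\<beta> c 3)\<^sup>2)"
  define Y where "Y = (\<Sum>i\<in>UNIV. 4 * (\<alpha> c i)\<^sup>2 + 12 * (\<beta> c i)\<^sup>2 + (g c (prv i))\<^sup>2 + (g c (nxt i))\<^sup>2 + 2 / 3 * (d c)\<^sup>2)"
  \<comment> \<open>Over the three rows each square of \<open>g\<close> occurs twice and that of
    \<open>d c\<close> three times with weight \<open>2 / 3\<close>, so these terms cancel
    exactly.\<close>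
  have "Y - 2 * X = 2 * (\<alpha> c 1)\<^sup>2 + 2 * (\<alpha> c 2)\<^sup>2 + 2 * (\<alpha> c 3)\<^sup>2 + 10 * (\<beta> c 1)\<^sup>2 + 10 * (\<beta> c 2)\<^sup>2 + 10 * (\<beta> c 3)\<^sup>2"
    unfolding X_def Y_def sum_3 pn by simp
  moreover have "0 \<le> \<dots>" by simp
  ultimately have XY: "2 * X \<le> Y" by linarith
  have "(coef_size c)\<^sup>2 \<le> 18 * X"
  proof -
    define t where "t k = \<bar>g c k\<bar> + \<bar>\<alpha> c k\<bar> + \<bar>\<beta> c k\<bar>" for k
    define z where "z k = (g c k)\<^sup>2 + (\<alpha> c k)\<^sup>2 + (\<beta> c k)\<^sup>2" for k
    define T where "T = (\<Sum>k\<in>UNIV. t k)"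
    \<comment> \<open>The factor 18 is \<open>2 * 3 * 3\<close>: \<open>coef_size\<close> is split
      into \<open>\<bar>d c\<bar>\<close> and \<open>T\<close>, \<open>T\<close> into three terms
      \<open>t k\<close>, and each of these into three coefficients.\<close>
    have sq: "(y + r)\<^sup>2 \<le> 2 * y\<^sup>2 + 2 * r\<^sup>2" for y r :: real
      using zero_le_power2[of "y - r"] unfolding power2_sum power2_diff by linarith
    have "(t k)\<^sup>2 \<le> 3 * z k" for k
      using square_sum3_le[of "\<bar>g c k\<bar>" "\<bar>\<alpha> c k\<bar>" "\<bar>\<beta> c k\<bar>"] by (simp add: t_def z_def)
    then have "(\<Sum>k\<in>UNIV. (t k)\<^sup>2) \<le> 3 * (\<Sum>k\<in>UNIV. z k)"
      unfolding sum_distrib_left by (rule sum_mono)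
    moreover have "T\<^sup>2 \<le> 3 * (\<Sum>k\<in>UNIV. (t k)\<^sup>2)"
      unfolding T_def sum_3 by (rule square_sum3_le)
    ultimately have T2: "2 * T\<^sup>2 \<le> 18 * (\<Sum>k\<in>UNIV. z k)" by linarith
    have "(coef_size c)\<^sup>2 \<le> 2 * (d c)\<^sup>2 + 2 * T\<^sup>2"
      using sq[of "\<bar>d c\<bar>" T] by (simp add: coef_size_def T_def t_def)
    also have "\<dots> \<le> 18 * (d c)\<^sup>2 + 18 * (\<Sum>k\<in>UNIV. z k)"
      by (rule add_mono[OF _ T2]) simp
    also have "\<dots> = 18 * X" by (simp add: X_def z_def sum_3)
    finally show ?thesis .
  qed
  then have "(coef_size c)\<^sup>2 \<le> 9 * Y" using XY by linarith
  then have "(coef_size c)\<^sup>2 * V \<le> 9 * Y * V" using V by (rule mult_right_mono)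
  also have "9 * Y * V = 9 * h ^ 4 * (\<Sum>i\<in>UNIV. \<Sum>j\<in>UNIV. \<integral>x. hess c i j x * hess c i j x \<partial>cell_measure c)"
    unfolding row Y_def using h_pos by (simp add: sum_distrib_right sum_divide_distrib[symmetric])
  finally show ?thesis unfolding V_def .
qed

lemma sum_coef_size_le:
  fixes w :: "real^3 \<Rightarrow> real"
  assumes "\<And>c. c \<in> centres \<Longrightarrow> hessian_form (interior (cube h c)) w w
      = (\<Sum>i\<in>UNIV. \<Sum>j\<in>UNIV. \<integral>x. hess c i j x * hess c i j x \<partial>cell_measure c)"
  shows "sqrt (\<Sum>c\<in>centres. (coef_size c)\<^sup>2 * (\<integral>x. 1 \<partial>cell_measure c)) \<le> 3 * h\<^sup>2 * broken_seminorm \<T> w"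
proof -
  have "(\<Sum>c\<in>centres. (coef_size c)\<^sup>2 * (\<integral>x. 1 \<partial>cell_measure c))
    \<le> (\<Sum>c\<in>centres. 9 * h ^ 4 * hessian_form (interior (cube h c)) w w)"
    by (rule sum_mono) (simp only: assms coef_size_le_hess)
  also have "\<dots> = 9 * (h ^ 4 * broken_form \<T> w w)"
    unfolding broken_form_def sum_cells by (simp add: sum_distrib_left mult.assoc)
  finally have "sqrt (\<Sum>c\<in>centres. (coef_size c)\<^sup>2 * (\<integral>x. 1 \<partial>cell_measure c))
      \<le> sqrt (9 * (h ^ 4 * broken_form \<T> w w))" by (rule real_sqrt_le_mono)
  also have "\<dots> = 3 * h\<^sup>2 * broken_seminorm \<T> w"
  proof -
    have "h ^ 4 = (h\<^sup>2)\<^sup>2" by simp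
    then have "sqrt (h ^ 4) = h\<^sup>2" by (simp only: real_sqrt_abs abs_power2)
    then show ?thesis by (simp add: broken_seminorm_def real_sqrt_mult)
  qed
  finally show ?thesis .
qed

context
  fixes u f :: "real^3 \<Rightarrow> real"
  assumes u: "u \<in> sobolev 4 \<Omega>" and f: "f \<in> L2 \<Omega>"
    and strong: "AE x in lebesgue_on \<Omega>. f x = (\<Sum>i\<in>UNIV. \<Sum>j\<in>UNIV. weak_deriv \<Omega> [i, j, j, i] u x)"
begin

abbreviation D :: "3 list \<Rightarrow> real^3 \<Rightarrow> real" where
  "D is \<equiv> weak_deriv \<Omega> is u"

text \<open>Every component of \<open>corr\<close> is a bubble in its own direction, so the extra
  integration by parts is carried out on each cell separately without any flux.\<close>

lemma cell_corr:
  assumes c: "c \<in> centres"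
  shows "(\<integral>x. D [i, i, i] x * grad c i x \<partial>cell_measure c) - (\<integral>x. D [i, i, i] x * mean c i x \<partial>cell_measure c)
    = - (\<Sum>k\<in>UNIV. \<integral>x. D [i, i, i, k] x * corr c i k x \<partial>cell_measure c)"
proof -
  have L: "D [i, i, i] \<in> L2 \<Omega>" "D [i, i, i, k] \<in> L2 \<Omega>" for k by (auto intro: U_L2[OF u])
  have "(\<integral>x. D [i, i, i] x * grad c i x \<partial>cell_measure c) - (\<integral>x. D [i, i, i] x * mean c i x \<partial>cell_measure c)
    = (\<integral>x. D [i, i, i] x * grad c i x - D [i, i, i] x * mean c i x \<partial>cell_measure c)"
    by (rule Bochner_Integration.integral_diff[symmetric])
       (rule cell_integrable[OF L(1) c grad_elementary] cell_integrable[OF L(1) c mean_elementary])+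
  also have "\<dots> = (\<integral>x. (\<Sum>k\<in>UNIV. D [i, i, i] x * partial_deriv k (corr c i k) x) \<partial>cell_measure c)"
    by (rule Bochner_Integration.integral_cong)
       (simp_all only: sum_distrib_left[symmetric] sum_partial_deriv_corr right_diff_distrib)
  also have "\<dots> = (\<Sum>k\<in>UNIV. \<integral>x. D [i, i, i] x * partial_deriv k (corr c i k) x \<partial>cell_measure c)"
    by (rule Bochner_Integration.integral_sum)
       (rule cell_integrable[OF L(1) c elementary_partial_deriv[OF corr_elementary]])
  also have "\<dots> = (\<Sum>k\<in>UNIV. - (\<integral>x. D [i, i, i, k] x * corr c i k x \<partial>cell_measure c))"
  proof (rule sum.cong[OF refl])
    fix k
    have W: "has_weak_deriv \<Omega> [k] (D [i, i, i]) (D [i, i, i, k])" using U_weak[OF u, of "[i, i, i]" k] by simp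
    have "ibp k (D [i, i, i]) (D [i, i, i, k]) c (corr c i k) = 0"
      unfolding corr_def[abs_def] by (rule ibp_bubble[OF L(1) L(2) W c corr_factor_elementary])
    then show "(\<integral>x. D [i, i, i] x * partial_deriv k (corr c i k) x \<partial>cell_measure c)
        = - (\<integral>x. D [i, i, i, k] x * corr c i k x \<partial>cell_measure c)"
      unfolding ibp_eq[OF L(1) L(2) W c corr_elementary] by (simp add: eq_neg_iff_add_eq_0)
  qed
  finally show ?thesis by (simp only: sum_negf)
qed

text \<open>The strong form is applied to the interpolant only, because \<open>q\<close> has the
  continuity that integration by parts requires. The load of \<open>b\<close> is left as it stands,
  being already of order \<open>h^2\<close>.\<close>

lemma sum_load_q:
  "pairing f q
    = (\<Sum>i\<in>UNIV. \<Sum>j\<in>UNIV. pairing (D [i, j, j, i]) q)"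
proof -
  have L: "D [i, j, j, i] \<in> L2 \<Omega>" for i j by (auto intro: U_L2[OF u])
  have "(\<integral>x. f x * q c x \<partial>cell_measure c)
      = (\<Sum>i\<in>UNIV. \<Sum>j\<in>UNIV. \<integral>x. D [i, j, j, i] x * q c x \<partial>cell_measure c)" if c: "c \<in> centres" for c
  proof -
    have int: "integrable (cell_measure c) (\<lambda>x. D [i, j, j, i] x * q c x)" for i j
      by (rule cell_integrable[OF L c q_elementary])
    have int': "integrable (cell_measure c) (\<lambda>x. \<Sum>i\<in>UNIV. \<Sum>j\<in>UNIV. D [i, j, j, i] x * q c x)"
      by (intro Bochner_Integration.integrable_sum int)
    have "AE x in lebesgue. x \<in> \<Omega> \<longrightarrow> f x = (\<Sum>i\<in>UNIV. \<Sum>j\<in>UNIV. D [i, j, j, i] x)"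
      using strong by (simp only: lebesgue_on_AE_iff[OF open_sets_lebesgue[OF open_domain]])
    then have "AE x in lebesgue. x \<in> interior (cube h c) \<longrightarrow> f x * q c x = (\<Sum>i\<in>UNIV. \<Sum>j\<in>UNIV. D [i, j, j, i] x * q c x)"
    proof eventually_elim
      case (elim x)
      show ?case
      proof
        assume "x \<in> interior (cube h c)"
        then have "x \<in> \<Omega>" using centre_interior[OF c] by blast
        with elim show "f x * q c x = (\<Sum>i\<in>UNIV. \<Sum>j\<in>UNIV. D [i, j, j, i] x * q c x)"
          by (simp add: sum_distrib_right)
      qed
    qed
    then have "AE x in cell_measure c. f x * q c x = (\<Sum>i\<in>UNIV. \<Sum>j\<in>UNIV. D [i, j, j, i] x * q c x)"
      by (simp only: lebesgue_on_AE_iff[OF open_sets_lebesgue[OF open_interior]])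
    then have "(\<integral>x. f x * q c x \<partial>cell_measure c) = (\<integral>x. (\<Sum>i\<in>UNIV. \<Sum>j\<in>UNIV. D [i, j, j, i] x * q c x) \<partial>cell_measure c)"
      by (rule integral_cong_AE[OF borel_measurable_integrable[OF cell_integrable[OF f c q_elementary]]
          borel_measurable_integrable[OF int']])
    also have "\<dots> = (\<Sum>i\<in>UNIV. \<integral>x. (\<Sum>j\<in>UNIV. D [i, j, j, i] x * q c x) \<partial>cell_measure c)"
      by (rule Bochner_Integration.integral_sum) (intro Bochner_Integration.integrable_sum int)
    also have "\<dots> = (\<Sum>i\<in>UNIV. \<Sum>j\<in>UNIV. \<integral>x. D [i, j, j, i] x * q c x \<partial>cell_measure c)"
      by (intro sum.cong refl Bochner_Integration.integral_sum int)
    finally show ?thesis .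
  qed
  then have "pairing f q
    = (\<Sum>c\<in>centres. \<Sum>i\<in>UNIV. \<Sum>j\<in>UNIV. \<integral>x. D [i, j, j, i] x * q c x \<partial>cell_measure c)"
    by (rule sum.cong[OF refl])
  also have "\<dots> = (\<Sum>i\<in>UNIV. \<Sum>c\<in>centres. \<Sum>j\<in>UNIV. \<integral>x. D [i, j, j, i] x * q c x \<partial>cell_measure c)"
    by (rule sum.swap)
  also have "\<dots> = (\<Sum>i\<in>UNIV. \<Sum>j\<in>UNIV. pairing (D [i, j, j, i]) q)"
    by (rule sum.cong[OF refl]) (rule sum.swap)
  finally show ?thesis .
qed

text \<open>Row \<open>i\<close> of the Hessian form gives \<open>- M i\<close> and
  \<open>- G i j\<close> for \<open>j \<noteq> i\<close>, while row \<open>i\<close> of the load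
  gives \<open>- G i j\<close> for all \<open>j\<close>. The off-diagonal terms cancel, and
  \<open>cell_corr\<close> treats the rest \<open>G i i - M i\<close>.\<close>

lemma consistency_identity:
  "(\<Sum>i\<in>UNIV. \<Sum>j\<in>UNIV. pairing (D [i, j]) (\<lambda>c. hess c i j))
     - pairing f q
   = - (\<Sum>i\<in>UNIV. \<Sum>k\<in>UNIV. pairing (D [i, i, i, k]) (\<lambda>c. corr c i k))"
proof -
  define G where "G i j = pairing (D [i, j, j]) (\<lambda>c. grad c i)" for i j
  define M where "M i = pairing (D [i, i, i]) (\<lambda>c. mean c i)" for i
  have H: "(\<Sum>j\<in>UNIV. pairing (D [i, j]) (\<lambda>c. hess c i j)) = - M i - G i (nxt i) - G i (prv i)" for i
    unfolding sum_nxt_prv[of _ i] G_def M_def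
    by (simp only: sum_hess_diagonal[OF u] sum_hess_off_diagonal[OF u nxt_prv_neq(1)]
        sum_hess_off_diagonal[OF u nxt_prv_neq(2)])
  have Q: "(\<Sum>j\<in>UNIV. pairing (D [i, j, j, i]) q) = - G i i - G i (nxt i) - G i (prv i)" for i
    unfolding sum_nxt_prv[of _ i] G_def sum_grad[OF u] by simp
  have C: "(\<Sum>k\<in>UNIV. pairing (D [i, i, i, k]) (\<lambda>c. corr c i k)) = M i - G i i" for i
  proof -
    have "G i i - M i = (\<Sum>c\<in>centres. - (\<Sum>k\<in>UNIV. \<integral>x. D [i, i, i, k] x * corr c i k x \<partial>cell_measure c))"
      unfolding G_def M_def sum_subtractf[symmetric] by (rule sum.cong[OF refl]) (rule cell_corr)
    also have "\<dots> = - (\<Sum>k\<in>UNIV. pairing (D [i, i, i, k]) (\<lambda>c. corr c i k))"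
      unfolding sum_negf by (subst sum.swap) (rule refl)
    finally show ?thesis by simp
  qed
  show ?thesis
    unfolding sum_load_q H Q C by (simp add: sum_subtractf[symmetric] sum_negf[symmetric])
qed

text \<open>Each of the nine pairings with \<open>corr\<close> is at most \<open>s4 * W\<close> and
  the bubble load at most \<open>L2_norm \<Omega> f * W\<close>. With \<open>W\<close> bounded by
  \<open>3 * h^2\<close> times the broken seminorm this gives 27.\<close>

theorem consistency_error:
  assumes w: "w \<in> L2 \<Omega>" and shape: "\<And>c. c \<in> centres \<Longrightarrow> AE x in cell_measure c. w x = q c x + b c x"
  shows "broken_form \<T> u w - L2_inner \<Omega> f w
    \<le> 27 * h\<^sup>2 * (L2_norm \<Omega> f + sobolev_seminorm 4 \<Omega> u) * broken_seminorm \<T> w"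
proof -
  have cell_sets: "interior (cube h c) \<in> sets lebesgue" for c :: "real^3"
    by (rule open_sets_lebesgue[OF open_interior])
  have wd_u: "AE x in cell_measure c. weak_deriv (interior (cube h c)) [i, j] u x = D [i, j] x" if c: "c \<in> centres" for c i j
    by (rule weak_deriv_AE[OF open_interior has_weak_deriv_subset[OF _ centre_interior[OF c] open_interior open_domain]])
       (rule sobolev_weak_deriv(1)[OF u _ open_domain], simp)
  have wd_w: "AE x in cell_measure c. weak_deriv (interior (cube h c)) [i, j] w x = hess c i j x" if c: "c \<in> centres" for c i j
  proof -
    have "partial_derivs (rev [i, j]) (\<lambda>x. q c x + b c x) = hess c i j"
      by (rule ext) (simp add: partial_deriv_shape)
    moreover have "smooth (\<lambda>x. q c x + b c x)"
      by (rule elementary_smooth[OF elementary_add[OF q_elementary b_elementary]])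
    ultimately have "has_weak_deriv (interior (cube h c)) [i, j] (\<lambda>x. q c x + b c x) (hess c i j)"
      using has_weak_deriv_smooth[OF _ open_interior, of "\<lambda>x. q c x + b c x" "cube h c" "[i, j]"] by metis
    from has_weak_deriv_cong_AE[OF this open_interior bounded_cell L2_cell[OF w c] shape[OF c]]
    show ?thesis by (rule weak_deriv_AE[OF open_interior])
  qed
  have DL: "D [i, j] \<in> L2 (interior (cube h c))" if "c \<in> centres" for c i j
    by (rule L2_cell[OF _ that]) (rule U_L2[OF u], simp)
  have HL: "hess c i j \<in> L2 (interior (cube h c))" for c i j
    by (rule elementary_L2_cell[OF hess_elementary])
  have ww: "hessian_form (interior (cube h c)) w w
      = (\<Sum>i\<in>UNIV. \<Sum>j\<in>UNIV. \<integral>x. hess c i j x * hess c i j x \<partial>cell_measure c)" if c: "c \<in> centres" for c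
    using hessian_form_eq_sum_AE[OF cell_sets HL wd_w[OF c] HL wd_w[OF c]] by (simp only: L2_inner_def)
  have uw: "hessian_form (interior (cube h c)) u w
      = (\<Sum>i\<in>UNIV. \<Sum>j\<in>UNIV. \<integral>x. D [i, j] x * hess c i j x \<partial>cell_measure c)" if c: "c \<in> centres" for c
    using hessian_form_eq_sum_AE[OF cell_sets DL[OF c] wd_u[OF c] HL wd_w[OF c]] by (simp only: L2_inner_def)
  have form: "broken_form \<T> u w
      = (\<Sum>i\<in>UNIV. \<Sum>j\<in>UNIV. pairing (D [i, j]) (\<lambda>c. hess c i j))"
  proof -
    have "broken_form \<T> u w = (\<Sum>c\<in>centres. \<Sum>i\<in>UNIV. \<Sum>j\<in>UNIV. \<integral>x. D [i, j] x * hess c i j x \<partial>cell_measure c)"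
      unfolding broken_form_def sum_cells by (rule sum.cong[OF refl uw])
    also have "\<dots> = (\<Sum>i\<in>UNIV. \<Sum>c\<in>centres. \<Sum>j\<in>UNIV. \<integral>x. D [i, j] x * hess c i j x \<partial>cell_measure c)"
      by (rule sum.swap)
    also have "\<dots> = (\<Sum>i\<in>UNIV. \<Sum>j\<in>UNIV. pairing (D [i, j]) (\<lambda>c. hess c i j))"
      by (rule sum.cong[OF refl]) (rule sum.swap)
    finally show ?thesis .
  qed
  have load: "L2_inner \<Omega> f w = pairing f q + pairing f b"
  proof -
    have "(\<integral>x. f x * w x \<partial>cell_measure c) = (\<integral>x. f x * q c x \<partial>cell_measure c) + (\<integral>x. f x * b c x \<partial>cell_measure c)"
      if c: "c \<in> centres" for c
    proof -
      have "AE x in cell_measure c. f x * w x = f x * q c x + f x * b c x"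
        using shape[OF c] by eventually_elim (simp add: distrib_left)
      then have "(\<integral>x. f x * w x \<partial>cell_measure c) = (\<integral>x. f x * q c x + f x * b c x \<partial>cell_measure c)"
        by (rule integral_cong_AE[OF borel_measurable_integrable[OF L2_mult_integrable[OF L2_cell[OF f c] L2_cell[OF w c]]]
            borel_measurable_integrable[OF Bochner_Integration.integrable_add[OF cell_integrable[OF f c q_elementary]
              cell_integrable[OF f c b_elementary]]]])
      also have "\<dots> = (\<integral>x. f x * q c x \<partial>cell_measure c) + (\<integral>x. f x * b c x \<partial>cell_measure c)"
        by (rule Bochner_Integration.integral_add[OF cell_integrable[OF f c q_elementary] cell_integrable[OF f c b_elementary]])
      finally show ?thesis .
    qed
    then show ?thesis
      unfolding L2_inner_def integral_centres[OF L2_mult_integrable[OF f w]] sum.distrib[symmetric]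
      by (rule sum.cong[OF refl])
  qed
  define W where "W = sqrt (\<Sum>c\<in>centres. (coef_size c)\<^sup>2 * (\<integral>x. 1 \<partial>cell_measure c))"
  define s4 where "s4 = sobolev_seminorm 4 \<Omega> u"
  define C where "C i k = pairing (D [i, i, i, k]) (\<lambda>c. corr c i k)" for i k
  define R where "R = pairing f b"
  have "0 \<le> (\<Sum>c\<in>centres. (coef_size c)\<^sup>2 * (\<integral>x. 1 \<partial>cell_measure c))"
    by (intro sum_nonneg mult_nonneg_nonneg zero_le_power2 integral_nonneg_AE) simp
  then have W: "0 \<le> W" unfolding W_def by (rule real_sqrt_ge_zero)
  have Cb: "- C i k \<le> s4 * W" for i k
  proof -
    have "\<bar>C i k\<bar> \<le> L2_norm \<Omega> (D [i, i, i, k]) * W"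
      unfolding C_def W_def by (rule sum_cell_integrals_le[OF U_L2[OF u] corr_elementary corr_bound]) simp_all
    also have "\<dots> \<le> s4 * W"
      unfolding s4_def by (rule mult_right_mono[OF L2_norm_le_sobolev_seminorm W]) simp
    finally show ?thesis by linarith
  qed
  have Rb: "- R \<le> L2_norm \<Omega> f * W"
  proof -
    have "\<bar>R\<bar> \<le> L2_norm \<Omega> f * W"
      unfolding R_def W_def by (rule sum_cell_integrals_le[OF f b_elementary b_bound])
    then show ?thesis by linarith
  qed
  have nf: "0 \<le> L2_norm \<Omega> f"
    unfolding L2_norm_def L2_inner_def by (intro real_sqrt_ge_zero integral_nonneg_AE) simp
  have "broken_form \<T> u w - L2_inner \<Omega> f w = - (\<Sum>i\<in>UNIV. \<Sum>k\<in>UNIV. C i k) - R"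
    using consistency_identity unfolding form load C_def R_def by linarith
  also have "\<dots> = (\<Sum>i\<in>UNIV. \<Sum>k\<in>UNIV. - C i k) - R" by (simp add: sum_negf)
  also have "\<dots> \<le> (\<Sum>i\<in>(UNIV :: 3 set). \<Sum>k\<in>(UNIV :: 3 set). s4 * W) + L2_norm \<Omega> f * W"
  proof -
    have "(\<Sum>i\<in>UNIV. \<Sum>k\<in>UNIV. - C i k) \<le> (\<Sum>i\<in>(UNIV :: 3 set). \<Sum>k\<in>(UNIV :: 3 set). s4 * W)"
      by (intro sum_mono Cb)
    then show ?thesis using Rb by linarith
  qed
  also have "\<dots> = 9 * s4 * W + L2_norm \<Omega> f * W" by simp
  also have "\<dots> \<le> 9 * (L2_norm \<Omega> f + s4) * W"
    using mult_nonneg_nonneg[OF nf W] by (simp add: algebra_simps)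
  also have "\<dots> \<le> 9 * (L2_norm \<Omega> f + s4) * (3 * h\<^sup>2 * broken_seminorm \<T> w)"
  proof (rule mult_left_mono)
    show "W \<le> 3 * h\<^sup>2 * broken_seminorm \<T> w" unfolding W_def by (rule sum_coef_size_le[OF ww])
    have "0 \<le> s4" unfolding s4_def sobolev_seminorm_def by (intro real_sqrt_ge_zero sum_nonneg) simp
    then show "0 \<le> 9 * (L2_norm \<Omega> f + s4)" using nf by simp
  qed
  also have "\<dots> = 27 * h\<^sup>2 * (L2_norm \<Omega> f + sobolev_seminorm 4 \<Omega> u) * broken_seminorm \<T> w"
    by (simp add: s4_def)
  finally show ?thesis .
qed

end

end

theorem theorem5p4:
  fixes \<Omega> :: "(real^3) set"
  assumes "bounded \<Omega>" and "lipschitz_domain \<Omega>"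
  shows "\<exists>C>0. \<forall>(h :: real) \<T> f u w\<^sub>h.
    h > 0 \<longrightarrow> uniform_cube_partition \<Omega> h \<T> \<longrightarrow>
    f \<in> L2 \<Omega> \<longrightarrow>
    u \<in> sobolev0 2 \<Omega> \<longrightarrow> (\<forall>v\<in>sobolev0 2 \<Omega>. hessian_form \<Omega> u v = L2_inner \<Omega> f v) \<longrightarrow>
    u \<in> sobolev 4 \<Omega> \<longrightarrow>
    w\<^sub>h \<in> morley_space \<Omega> \<T> \<longrightarrow>
    broken_form \<T> u w\<^sub>h - L2_inner \<Omega> f w\<^sub>h
      \<le> C * h\<^sup>2 * (L2_norm \<Omega> f + sobolev_seminorm 4 \<Omega> u) * broken_seminorm \<T> w\<^sub>h"
\<comment> \<open>The explicit constant of \<open>consistency_error\<close>, the same for every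
  domain.\<close>
proof (rule exI[of _ 27], intro conjI allI impI)
  fix h :: real and \<T> f u w
  assume h: "h > 0" and part: "uniform_cube_partition \<Omega> h \<T>" and f: "f \<in> L2 \<Omega>"
    and var: "\<forall>v\<in>sobolev0 2 \<Omega>. hessian_form \<Omega> u v = L2_inner \<Omega> f v"
    and u: "u \<in> sobolev 4 \<Omega>" and w: "w \<in> morley_space \<Omega> \<T>"
  have op: "open \<Omega>" using assms(2) by (simp add: lipschitz_domain_def)
  have mesh: "cube_mesh \<Omega> h \<T>"
    by (intro cube_mesh.intro op assms(1) lipschitz_domain_interior_closure[OF assms(2)] h part)
  obtain a d l g \<alpha> \<beta> where M: "morley_function \<Omega> h \<T> a d l g \<alpha> \<beta>"
    and AE: "\<And>c. cube h c \<in> \<T> \<Longrightarrow>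
      AE x in lebesgue_on (cube h c). w x = trilinear h c (a c) (l c) (g c) (d c) x + bubble h c (\<alpha> c) (\<beta> c) x"
    using morley_space_function[OF mesh w] by blast
  interpret morley_function \<Omega> h \<T> a d l g \<alpha> \<beta> by (rule M)
  have "w \<in> L2 \<Omega>" using w by (simp add: morley_space_def)
  moreover have "AE x in cell_measure c. w x = q c x + b c x" if c: "c \<in> centres" for c
  proof -
    have "cube h c \<in> sets lebesgue" by (simp add: cube_def)
    then have "AE x in lebesgue. x \<in> cube h c \<longrightarrow> w x = q c x + b c x"
      using AE[of c] c by (simp add: centres_def q_def b_def lebesgue_on_AE_iff)
    then have "AE x in lebesgue. x \<in> interior (cube h c) \<longrightarrow> w x = q c x + b c x"
      by eventually_elim (use interior_subset in blast)
    then show ?thesis by (simp only: lebesgue_on_AE_iff[OF open_sets_lebesgue[OF open_interior]])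
  qed
  ultimately show "broken_form \<T> u w - L2_inner \<Omega> f w
      \<le> 27 * h\<^sup>2 * (L2_norm \<Omega> f + sobolev_seminorm 4 \<Omega> u) * broken_seminorm \<T> w"
    by (rule consistency_error[OF u f biharmonic_strong_form[OF op assms(1) u f var]])
qed simp

end
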